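(* Let $\dot y\in\mathcal P^{++}_2(\mathcal N,\pi_y)$ be such that $\mathbb E_\pi[\Lambda_y]=1$ and $$\mathbb E_\pi\Big[\int_0^\infty\mathfrak m\big(\dot y^*(s)-1\big)\,ds\Big]<\infty.$$ If $\mathbf Y^\#\pi\ll\pi$, then $$H(\mathbf Y^\#\pi\,|\,\pi)\le\mathbb E_\pi\Big[\int_0^\infty\mathfrak m\big(\dot y^*(s)-1\big)\,ds\Big].$$ Moreover, $\mathbf Y$ is left invertible if and only if $$H(\mathbf Y^\#\pi\,|\,\pi)=\mathbb E_\pi\Big[\int_0^\infty\mathfrak m\big(\dot y^*(s)-1\big)\,ds\Big].$$
   Context: $\mathfrak N$ denotes the set of locally finite simple configurations on $(0,\infty)$, identified with counting paths; $N$ is the canonical process, $\mathcal N_t=\sigma(N(s),s\le t)$, $\mathcal N_\infty=\bigvee_t\mathcal N_t$. $\pi_y$ is the unique probability on $(\mathfrak N,\mathcal N_\infty)$ under which $N-y$ is an $\mathcal N$-local martingale; $\pi=\pi_{\mathrm{Id}}$ is the unit rate Poisson law. $\mathcal P^{++}(\mathcal N)$ is the set of positive $\mathcal N$-predictable processes $\dot y$ such that, $\pi$-a.s., $y(t):=\int_0^t\dot y(s)ds<\infty$ for all $t$ and $y(t)\to\infty$; $y^*(N,t)=\inf\{s:y(N,s)>t\}$ and $\dot y^*$ is its derivative. $\mathcal P^{++}_2(\mathcal N,\mu)$: those $\dot y$ with $\mu(\int_0^\infty(1-\sqrt{\dot y(s)})^2ds<\infty)=1$. $\Lambda_y=\exp\big(\int_0^\infty\log\dot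 y(N,s)\,dN(s)+\int_0^\infty(1-\dot y(N,s))\,ds\big)$. $\mathbf Y(N)=Y$ with $Y(t)=N(y^*(N,t))$; $\mathbf Y^\#\pi$ its image measure. $\mathbf Y$ is left invertible if $\mathbf Y^\#\pi\ll\pi$ and there is a measurable $\mathbb Z:\mathfrak N\to\mathfrak N$ with $\mathbb Z\circ\mathbf Y=\mathrm{Id}_{\mathfrak N}$ $\pi$-a.s. $\mathfrak m(x)=(x+1)\log(x+1)-x$ for $x>-1$ and $\mathfrak m(-1)=1$. $H(\nu|\mu)=\mathbb E_\nu[\log\frac{d\nu}{d\mu}|_{\mathcal N_\infty}]$ if $\nu\ll\mu$, and $+\infty$ otherwise. *)

theory Defs
  imports "HOL-Probability.Probability"
begin

type_synonym cpath = "real \<Rightarrow> nat"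

text \<open>Locally finite simple configurations on (0,oo), identified with their counting
  paths N(t) = number of points in (0,t]; N t = 0 for t <= 0.\<close>
definition paths :: "cpath set" where
  "paths = {N. (\<forall>t\<le>0. N t = 0) \<and> mono N
      \<and> (\<forall>t. \<exists>e>0. \<forall>s. t \<le> s \<and> s < t + e \<longrightarrow> N s = N t)
      \<and> (\<forall>t. \<exists>e>0. \<forall>s. t - e < s \<and> s < t \<longrightarrow> N t \<le> N s + 1)}"

definition Nsig :: "real \<Rightarrow> cpath measure" where
  "Nsig t = sigma paths {{N \<in> paths. N s = k} | s k. s \<le> t}"

definition Ninf :: "cpath measure" where
  "Ninf = sigma paths {{N \<in> paths. N s = k} | s k. True}"

definition predictable :: "(real \<times> cpath) measure" where
  "predictable = sigma ({0<..} \<times> paths)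
     {{s<..t} \<times> A | s t A. 0 \<le> s \<and> s \<le> t \<and> A \<in> sets (Nsig s)}"

definition pp_stopping :: "(cpath \<Rightarrow> real) \<Rightarrow> bool" where
  "pp_stopping T \<longleftrightarrow> (\<forall>N\<in>paths. 0 \<le> T N) \<and> (\<forall>t\<ge>0. {N \<in> paths. T N \<le> t} \<in> sets (Nsig t))"

definition pp_martingale :: "cpath measure \<Rightarrow> (cpath \<Rightarrow> real \<Rightarrow> real) \<Rightarrow> bool" where
  "pp_martingale \<mu> X \<longleftrightarrow>
     (\<forall>t\<ge>0. integrable \<mu> (\<lambda>N. X N t) \<and> (\<lambda>N. X N t) \<in> borel_measurable (Nsig t)) \<and>
     (\<forall>s t A. 0 \<le> s \<longrightarrow> s \<le> t \<longrightarrow> A \<in> sets (Nsig s) \<longrightarrow>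
        (LINT N:A|\<mu>. X N t) = (LINT N:A|\<mu>. X N s))"

definition pp_local_martingale :: "cpath measure \<Rightarrow> (cpath \<Rightarrow> real \<Rightarrow> real) \<Rightarrow> bool" where
  "pp_local_martingale \<mu> X \<longleftrightarrow>
     (\<exists>T :: nat \<Rightarrow> cpath \<Rightarrow> real.
        (\<forall>n. pp_stopping (T n)) \<and> (\<forall>n. \<forall>N\<in>paths. T n N \<le> T (Suc n) N) \<and>
        (AE N in \<mu>. filterlim (\<lambda>n. T n N) at_top sequentially) \<and>
        (\<forall>n. pp_martingale \<mu> (\<lambda>N t. X N (min t (T n N)))))"

definition yint :: "(cpath \<Rightarrow> real \<Rightarrow> real) \<Rightarrow> cpath \<Rightarrow> real \<Rightarrow> real" where
  "yint ydot N t = enn2real (\<integral>\<^sup>+ s. ennreal (ydot N s) * indicator {0<..t} s \<partial>lborel)"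

definition pi_y :: "(cpath \<Rightarrow> real \<Rightarrow> real) \<Rightarrow> cpath measure" where
  "pi_y ydot = (THE \<mu>. sets \<mu> = sets Ninf \<and> prob_space \<mu> \<and>
       pp_local_martingale \<mu> (\<lambda>N t. real (N t) - yint ydot N t))"

text \<open>The unit rate Poisson law pi = pi_Id.\<close>
definition Ppi :: "cpath measure" where
  "Ppi = pi_y (\<lambda>N s. 1)"

definition Ppp :: "(cpath \<Rightarrow> real \<Rightarrow> real) \<Rightarrow> bool" where
  "Ppp ydot \<longleftrightarrow> (\<lambda>(s, N). ydot N s) \<in> borel_measurable predictable \<and>
     (\<forall>N\<in>paths. \<forall>s>0. 0 < ydot N s) \<and>
     (AE N in Ppi. (\<forall>t. (\<integral>\<^sup>+ s. ennreal (ydot N s) * indicator {0<..t} s \<partial>lborel) < \<infinity>) \<and>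
        filterlim (yint ydot N) at_top at_top)"

definition Ppp2 :: "(cpath \<Rightarrow> real \<Rightarrow> real) \<Rightarrow> cpath measure \<Rightarrow> bool" where
  "Ppp2 ydot \<mu> \<longleftrightarrow> Ppp ydot \<and>
     (AE N in \<mu>. (\<integral>\<^sup>+ s. ennreal ((1 - sqrt (ydot N s))\<^sup>2) * indicator {0<..} s \<partial>lborel) < \<infinity>)"

definition ystar :: "(cpath \<Rightarrow> real \<Rightarrow> real) \<Rightarrow> cpath \<Rightarrow> real \<Rightarrow> real" where
  "ystar ydot N t = Inf {s. yint ydot N s > t}"

definition ydstar :: "(cpath \<Rightarrow> real \<Rightarrow> real) \<Rightarrow> cpath \<Rightarrow> real \<Rightarrow> real" where
  "ydstar ydot N s = (if ystar ydot N differentiable (at s) then deriv (ystar ydot N) s else 0)"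

definition jumps :: "cpath \<Rightarrow> real set" where
  "jumps N = {x. 0 < x \<and> (\<forall>s<x. N s < N x)}"

definition Lambda :: "(cpath \<Rightarrow> real \<Rightarrow> real) \<Rightarrow> cpath \<Rightarrow> real" where
  "Lambda ydot N = Lim at_top (\<lambda>t. exp ((\<Sum>x\<in>jumps N \<inter> {0<..t}. ln (ydot N x))
                                        + (LINT s:{0<..t}|lborel. 1 - ydot N s)))"

definition mfun :: "real \<Rightarrow> real" where
  "mfun x = (if x = -1 then 1 else (x + 1) * ln (x + 1) - x)"

definition Emm :: "(cpath \<Rightarrow> real \<Rightarrow> real) \<Rightarrow> ennreal" where
  "Emm ydot = (\<integral>\<^sup>+ N. (\<integral>\<^sup>+ s. ennreal (mfun (ydstar ydot N s - 1)) * indicator {0<..} s \<partial>lborel) \<partial>Ppi)"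

text \<open>The map Y(N)(t) = N(y*(N,t)) (replaced by the empty configuration on the
  pi-null set where it fails to be a configuration).\<close>
definition Ymap :: "(cpath \<Rightarrow> real \<Rightarrow> real) \<Rightarrow> cpath \<Rightarrow> cpath" where
  "Ymap ydot N = (let Y = (\<lambda>t. if t \<le> 0 then 0 else N (ystar ydot N t))
                  in if Y \<in> paths then Y else (\<lambda>_. 0))"

definition relent :: "cpath measure \<Rightarrow> cpath measure \<Rightarrow> ereal" where
  "relent \<nu> \<mu> = (if absolutely_continuous \<mu> \<nu>
     then enn2ereal (\<integral>\<^sup>+ x. ennreal (ln (enn2real (RN_deriv \<mu> \<nu> x))) \<partial>\<nu>)
        - enn2ereal (\<integral>\<^sup>+ x. ennreal (- ln (enn2real (RN_deriv \<mu> \<nu> x))) \<partial>\<nu>)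
     else \<infinity>)"

definition left_invertible :: "(cpath \<Rightarrow> real \<Rightarrow> real) \<Rightarrow> bool" where
  "left_invertible ydot \<longleftrightarrow> absolutely_continuous Ppi (distr Ppi Ninf (Ymap ydot)) \<and>
     (\<exists>Z \<in> measurable Ninf Ninf. AE N in Ppi. Z (Ymap ydot N) = N)"

end

theory Submission
  imports Defs "HOL-Probability.Probability"
begin

text \<open>
  Under \<open>\<pi>\<close> the inter-arrival times \<open>w 0, w 1, \<dots>\<close> are independent and exponentially distributed, by
  Watanabe's characterisation. Predictability makes the intensity after the \<open>n\<close>-th jump a function
  \<open>a n w s\<close> of the first \<open>n\<close> gaps and of the elapsed time \<open>s\<close>, and \<open>Ymap\<close> replaces the gap \<open>w n\<close> by the
  integral of \<open>a n w\<close> over \<open>(0, w n]\<close>, which is strictly increasing in \<open>w n\<close>. So the old gaps are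
  recovered one after the other from the new ones. Changing variables one gap at a time, and using
  \<open>E \<Lambda> = 1\<close> to pass to the limit, the new gaps are again independent exponential under \<open>\<Lambda> \<pi>\<close>.
  Therefore \<open>Ymap\<close> always has a left inverse \<open>Z\<close>, its law has the density \<open>1 / \<Lambda>(Z)\<close>, and its relative entropy
  is \<open>- E ln \<Lambda>\<close>. Compensating the jumps, this is the mean of the integral of \<open>x - 1 - ln x\<close> at the intensity,
  and the substitution \<open>t = y\<^sup>*(s)\<close> turns the latter into \<open>Emm\<close>.
\<close>

section \<open>Integrated rates and their inverses\<close>

text \<open>Finite entropy controls \<open>log_gap x = x - 1 - ln x\<close>, which is only quadratic
  at \<open>x = 1\<close>. The logarithms in \<open>Lambda\<close> therefore need not be absolutely
  summable, and their limit exists only after compensation. It is taken along the jump times;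
  between jumps the likelihood still drifts, and that drift has to be shown to vanish as well.

  Along an observed path \<open>y\<close> tends to infinity, but this says nothing about the
  intensity continued past an observed gap. That continuation is what the change of variables in one
  gap sees: if its total integral is finite, the new gap fills only a bounded interval and
  exponential mass is lost. The likelihood loses exactly this amount of expectation. So
  \<open>E Lambda = 1\<close> serves twice: it gives convergence of the likelihoods in L1, and it
  makes each integrated rate a bijection of the half line, as the reconstruction of the old gaps
  requires.

  Conditioning on the past is expressed by resampling a single gap, which also carries almost sure
  properties of an observed gap over to gaps that did not occur.\<close>

lemma pred_in_Ioc [measurable (raw)]:
  fixes f g h :: "'a \<Rightarrow> real"
  assumes [measurable]: "f \<in> borel_measurable M" "g \<in> borel_measurable M" "h \<in> borel_measurable M"
  shows "Measurable.pred M (\<lambda>x. h x \<in> {f x<..g x})"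
  unfolding greaterThanAtMost_iff by measurable

lemma pred_in_Ici [measurable (raw)]:
  fixes f h :: "'a \<Rightarrow> real"
  assumes [measurable]: "f \<in> borel_measurable M" "h \<in> borel_measurable M"
  shows "Measurable.pred M (\<lambda>x. h x \<in> {f x..})"
  unfolding atLeast_iff by measurable

text \<open>One half of Lebesgue's differentiation theorem, from Vitali's covering theorem.\<close>

lemma negligible_upper_density:
  fixes f :: "real \<Rightarrow> real"
  assumes f: "integrable lborel f" and pq: "p < q"
  shows "negligible {x. f x < p \<and> (\<forall>d>0. \<exists>u v. u \<le> x \<and> x \<le> v \<and> u < v \<and> v - u < d \<and>
           q * (v - u) < (LINT y:{u..v}|lborel. f y))}" (is "negligible ?E")
proof -
  have [measurable]: "f \<in> borel_measurable borel" using f by auto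
  have neg: "negligible (?E \<inter> {-real K<..<real K})" for K :: nat
  proof (rule negligible_outer_le[THEN iffD2, rule_format])
    fix e :: real assume e: "e > 0"
    \<comment> \<open>\<open>M\<close> carries the positive part of \<open>f - p\<close> on a
      bounded window, hence is finite and outer regular. It gives no mass to \<open>B\<close>, where
      \<open>f < p\<close>, so \<open>B\<close> lies in an open set of arbitrarily small
      \<open>M\<close>-mass.\<close>
    define M where "M = density lborel (\<lambda>x. ennreal (f x - p) * indicator {-real K<..<real K} x)"
    have [simp]: "sets M = sets borel" "space M = UNIV" by (auto simp: M_def)
    have "emeasure M (space M) = (\<integral>\<^sup>+x. ennreal (f x - p) * indicator {-real K<..<real K} x \<partial>lborel)"
      unfolding M_def by (subst emeasure_density) auto
    also have "\<dots> \<le> (\<integral>\<^sup>+x. ennreal (norm (f x)) + ennreal \<bar>p\<bar> * indicator {-real K<..<real K} x \<partial>lborel)"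
      by (intro nn_integral_mono) (auto simp: indicator_def ennreal_plus[symmetric] simp del: ennreal_plus intro!: ennreal_leI)
    also have "\<dots> = (\<integral>\<^sup>+x. ennreal (norm (f x)) \<partial>lborel) + ennreal \<bar>p\<bar> * emeasure lborel {-real K<..<real K}"
      by (subst nn_integral_add) (auto simp: nn_integral_cmult)
    also have "\<dots> < \<infinity>"
      using f by (auto simp: integrable_iff_bounded ennreal_mult_less_top)
    finally have fin: "emeasure M (space M) \<noteq> \<infinity>" by simp
    define B where "B = {x. f x < p}"
    have [measurable]: "B \<in> sets borel" unfolding B_def by measurable
    have "emeasure M B = (\<integral>\<^sup>+x. ennreal (f x - p) * indicator {-real K<..<real K} x * indicator B x \<partial>lborel)"
      unfolding M_def by (subst emeasure_density) auto
    also have "\<dots> = (\<integral>\<^sup>+x. 0 \<partial>(lborel::real measure))"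
      by (intro nn_integral_cong) (auto simp: B_def indicator_def ennreal_neg)
    finally have "emeasure M B = 0" by simp
    moreover have "emeasure M B = (INF U\<in>{U. B \<subseteq> U \<and> open U}. emeasure M U)"
      by (rule outer_regular) (use fin in \<open>auto simp: B_def\<close>)
    ultimately have "(INF U\<in>{U. B \<subseteq> U \<and> open U}. emeasure M U) < ennreal (e * (q - p))"
      using e pq by simp
    then obtain U where U: "B \<subseteq> U" "open U" "emeasure M U < ennreal (e * (q - p))"
      by (auto simp: INF_less_iff)
    define W where "W = U \<inter> {-real K<..<real K}"
    have "open W" using U by (auto simp: W_def)
    \<comment> \<open>Only intervals inside \<open>W\<close> enter the Vitali cover: there
      \<open>M\<close> has the full positive part of \<open>f - p\<close> as density, and any
      disjoint selection stays in the set \<open>U\<close> of small mass.\<close>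
    define I where "I = {(u,v). u < v \<and> {u..v} \<subseteq> W \<and> q * (v - u) < (LINT y:{u..v}|lborel. f y)}"
    define a where "a = (\<lambda>(u::real,v::real). (u+v)/2)"
    define r where "r = (\<lambda>(u::real,v::real). (v-u)/2)"
    have cb: "cball (a (u,v)) (r (u,v)) = {u..v}" for u v
      by (auto simp: a_def r_def cball_eq_atLeastAtMost field_simps)
    have rp: "0 < r i" if "i \<in> I" for i using that by (auto simp: I_def r_def)
    have cov: "\<exists>i. i \<in> I \<and> x \<in> cball (a i) (r i) \<and> r i < d"
      if x: "x \<in> ?E \<inter> {-real K<..<real K}" and d: "0 < d" for x d
    proof -
      have "x \<in> W" using x U(1) by (auto simp: W_def B_def)
      then obtain d' where d': "d' > 0" "ball x d' \<subseteq> W" using \<open>open W\<close> open_contains_ball by blast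
      have "min d d' > 0" using d d' by auto
      then obtain u v where uv: "u \<le> x" "x \<le> v" "u < v" "v - u < min d d'" "q * (v - u) < (LINT y:{u..v}|lborel. f y)"
        using x by blast
      have "{u..v} \<subseteq> ball x d'" using uv by (auto simp: dist_real_def)
      then have "(u,v) \<in> I" using uv d' by (auto simp: I_def)
      moreover have "x \<in> cball (a (u,v)) (r (u,v))" using uv cb by auto
      moreover have "r (u,v) < d" using uv by (auto simp: r_def)
      ultimately show ?thesis by blast
    qed
    obtain C where C: "countable C" "C \<subseteq> I"
     "pairwise (\<lambda>i j. disjnt (cball (a i) (r i)) (cball (a j) (r j))) C"
     "negligible((?E \<inter> {-real K<..<real K}) - (\<Union>i \<in> C. cball (a i) (r i)))"
      by (rule Vitali_covering_theorem_cballs[of I r "?E \<inter> {-real K<..<real K}" a])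
         (use rp cov in blast)+
    define V where "V = (\<Union>i \<in> C. cball (a i) (r i))"
    have [measurable]: "V \<in> sets borel" unfolding V_def using C(1) by auto
    have dj: "disjoint_family_on (\<lambda>i. cball (a i) (r i)) C"
      using C(3) by (auto simp: disjoint_family_on_def pairwise_def disjnt_def)
    \<comment> \<open>The mean of \<open>f\<close> over the interval exceeds \<open>q\<close>, so
      \<open>f - p\<close> integrates to more than \<open>q - p\<close> times the length, and its
      positive part to at least as much.\<close>
    have le: "ennreal (q - p) * emeasure lborel (cball (a i) (r i)) \<le> emeasure M (cball (a i) (r i))" if "i \<in> C" for i
    proof -
      obtain u v where i: "i = (u,v)" by (cases i)
      with that C(2) have uv: "u < v" "{u..v} \<subseteq> W" "q * (v - u) < (LINT y:{u..v}|lborel. f y)" by (auto simp: I_def)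
      have sf: "set_integrable lborel {u..v} f"
        unfolding set_integrable_def by (rule integrable_mult_indicator[OF _ f]) simp
      have sp: "set_integrable lborel {u..v} (\<lambda>_. p)"
        unfolding set_integrable_def using emeasure_lborel_Icc[of u v] uv
        by (intro integrable_scaleR_left) (auto simp: integrable_indicator_iff)
      have sd: "integrable lborel (\<lambda>y. indicator {u..v} y *\<^sub>R (f y - p))"
        using set_integral_diff(1)[OF sf sp] unfolding set_integrable_def .
      have "(LINT y:{u..v}|lborel. p) = p * (v - u)"
        using uv by (simp add: set_lebesgue_integral_def)
      then have "(q - p) * (v - u) \<le> (LINT y:{u..v}|lborel. f y - p)"
        using uv set_integral_diff(2)[OF sf sp] by (simp add: algebra_simps)
      also have "\<dots> \<le> enn2real (\<integral>\<^sup>+y. ennreal (indicator {u..v} y *\<^sub>R (f y - p)) \<partial>lborel)"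
        unfolding set_lebesgue_integral_def by (subst real_lebesgue_integral_def[OF sd]) simp
      also have "(\<integral>\<^sup>+y. ennreal (indicator {u..v} y *\<^sub>R (f y - p)) \<partial>lborel) = emeasure M {u..v}"
        unfolding M_def using uv
        by (subst emeasure_density) (auto intro!: nn_integral_cong simp: indicator_def W_def)
      finally have "ennreal ((q - p) * (v - u)) \<le> ennreal (enn2real (emeasure M {u..v}))"
        by (rule ennreal_leI)
      also have "\<dots> = emeasure M {u..v}"
        using fin emeasure_space[of M "{u..v}"] by (intro ennreal_enn2real) (auto simp: top.not_eq_extremum)
      finally show ?thesis using uv pq by (simp add: i cb ennreal_mult)
    qed
    have "ennreal (q - p) * emeasure lborel V = (\<integral>\<^sup>+i. ennreal (q - p) * emeasure lborel (cball (a i) (r i)) \<partial>count_space C)"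
      unfolding V_def by (subst emeasure_UN_countable) (auto simp: C dj nn_integral_cmult)
    also have "\<dots> \<le> (\<integral>\<^sup>+i. emeasure M (cball (a i) (r i)) \<partial>count_space C)"
      by (intro nn_integral_mono) (auto simp: le)
    also have "\<dots> = emeasure M V"
      unfolding V_def by (subst emeasure_UN_countable) (auto simp: C dj)
    also have "\<dots> \<le> emeasure M U"
    proof (rule emeasure_mono)
      show "V \<subseteq> U" unfolding V_def
      proof (rule UN_least)
        fix i assume "i \<in> C"
        then show "cball (a i) (r i) \<subseteq> U" using C(2) cb by (cases i) (auto simp: I_def W_def)
      qed
      show "U \<in> sets M" using U by auto
    qed
    also note U(3)
    finally have 1: "ennreal (q - p) * emeasure lborel V < ennreal (e * (q - p))" .
    have Vf: "emeasure lborel V < \<infinity>" 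
    proof (rule ccontr)
      assume "\<not> ?thesis"
      then have "emeasure lborel V = \<infinity>" by (simp add: less_top[symmetric])
      with 1 pq show False by (simp add: ennreal_mult_eq_top_iff ennreal_mult_top)
    qed
    have Ve: "emeasure lborel V < ennreal e"
    proof (rule ccontr)
      assume "\<not> ?thesis"
      then have "ennreal (q - p) * ennreal e \<le> ennreal (q - p) * emeasure lborel V" by (intro mult_left_mono) auto
      with 1 e pq show False by (simp add: ennreal_mult[symmetric] mult.commute)
    qed
    let ?Z = "(?E \<inter> {-real K<..<real K}) - V"
    have "V \<in> lmeasurable" using Vf by (auto simp: fmeasurable_def)
    moreover have negZ: "negligible ?Z" using C(4) by (simp add: V_def)
    ultimately have "V \<union> ?Z \<in> lmeasurable" "measure lebesgue (V \<union> ?Z) \<le> measure lebesgue V + measure lebesgue ?Z"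
      unfolding negligible_iff_measure
      by (blast intro: fmeasurable.Un, blast intro: measure_Un_le fmeasurableD)
    moreover have "measure lebesgue ?Z = 0" using negZ by (simp add: negligible_iff_measure)
    moreover have "measure lebesgue V \<le> e" 
      using Ve Vf e by (simp add: measure_def enn2real_leI less_imp_le)
    ultimately show "\<exists>T. ?E \<inter> {-real K<..<real K} \<subseteq> T \<and> T \<in> lmeasurable \<and> measure lebesgue T \<le> e"
      by (intro exI[of _ "V \<union> ?Z"]) auto
  qed
  have "?E = (\<Union>K::nat. ?E \<inter> {-real K<..<real K})"
  proof -
    have "\<exists>K::nat. x \<in> {-real K<..<real K}" for x :: real
      using reals_Archimedean2[of "\<bar>x\<bar>"] by (auto simp: abs_less_iff) (metis minus_less_iff)
    then show ?thesis by blast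
  qed
  moreover have "negligible (\<Union>K::nat. ?E \<inter> {-real K<..<real K})"
    by (rule negligible_countable_Union) (use neg in auto)
  ultimately show ?thesis by (simp only:)
qed

text \<open>Where the difference quotients do not tend to \<open>f x\<close>, arbitrarily short
  intervals containing \<open>x\<close> have mean above a rational \<open>q\<close> with
  \<open>f x < p < q\<close>, or the same happens for \<open>- f\<close>. Both sets are negligible
  by the density lemma, and countably many rational pairs suffice. Truncation to
  \<open>{0<..K}\<close> makes \<open>f\<close> integrable on the line.\<close>

lemma AE_derivative_indefinite_integral:
  fixes f :: "real \<Rightarrow> real"
  assumes f: "\<And>t. set_integrable lborel {0<..t} f"
  shows "AE x in lborel. 0 < x \<longrightarrow> ((\<lambda>t. LINT s:{0<..t}|lborel. f s) has_real_derivative f x) (at x)"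
proof -
  define F where "F t = (LINT s:{0<..t}|lborel. f s)" for t
  define bad where "bad g p q = {x. g x < p \<and> (\<forall>d>0. \<exists>u v. u \<le> x \<and> x \<le> v \<and> u < v \<and> v - u < d \<and>
           q * (v - u) < (LINT y:{u..v}|lborel. g y))}" for g :: "real \<Rightarrow> real" and p q
  define g where "g K x = indicator {0<..real K} x *\<^sub>R f x" for K x
  have gi: "integrable lborel (g K)" for K
    using f[of "real K"] by (simp add: g_def[abs_def] set_integrable_def)
  then have gi': "integrable lborel (\<lambda>x. - g K x)" for K by simp
  have n1: "negligible (bad (g K) p q)" "negligible (bad (\<lambda>x. - g K x) p q)" if "p < q" for K p q
    unfolding bad_def using negligible_upper_density[OF gi that] negligible_upper_density[OF gi' that] by auto
  have n2: "AE x in lborel. x \<notin> S" if "negligible S" for S :: "real set"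
    using AE_not_in[of S lebesgue] that by (simp only: negligible_iff_null_sets AE_completion_iff)
  have "AE x in lborel. \<forall>K. \<forall>p\<in>\<rat>. \<forall>q\<in>\<rat>. p < q \<longrightarrow> x \<notin> bad (g K) p q \<and> x \<notin> bad (\<lambda>x. - g K x) p q"
    unfolding AE_all_countable
  proof (intro allI)
    fix K
    have "AE x in lborel. p < q \<longrightarrow> x \<notin> bad (g K) p q \<and> x \<notin> bad (\<lambda>x. - g K x) p q" for p q
    proof (cases "p < q")
      case True
      show ?thesis using n2[OF n1(1)[OF True, of K]] n2[OF n1(2)[OF True, of K]] by eventually_elim simp
    qed auto
    then show "AE x in lborel. \<forall>p\<in>\<rat>. \<forall>q\<in>\<rat>. p < q \<longrightarrow> x \<notin> bad (g K) p q \<and> x \<notin> bad (\<lambda>x. - g K x) p q"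
      by (subst AE_ball_countable[OF countable_rat], intro ballI)+ blast
  qed
  then show ?thesis
  proof eventually_elim
    case (elim x)
    show ?case
    proof
      assume x: "0 < x"
      obtain K :: nat where K: "x < real K" using reals_Archimedean2 by blast
      have gx: "g K x = f x" using x K by (simp add: g_def)
      have Fd: "F v - F u = (LINT y:{u..v}|lborel. g K y)" if "0 < u" "u \<le> v" "v \<le> real K" for u v
      proof -
        have "set_integrable lborel {0<..u} f" "set_integrable lborel {u<..v} f"
          using f[of u] set_integrable_subset[OF f[of v], of "{u<..v}"] that by (auto simp: subset_iff)
        then have "(LINT y:{0<..u} \<union> {u<..v}|lborel. f y) = F u + (LINT y:{u<..v}|lborel. f y)"
          unfolding F_def by (intro set_integral_Un) auto
        moreover have "{0<..u} \<union> {u<..v} = {0<..v}" using that by auto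
        moreover have "(LINT y:{u<..v}|lborel. f y) = (LINT y:{u..v}|lborel. g K y)"
          unfolding set_lebesgue_integral_def
        proof (rule integral_cong_AE)
          show "(\<lambda>x. indicat_real {u<..v} x *\<^sub>R f x) \<in> borel_measurable lborel"
            using \<open>set_integrable lborel {u<..v} f\<close> unfolding set_integrable_def by auto
          show "(\<lambda>x. indicat_real {u..v} x *\<^sub>R g K x) \<in> borel_measurable lborel"
            using gi[of K, THEN borel_measurable_integrable] by measurable
          show "AE x in lborel. indicat_real {u<..v} x *\<^sub>R f x = indicat_real {u..v} x *\<^sub>R g K x"
            using AE_lborel_singleton[of u] by eventually_elim (use that in \<open>auto simp: g_def indicator_def\<close>)
        qed
        ultimately show ?thesis by (simp add: F_def)
      qed
      show "((\<lambda>t. LINT s:{0<..t}|lborel. f s) has_real_derivative f x) (at x)"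
        unfolding F_def[symmetric] has_field_derivative_iff tendsto_iff
      proof (intro allI impI)
        fix e :: real assume e: "0 < e"
        \<comment> \<open>Two rationals between \<open>f x\<close> and \<open>f x + e\<close>: the
          density lemma consumes the gap between them, and \<open>q\<close> is the bound that comes
          out.\<close>
        obtain p q where pq: "p \<in> \<rat>" "q \<in> \<rat>" "f x < p" "p < q" "q < f x + e"
          using Rats_dense_in_real[of "f x" "f x + e"] e Rats_dense_in_real by (metis less_add_same_cancel1)
        obtain p' q' where pq': "p' \<in> \<rat>" "q' \<in> \<rat>" "- f x < p'" "p' < q'" "q' < - f x + e"
          using Rats_dense_in_real[of "- f x" "- f x + e"] e Rats_dense_in_real by (metis less_add_same_cancel1)
        have "x \<notin> bad (g K) p q" "x \<notin> bad (\<lambda>x. - g K x) p' q'" using elim pq pq' by auto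
        then obtain d d' where d: "d > 0" "\<And>u v. u \<le> x \<Longrightarrow> x \<le> v \<Longrightarrow> u < v \<Longrightarrow> v - u < d \<Longrightarrow> (LINT y:{u..v}|lborel. g K y) \<le> q * (v - u)"
           and d': "d' > 0" "\<And>u v. u \<le> x \<Longrightarrow> x \<le> v \<Longrightarrow> u < v \<Longrightarrow> v - u < d' \<Longrightarrow> (LINT y:{u..v}|lborel. - g K y) \<le> q' * (v - u)"
          using pq pq' gx unfolding bad_def mem_Collect_eq by (metis not_less)
        have b: "\<bar>(F v - F u) / (v - u) - f x\<bar> < e"
          if "u \<le> x" "x \<le> v" "u < v" "v - u < min d d'" "0 < u" "v \<le> real K" for u v
        proof -
          have "F v - F u \<le> q * (v - u)" using d(2)[of u v] that Fd[of u v] by auto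
          moreover have "- (F v - F u) \<le> q' * (v - u)" using d'(2)[of u v] that Fd[of u v]
            by (auto simp: set_lebesgue_integral_def)
          ultimately have "(F v - F u) / (v - u) \<le> q" "- q' \<le> (F v - F u) / (v - u)"
            using that by (auto simp: field_simps)
          then show ?thesis using pq pq' by (auto simp: abs_less_iff)
        qed
        define r where "r = min (min d d') (min x (real K - x))"
        have "r > 0" using d d' x K by (auto simp: r_def)
        show "\<forall>\<^sub>F y in at x. dist ((F y - F x) / (y - x)) (f x) < e"
          unfolding eventually_at
        proof (intro exI[of _ r] conjI ballI impI \<open>r > 0\<close>)
          fix y assume y: "y \<noteq> x \<and> dist y x < r"
          then consider "y < x" | "x < y" by linarith
          then show "dist ((F y - F x) / (y - x)) (f x) < e"
          proof cases
            case 1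
            then have "\<bar>(F x - F y) / (x - y) - f x\<bar> < e" using y by (intro b) (auto simp: r_def dist_real_def)
            moreover have "(F x - F y) / (x - y) = (F y - F x) / (y - x)"
              by (metis minus_diff_eq minus_divide_divide)
            ultimately show ?thesis by (simp add: dist_real_def)
          next
            case 2
            then show ?thesis using y b[of x y] by (auto simp: r_def dist_real_def)
          qed
        qed
      qed
    qed
  qed
qed

text \<open>The same formula as \<open>yint\<close>, for a single rate function. An infinite
  integral is turned into 0, so monotonicity holds only under finiteness.\<close>

definition cumint :: "(real \<Rightarrow> real) \<Rightarrow> real \<Rightarrow> real" where
  "cumint a t = enn2real (\<integral>\<^sup>+ s. ennreal (a s) * indicator {0<..t} s \<partial>lborel)"

lemma cumint_cong: "(\<And>s. 0 < s \<Longrightarrow> s \<le> t \<Longrightarrow> a s = b s) \<Longrightarrow> cumint a t = cumint b t"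
  unfolding cumint_def by (intro arg_cong[where f=enn2real] nn_integral_cong) (auto simp: indicator_def)

section \<open>Integrals of a positive, locally integrable rate\<close>

locale rate =
  fixes a :: "real \<Rightarrow> real"
  assumes meas[measurable]: "a \<in> borel_measurable borel"
    and pos: "\<And>s. 0 < s \<Longrightarrow> 0 < a s"
    and fin: "\<And>t. (\<integral>\<^sup>+ s. ennreal (a s) * indicator {0<..t} s \<partial>lborel) < \<infinity>"
begin

lemma ennreal_cumint: "ennreal (cumint a t) = (\<integral>\<^sup>+ s. ennreal (a s) * indicator {0<..t} s \<partial>lborel)"
  unfolding cumint_def using fin[of t] by (intro ennreal_enn2real) auto

lemma cumint_nonneg: "0 \<le> cumint a t" by (simp add: cumint_def)

lemma cumint_nonpos: "t \<le> 0 \<Longrightarrow> cumint a t = 0" by (simp add: cumint_def)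

lemma cumint_0 [simp]: "cumint a 0 = 0" by (simp add: cumint_nonpos)

lemma ennreal_cumint_diff:
  assumes "0 \<le> s" "s \<le> t"
  shows "ennreal (cumint a t) = ennreal (cumint a s) + (\<integral>\<^sup>+ x. ennreal (a x) * indicator {s<..t} x \<partial>lborel)"
  unfolding ennreal_cumint
  using assms by (subst nn_integral_add[symmetric]) (auto intro!: nn_integral_cong simp: indicator_def)

lemma cumint_mono: "s \<le> t \<Longrightarrow> cumint a s \<le> cumint a t"
proof -
  assume "s \<le> t"
  then have "ennreal (cumint a s) \<le> ennreal (cumint a t)"
    unfolding ennreal_cumint by (intro nn_integral_mono) (auto simp: indicator_def)
  then show ?thesis by (simp add: cumint_nonneg)
qed

lemma cumint_strict_mono:
  assumes "0 \<le> s" "s < t" shows "cumint a s < cumint a t"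
proof (rule ccontr)
  assume "\<not> ?thesis"
  then have "cumint a s = cumint a t" using cumint_mono[of s t] assms by auto
  then have "ennreal (cumint a s) + 0 = ennreal (cumint a s) + (\<integral>\<^sup>+ x. ennreal (a x) * indicator {s<..t} x \<partial>lborel)"
    using ennreal_cumint_diff[of s t] assms by auto
  then have "(\<integral>\<^sup>+ x. ennreal (a x) * indicator {s<..t} x \<partial>lborel) = 0"
    using ennreal_add_left_cancel[of "ennreal (cumint a s)" 0 "\<integral>\<^sup>+ x. ennreal (a x) * indicator {s<..t} x \<partial>lborel"] by auto
  then have "AE x in lborel. ennreal (a x) * indicator {s<..t} x = 0"
    by (subst (asm) nn_integral_0_iff_AE) auto
  then have "AE x in lborel. x \<notin> {s<..t}"
  proof eventually_elim
    case (elim x)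
    then show ?case using assms pos[of x] by (auto simp: indicator_def ennreal_eq_0_iff split: if_splits)
  qed
  then have "emeasure lborel {s<..t} = 0"
    by (subst (asm) AE_iff_measurable[of "{s<..t}"]) auto
  then show False using assms by auto
qed

lemma cumint_measurable [measurable]: "cumint a \<in> borel_measurable borel"
  by (rule borel_measurable_mono) (auto simp: mono_def cumint_mono)

lemma set_integrable_rate: "set_integrable lborel {0<..t} a"
  unfolding set_integrable_def
proof (rule integrableI_nonneg)
  have "(\<integral>\<^sup>+ x. ennreal (indicat_real {0<..t} x *\<^sub>R a x) \<partial>lborel) = (\<integral>\<^sup>+ s. ennreal (a s) * indicator {0<..t} s \<partial>lborel)"
    by (intro nn_integral_cong) (auto simp: indicator_def)
  then show "(\<integral>\<^sup>+ x. ennreal (indicat_real {0<..t} x *\<^sub>R a x) \<partial>lborel) < \<infinity>" using fin by simp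
qed (use pos in \<open>auto simp: indicator_def less_imp_le\<close>)

lemma cumint_eq_LINT: "cumint a t = (LINT s:{0<..t}|lborel. a s)"
proof -
  have "ennreal (LINT s:{0<..t}|lborel. a s) = (\<integral>\<^sup>+ x. ennreal (indicat_real {0<..t} x *\<^sub>R a x) \<partial>lborel)"
    unfolding set_lebesgue_integral_def
    by (rule nn_integral_eq_integral[symmetric])
       (use set_integrable_rate pos in \<open>auto simp: set_integrable_def indicator_def less_imp_le\<close>)
  also have "\<dots> = ennreal (cumint a t)" unfolding ennreal_cumint
    by (intro nn_integral_cong) (auto simp: indicator_def)
  finally show ?thesis
    by (subst (asm) ennreal_inj)
       (use pos cumint_nonneg in \<open>auto simp: set_lebesgue_integral_def indicator_def less_imp_le intro!: integral_nonneg\<close>)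
qed

lemma continuous_on_cumint: "continuous_on {0..} (cumint a)"
proof -
  have *: "continuous_on {0..T} (cumint a)" for T
  proof (cases "T \<ge> 0")
    case True
    have "set_integrable lborel {0..T} (\<lambda>s. if 0 < s then a s else 0)"
      using set_integrable_rate[of T] unfolding set_integrable_def
      by (rule Bochner_Integration.integrable_cong[OF refl, THEN iffD1, rotated]) (auto simp: indicator_def)
    then have "continuous_on {0..T} (\<lambda>x. integral {0..x} (\<lambda>s. if 0 < s then a s else 0))"
      by (intro indefinite_integral_continuous_1 set_borel_integral_eq_integral)
    moreover have "integral {0..x} (\<lambda>s. if 0 < s then a s else 0) = cumint a x" for x
    proof -
      have "set_integrable lborel {0..x} (\<lambda>s. if 0 < s then a s else 0)"
        using set_integrable_rate[of x] unfolding set_integrable_def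
        by (rule Bochner_Integration.integrable_cong[OF refl, THEN iffD1, rotated]) (auto simp: indicator_def)
      then have "integral {0..x} (\<lambda>s. if 0 < s then a s else 0) = (LINT s:{0..x}|lborel. if 0 < s then a s else 0)"
        by (rule set_borel_integral_eq_integral(2)[symmetric])
      also have "\<dots> = cumint a x" unfolding cumint_eq_LINT set_lebesgue_integral_def
        by (intro Bochner_Integration.integral_cong) (auto simp: indicator_def)
      finally show ?thesis .
    qed
    ultimately show ?thesis by simp
  qed auto
  show ?thesis unfolding continuous_on_eq_continuous_within
  proof
    fix x :: real assume x: "x \<in> {0..}"
    have "continuous (at x within {0..x+1}) (cumint a)"
      using *[of "x+1"] x by (auto simp: continuous_on_eq_continuous_within)
    moreover have "at x within {0..} = at x within {0..x+1}"
      by (rule at_within_nhd[of x "{..<x+1}"]) (use x in auto)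
    ultimately show "continuous (at x within {0..}) (cumint a)" by simp
  qed
qed

lemma cumint_attains:
  assumes "0 \<le> u" "u \<le> cumint a T"
  obtains x where "0 \<le> x" "x \<le> max 0 T" "cumint a x = u"
proof (cases "0 \<le> T")
  case True
  with IVT'[of "cumint a" 0 u T] assms continuous_on_subset[OF continuous_on_cumint, of "{0..T}"] that
  show ?thesis by auto
next
  case False
  then have "u = 0" using assms cumint_nonpos[of T] by auto
  then show ?thesis using that[of 0] False assms by (auto simp: cumint_nonpos)
qed

text \<open>Substitution \<open>u = cumint a x\<close> for a merely measurable rate. By continuity
  and strict monotonicity \<open>{cumint a <= c}\<close> ends at a point where
  \<open>cumint a\<close> is \<open>c\<close>, or is everything, so both measures agree on all half
  lines \<open>{..c}\<close>. The set on the right is the range over positive times, which is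
  bounded if the total rate is finite.\<close>

lemma distr_cumint:
  "distr (density lborel (\<lambda>x. ennreal (a x) * indicator {0<..} x)) borel (cumint a) =
   density lborel (indicator {u. 0 < u \<and> (\<exists>x. u < cumint a x)})" (is "distr ?M _ _ = ?R")
proof -
  define J where "J = {u. 0 < u \<and> (\<exists>x. u < cumint a x)}"
  have "J = {0<..} \<inter> (\<Union>x. {..<cumint a x})" by (auto simp: J_def)
  moreover have "open ({0<..} \<inter> (\<Union>x. {..<cumint a x}))" by (intro open_Int open_UN ballI) auto
  ultimately have [measurable]: "J \<in> sets borel" by simp
  have eq: "emeasure (distr ?M borel (cumint a)) {..c} = emeasure (density lborel (indicator J)) {..c}"
    and finR: "emeasure (density lborel (indicator J)) {..c} \<noteq> \<infinity>" for c
  proof -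
    have L: "emeasure (distr ?M borel (cumint a)) {..c} = (\<integral>\<^sup>+x. ennreal (a x) * indicator {x. 0 < x \<and> cumint a x \<le> c} x \<partial>lborel)"
      by (subst emeasure_distr, measurable, subst emeasure_density, measurable)
         (auto intro!: nn_integral_cong simp: indicator_def)
    have R: "emeasure (density lborel (indicator J)) {..c} = emeasure lborel (J \<inter> {..c})"
      by (subst emeasure_density) (auto simp: nn_integral_indicator[symmetric] indicator_inter_arith simp del: nn_integral_indicator)
    have Rle: "emeasure lborel (J \<inter> {..c}) \<le> emeasure lborel {0..max 0 c}"
      by (rule emeasure_mono) (auto simp: J_def)
    then show "emeasure (density lborel (indicator J)) {..c} \<noteq> \<infinity>"
      unfolding R by (auto simp: top_unique)
    have "(\<integral>\<^sup>+x. ennreal (a x) * indicator {x. 0 < x \<and> cumint a x \<le> c} x \<partial>lborel) = emeasure lborel (J \<inter> {..c})"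
    proof (cases "c < 0")
      case True
      have "{x. 0 < x \<and> cumint a x \<le> c} = {}" "J \<inter> {..c} = {}"
        using True cumint_nonneg by (auto simp: J_def) (meson dual_order.strict_trans2 not_less)
      then show ?thesis by simp
    next
      case c: False
      show ?thesis
      proof (cases "\<exists>T. c < cumint a T")
        case True
        then obtain T where T: "c < cumint a T" by blast
        obtain x where x: "0 \<le> x" "cumint a x = c" using cumint_attains[of c T] c T by auto
        have "{y. 0 < y \<and> cumint a y \<le> c} = {0<..x}"
          using x cumint_strict_mono[of x] cumint_mono by (auto simp: not_le[symmetric]) (meson not_le)+
        then have "(\<integral>\<^sup>+x. ennreal (a x) * indicator {x. 0 < x \<and> cumint a x \<le> c} x \<partial>lborel) = ennreal c"
          using ennreal_cumint[of x] x by simp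
        also have "J \<inter> {..c} = {0<..c}" using T by (auto simp: J_def intro!: exI[of _ T])
        ultimately show ?thesis using c by simp
      next
        case False
        \<comment> \<open>Here \<open>c\<close> bounds \<open>cumint a\<close>: the whole mass
          counts, and both sides are limits of \<open>cumint a n\<close> along natural
          \<open>n\<close>.\<close>
        have "{y. 0 < y \<and> cumint a y \<le> c} = {0<..}" using False by (auto simp: not_less)
        then have "(\<integral>\<^sup>+x. ennreal (a x) * indicator {x. 0 < x \<and> cumint a x \<le> c} x \<partial>lborel) = (\<integral>\<^sup>+x. ennreal (a x) * indicator {0<..} x \<partial>lborel)" by simp
        also have "\<dots> = (\<integral>\<^sup>+x. (SUP n. ennreal (a x) * indicator {0<..real n} x) \<partial>lborel)"
        proof (intro nn_integral_cong)
          fix x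
          obtain n where n: "x < real n" using reals_Archimedean2 by blast
          have "(SUP n. ennreal (a x) * indicator {0<..real n} x) = ennreal (a x) * indicator {0<..} x"
          proof (rule antisym)
            show "ennreal (a x) * indicator {0<..} x \<le> (SUP n. ennreal (a x) * indicator {0<..real n} x)"
              by (rule SUP_upper2[of n]) (use n in \<open>auto simp: indicator_def\<close>)
          qed (auto intro!: SUP_least simp: indicator_def)
          then show "ennreal (a x) * indicator {0<..} x = (SUP n. ennreal (a x) * indicator {0<..real n} x)" by simp
        qed
        also have "\<dots> = (SUP n. ennreal (cumint a (real n)))"
          unfolding ennreal_cumint
          by (rule nn_integral_monotone_convergence_SUP)
             (auto simp: incseq_def le_fun_def indicator_def)
        also have "\<dots> = emeasure lborel (J \<inter> {..c})"
        proof -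
          have "J \<inter> {..c} = (\<Union>n. {0<..<cumint a (real n)})"
          proof safe
            fix u assume "u \<in> J"
            then obtain x where x: "0 < u" "u < cumint a x" by (auto simp: J_def)
            obtain n where "x < real n" using reals_Archimedean2 by blast
            then have "u \<in> {0<..<cumint a (real n)}" using x cumint_mono[of x "real n"] by auto
            then show "u \<in> (\<Union>n. {0<..<cumint a (real n)})" by blast
          qed (use False in \<open>auto simp: J_def not_less intro: order_trans less_imp_le\<close>)
          then have "emeasure lborel (J \<inter> {..c}) = (SUP n. emeasure lborel {0<..<cumint a (real n)})"
            by (subst SUP_emeasure_incseq)
               (auto simp: incseq_def dest!: cumint_mono[OF of_nat_mono])
          then show ?thesis by (simp add: cumint_nonneg)
        qed
        finally show ?thesis .
      qed
    qed
    then show "emeasure (distr ?M borel (cumint a)) {..c} = emeasure (density lborel (indicator J)) {..c}"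
      using L R by simp
  qed
  show ?thesis unfolding J_def[symmetric]
  proof (rule measure_eqI_generator_eq[where E="range atMost" and \<Omega>=UNIV and A="\<lambda>n. {..real n}"])
    show "Int_stable (range (atMost :: real \<Rightarrow> real set))"
      by (auto simp: Int_stable_def)
    show "(\<Union>i. {..real i}) = UNIV"
      by (auto simp: real_arch_simple)
    show "emeasure (distr ?M borel (cumint a)) {..real i} \<noteq> \<infinity>" for i
      using finR eq by simp
  qed (use eq in \<open>auto simp: borel_eq_atMost\<close>)
qed

lemma nn_integral_cumint_subst:
  assumes [measurable]: "g \<in> borel_measurable borel"
  shows "(\<integral>\<^sup>+x. g (cumint a x) * (ennreal (a x) * indicator {0<..} x) \<partial>lborel) =
         (\<integral>\<^sup>+u. g u * indicator {u. 0 < u \<and> (\<exists>x. u < cumint a x)} u \<partial>lborel)"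
proof -
  have "{u. 0 < u \<and> (\<exists>x. u < cumint a x)} = {0<..} \<inter> (\<Union>x. {..<cumint a x})" by auto
  moreover have "open ({0<..} \<inter> (\<Union>x. {..<cumint a x}))" by (intro open_Int open_UN ballI) auto
  ultimately have [measurable]: "{u. 0 < u \<and> (\<exists>x. u < cumint a x)} \<in> sets borel" by (simp only: borel_open)
  have "(\<integral>\<^sup>+x. g (cumint a x) * (ennreal (a x) * indicator {0<..} x) \<partial>lborel) =
     (\<integral>\<^sup>+u. g u \<partial>distr (density lborel (\<lambda>x. ennreal (a x) * indicator {0<..} x)) borel (cumint a))"
    by (subst nn_integral_distr, simp, simp, subst nn_integral_density) (auto simp: ac_simps)
  also have "\<dots> = (\<integral>\<^sup>+u. g u * indicator {u. 0 < u \<and> (\<exists>x. u < cumint a x)} u \<partial>lborel)"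
    unfolding distr_cumint by (subst nn_integral_density) (auto simp: ac_simps)
  finally show ?thesis .
qed

lemma AE_derivative_cumint:
  "AE s in lborel. 0 < s \<longrightarrow> (cumint a has_real_derivative a s) (at s)"
  using AE_derivative_indefinite_integral[OF set_integrable_rate]
  unfolding cumint_eq_LINT[abs_def, symmetric] .

end

section \<open>The inverse of an unbounded integrated rate\<close>

definition cuminv :: "(real \<Rightarrow> real) \<Rightarrow> real \<Rightarrow> real" where
  "cuminv a t = Inf {s. cumint a s > t}"

locale unbounded_rate = rate +
  assumes unbounded: "\<And>u. \<exists>x. u < cumint a x"
begin

lemma cuminv_cumint: "0 \<le> x \<Longrightarrow> cuminv a (cumint a x) = x"
proof -
  assume x: "0 \<le> x"
  have "{s. cumint a s > cumint a x} = {x<..}"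
    using x cumint_strict_mono[of x] cumint_mono by (auto simp: not_le[symmetric])
  then show ?thesis by (simp add: cuminv_def)
qed

lemma cumint_cuminv: "0 \<le> u \<Longrightarrow> cumint a (cuminv a u) = u"
  and cuminv_nonneg: "0 \<le> u \<Longrightarrow> 0 \<le> cuminv a u"
proof -
  assume "0 \<le> u"
  then obtain x where "0 \<le> x" "cumint a x = u"
    using cumint_attains[of u] unbounded[of u] by (metis less_imp_le)
  then show "cumint a (cuminv a u) = u" "0 \<le> cuminv a u" using cuminv_cumint by auto
qed

lemma cuminv_le_iff: "0 \<le> u \<Longrightarrow> 0 \<le> x \<Longrightarrow> cuminv a u \<le> x \<longleftrightarrow> u \<le> cumint a x"
  by (metis cumint_cuminv cumint_mono cumint_strict_mono cuminv_nonneg not_le)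

lemma le_cuminv_iff: "0 \<le> u \<Longrightarrow> 0 \<le> x \<Longrightarrow> x \<le> cuminv a u \<longleftrightarrow> cumint a x \<le> u"
  by (metis cumint_cuminv cumint_mono cumint_strict_mono cuminv_nonneg not_le)

lemma cuminv_pos: "0 < u \<Longrightarrow> 0 < cuminv a u"
  using cuminv_le_iff[of u 0] by auto

lemma cuminv_mono_on: "0 \<le> u \<Longrightarrow> u \<le> v \<Longrightarrow> cuminv a u \<le> cuminv a v"
  using cuminv_le_iff[of u "cuminv a v"] cumint_cuminv[of v] cuminv_nonneg[of v] by auto

lemma measurable_cuminv_pos: "(\<lambda>u. if 0 \<le> u then cuminv a u else 0) \<in> borel_measurable borel"
  by (rule borel_measurable_mono) (auto simp: mono_def cuminv_mono_on cuminv_nonneg)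

lemma nn_integral_rate_subst:
  assumes [measurable]: "g \<in> borel_measurable borel"
  shows "(\<integral>\<^sup>+u. g u * indicator {0<..} u \<partial>lborel) =
    (\<integral>\<^sup>+x. g (cumint a x) * (ennreal (a x) * indicator {0<..} x) \<partial>lborel)"
proof -
  have "{u. 0 < u \<and> (\<exists>x. u < cumint a x)} = {0<..}" using unbounded by auto
  then show ?thesis by (subst nn_integral_cumint_subst) auto
qed

text \<open>Outside a null set \<open>N\<close> of times \<open>cumint a\<close> is differentiable
  and the inverse function rule applies. The \<open>t\<close> with \<open>cuminv a t\<close> in
  \<open>N\<close> are again null, since by substitution their measure is an integral of
  \<open>a\<close> over a subset of \<open>N\<close>.\<close>

lemma AE_derivative_cuminv:
  "AE t in lborel. 0 < t \<longrightarrow> (cuminv a has_real_derivative inverse (a (cuminv a t))) (at t)"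
proof -
  obtain N where N: "N \<in> null_sets lborel" "{s. \<not> (0 < s \<longrightarrow> (cumint a has_real_derivative a s) (at s))} \<subseteq> N"
    using AE_derivative_cumint by (auto simp: eventually_ae_filter)
  have [measurable]: "N \<in> sets borel" using N by auto
  \<comment> \<open>Extended by 0 to negative arguments, the inverse is monotone on the whole line
    and hence Borel.\<close>
  define N' where "N' = {t. 0 < t \<and> (if 0 \<le> t then cuminv a t else 0) \<in> N}"
  have [measurable]: "N' \<in> sets borel"
    unfolding N'_def using measurable_cuminv_pos by measurable
  have "emeasure lborel N' = (\<integral>\<^sup>+u. indicator N' u * indicator {0<..} u \<partial>lborel)"
    by (subst nn_integral_indicator[symmetric], simp, intro nn_integral_cong) (auto simp: indicator_def N'_def)
  also have "\<dots> = (\<integral>\<^sup>+x. indicator N' (cumint a x) * (ennreal (a x) * indicator {0<..} x) \<partial>lborel)"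
    by (rule nn_integral_rate_subst) auto
  also have "\<dots> = (\<integral>\<^sup>+x. 0 \<partial>(lborel::real measure))"
  proof (rule nn_integral_cong_AE)
    have "AE x in lborel. x \<notin> N" using N by (intro AE_not_in)
    then show "AE x in lborel. indicator N' (cumint a x) * (ennreal (a x) * indicator {0<..} x) = 0"
      by eventually_elim (auto simp: indicator_def N'_def cuminv_cumint cumint_nonneg)
  qed
  finally have "N' \<in> null_sets lborel" by (simp add: null_sets_def)
  then have "AE t in lborel. t \<notin> N'" by (rule AE_not_in)
  then show ?thesis
  proof eventually_elim
    case (elim t)
    show ?case
    proof
      assume t: "0 < t"
      let ?x = "cuminv a t"
      have x: "0 < ?x" "cumint a ?x = t" using t cuminv_pos cumint_cuminv by auto
      have "?x \<notin> N" using elim t by (auto simp: N'_def)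
      then have d: "(cumint a has_real_derivative a ?x) (at ?x)" using N(2) x by auto
      have "(cuminv a has_derivative (*) (inverse (a ?x))) (at (cumint a ?x))"
      proof (rule has_derivative_inverse_strong[of "{0<..}" ?x "cumint a" "cuminv a" "(*) (a ?x)" "(*) (inverse (a ?x))"])
        show "(cumint a has_derivative (*) (a ?x)) (at ?x)" using d by (simp add: has_field_derivative_def)
        show "(*) (a ?x) \<circ> (*) (inverse (a ?x)) = id" using pos[OF x(1)] by (auto simp: fun_eq_iff)
        show "continuous_on {0<..} (cumint a)" by (rule continuous_on_subset[OF continuous_on_cumint]) auto
      qed (use x cuminv_cumint in auto)
      then have "(cuminv a has_real_derivative inverse (a ?x)) (at (cumint a ?x))"
        by (simp add: has_field_derivative_def)
      then show "(cuminv a has_real_derivative inverse (a ?x)) (at t)" by (simp add: x)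
    qed
  qed
qed

end

section \<open>The exponential law\<close>

definition exp_law :: "real measure" where
  "exp_law = density lborel (\<lambda>x. ennreal (exp (- x)) * indicator {0<..} x)"

lemma sets_exp_law [measurable_cong, simp]: "sets exp_law = sets borel"
  and space_exp_law [simp]: "space exp_law = UNIV"
  by (auto simp: exp_law_def)

lemma nn_integral_exp_law:
  assumes [measurable]: "f \<in> borel_measurable borel"
  shows "(\<integral>\<^sup>+x. f x \<partial>exp_law) = (\<integral>\<^sup>+x. f x * (ennreal (exp (- x)) * indicator {0<..} x) \<partial>lborel)"
  unfolding exp_law_def by (subst nn_integral_density) (auto simp: ac_simps)

lemma nn_integral_exp_tail:
  "(\<integral>\<^sup>+x. ennreal (exp (- (c * x))) * indicator {s..} x \<partial>lborel) = ennreal (exp (- (c * s)) / c)" if c: "0 < c" for c s :: real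
proof -
  have "((\<lambda>x. exp (- (c * x))) \<longlongrightarrow> 0) at_top"
    by (intro filterlim_compose[OF exp_at_bot] filterlim_compose[OF filterlim_uminus_at_bot_at_top]
        filterlim_tendsto_pos_mult_at_top[OF tendsto_const c] filterlim_ident)
  then have "((\<lambda>x. - exp (- (c * x)) / c) \<longlongrightarrow> 0) at_top"
    using tendsto_divide[OF tendsto_minus tendsto_const[of c], of "\<lambda>x. exp (- (c * x))" 0 at_top] c by simp
  moreover have "((\<lambda>x. - exp (- (c * x)) / c) has_real_derivative exp (- (c * x))) (at x)" for x
    using c by (auto intro!: derivative_eq_intros)
  ultimately show ?thesis
    using nn_integral_FTC_atLeast[of "\<lambda>x. exp (- (c * x))" s "\<lambda>x. - exp (- (c * x)) / c" 0] by auto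
qed

lemma nn_integral_exp_tail':
  "(\<integral>\<^sup>+x. ennreal (exp (- x)) * indicator {s..} x \<partial>lborel) = ennreal (exp (- s))"
  using nn_integral_exp_tail[of 1 s] by simp

lemma nn_integral_lborel_Ioi:
  "(\<integral>\<^sup>+x. f x * indicator {s<..} x \<partial>lborel) = (\<integral>\<^sup>+x. f x * indicator {s..} x \<partial>lborel)" for s :: real
  by (rule nn_integral_cong_AE, use AE_lborel_singleton[of s] in eventually_elim) (auto simp: indicator_def)

lemma prob_space_exp_law: "prob_space exp_law"
proof
  have "emeasure exp_law (space exp_law) = (\<integral>\<^sup>+x. 1 \<partial>exp_law)" by simp
  also have "\<dots> = 1" by (subst nn_integral_exp_law) (auto simp: nn_integral_lborel_Ioi nn_integral_exp_tail')
  finally show "emeasure exp_law (space exp_law) = 1" .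
qed

interpretation exp_law: prob_space exp_law by (rule prob_space_exp_law)

lemma AE_exp_law_pos: "AE x in exp_law. 0 < x"
  unfolding exp_law_def by (subst AE_density) (auto simp: indicator_def)

text \<open>The exponential law charges every half line. As rate integrals increase with their upper
  limit, a bound for almost every gap thus becomes a bound for every time.\<close>

lemma AE_exp_law_exceeds:
  assumes "AE x in exp_law. P x" shows "\<exists>x>c. P x"
proof (rule ccontr)
  assume "\<not> ?thesis"
  then have "AE x in exp_law. x \<notin> {max 0 c<..}" using assms by (rule_tac AE_mp[OF assms]) (auto intro!: AE_I2)
  then have "emeasure exp_law {max 0 c<..} = 0"
    by (subst (asm) AE_iff_measurable[of "{max 0 c<..}"]) auto
  moreover have "emeasure exp_law {max 0 c<..} = (\<integral>\<^sup>+x. ennreal (exp (- x)) * indicator {max 0 c<..} x \<partial>lborel)"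
    unfolding exp_law_def by (subst emeasure_density) (auto intro!: nn_integral_cong simp: indicator_def)
  ultimately show False by (auto simp: nn_integral_lborel_Ioi nn_integral_exp_tail')
qed

text \<open>The exponential law has hazard rate 1: after Fubini the inner integral is the tail
  \<open>exp (- s)\<close>, which is also the density at \<open>s\<close>.\<close>

lemma nn_integral_exp_law_compensator:
  assumes [measurable]: "h \<in> borel_measurable borel"
  shows "(\<integral>\<^sup>+x. (\<integral>\<^sup>+s. h s * indicator {0<..x} s \<partial>lborel) \<partial>exp_law) = (\<integral>\<^sup>+x. h x \<partial>exp_law)"
proof -
  have "(\<integral>\<^sup>+x. (\<integral>\<^sup>+s. h s * indicator {0<..x} s \<partial>lborel) \<partial>exp_law) =
     (\<integral>\<^sup>+x. (\<integral>\<^sup>+s. h s * indicator {0<..} s * (ennreal (exp (- x)) * indicator {s..} x) \<partial>lborel) \<partial>lborel)"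
  proof (subst nn_integral_exp_law, measurable, intro nn_integral_cong)
    fix x :: real
    show "(\<integral>\<^sup>+s. h s * indicator {0<..x} s \<partial>lborel) * (ennreal (exp (- x)) * indicator {0<..} x) =
      (\<integral>\<^sup>+s. h s * indicator {0<..} s * (ennreal (exp (- x)) * indicator {s..} x) \<partial>lborel)"
      by (subst nn_integral_multc[symmetric], measurable, rule nn_integral_cong) (auto simp: indicator_def mult.assoc)
  qed
  also have "\<dots> = (\<integral>\<^sup>+s. (\<integral>\<^sup>+x. h s * indicator {0<..} s * (ennreal (exp (- x)) * indicator {s..} x) \<partial>lborel) \<partial>lborel)"
    by (rule lborel_pair.Fubini') measurable
  also have "\<dots> = (\<integral>\<^sup>+s. h s * indicator {0<..} s * ennreal (exp (- s)) \<partial>lborel)"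
    by (intro nn_integral_cong, subst nn_integral_cmult) (auto simp: nn_integral_exp_tail')
  also have "\<dots> = (\<integral>\<^sup>+x. h x \<partial>exp_law)" by (subst nn_integral_exp_law) (auto simp: ac_simps)
  finally show ?thesis .
qed

text \<open>Hardy's inequality, from Cauchy--Schwarz with the weights \<open>exp (s / 2)\<close> and \<open>exp (- s / 2)\<close>.\<close>

lemma nn_integral_exp_law_Hardy:
  assumes [measurable]: "h \<in> borel_measurable borel"
  shows "(\<integral>\<^sup>+x. (\<integral>\<^sup>+s. ennreal \<bar>h s\<bar> * indicator {0<..x} s \<partial>lborel)\<^sup>2 \<partial>exp_law) \<le> 4 * (\<integral>\<^sup>+x. ennreal ((h x)\<^sup>2) \<partial>exp_law)"
proof -
  have CS: "(\<integral>\<^sup>+s. ennreal \<bar>h s\<bar> * indicator {0<..x} s \<partial>lborel)\<^sup>2 \<le>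
      ennreal (2 * exp (x / 2)) * (\<integral>\<^sup>+s. ennreal ((h s)\<^sup>2 * exp (- (s / 2))) * indicator {0<..x} s \<partial>lborel)" for x :: real
  proof (cases "0 < x")
    case True
    have "(\<integral>\<^sup>+s. ennreal \<bar>h s\<bar> * indicator {0<..x} s \<partial>lborel)\<^sup>2 =
      (\<integral>\<^sup>+s. (ennreal (exp (s / 4)) * indicator {0<..x} s) * (ennreal (\<bar>h s\<bar> * exp (- (s / 4))) * indicator {0<..x} s) \<partial>lborel)\<^sup>2"
      by (intro arg_cong[where f="\<lambda>x. x\<^sup>2"] nn_integral_cong)
         (auto simp: indicator_def ennreal_mult[symmetric] exp_minus field_simps)
    also have "\<dots> \<le> (\<integral>\<^sup>+s. (ennreal (exp (s / 4)) * indicator {0<..x} s)\<^sup>2 \<partial>lborel) *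
      (\<integral>\<^sup>+s. (ennreal (\<bar>h s\<bar> * exp (- (s / 4))) * indicator {0<..x} s)\<^sup>2 \<partial>lborel)"
      by (rule Cauchy_Schwarz_nn_integral) measurable
    also have "(\<integral>\<^sup>+s. (ennreal (exp (s / 4)) * indicator {0<..x} s)\<^sup>2 \<partial>lborel) \<le> ennreal (2 * exp (x / 2))"
    proof -
      have "(\<integral>\<^sup>+s. (ennreal (exp (s / 4)) * indicator {0<..x} s)\<^sup>2 \<partial>lborel) \<le>
         (\<integral>\<^sup>+s. ennreal (exp (s / 2)) * indicator {0..x} s \<partial>lborel)"
        by (intro nn_integral_mono) (auto simp: indicator_def ennreal_mult[symmetric] power2_eq_square exp_add[symmetric] field_simps)
      also have "\<dots> = ennreal (2 * exp (x / 2) - 2 * exp (0 / 2))"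
        by (rule nn_integral_FTC_Icc[of _ 0 x "\<lambda>s. 2 * exp (s / 2)"]) (use True in \<open>auto intro!: derivative_eq_intros\<close>)
      also have "\<dots> \<le> ennreal (2 * exp (x / 2))" by (intro ennreal_leI) auto
      finally show ?thesis .
    qed
    also have "(\<integral>\<^sup>+s. (ennreal (\<bar>h s\<bar> * exp (- (s / 4))) * indicator {0<..x} s)\<^sup>2 \<partial>lborel) =
       (\<integral>\<^sup>+s. ennreal ((h s)\<^sup>2 * exp (- (s / 2))) * indicator {0<..x} s \<partial>lborel)"
      by (intro nn_integral_cong) (auto simp: indicator_def ennreal_mult[symmetric] power2_eq_square exp_add[symmetric] mult.assoc mult.left_commute[of "exp _"] intro!: arg_cong[where f=ennreal])
    finally show ?thesis by (auto simp: mult_right_mono)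
  qed simp
  have "(\<integral>\<^sup>+x. (\<integral>\<^sup>+s. ennreal \<bar>h s\<bar> * indicator {0<..x} s \<partial>lborel)\<^sup>2 \<partial>exp_law) \<le>
     (\<integral>\<^sup>+x. ennreal (2 * exp (x / 2)) * (\<integral>\<^sup>+s. ennreal ((h s)\<^sup>2 * exp (- (s / 2))) * indicator {0<..x} s \<partial>lborel) \<partial>exp_law)"
    by (intro nn_integral_mono CS)
  \<comment> \<open>The factor \<open>2 * exp (x / 2)\<close> meets the density
    \<open>exp (- x)\<close> and leaves \<open>exp (- x / 2)\<close>. Its tail integral
    \<open>2 * exp (- s / 2)\<close> restores the density at \<open>s\<close> and produces the
    constant 4.\<close>
  also have "\<dots> = (\<integral>\<^sup>+x. (\<integral>\<^sup>+s. (ennreal (2 * (h s)\<^sup>2 * exp (- (s / 2))) * indicator {0<..} s) * (ennreal (exp (- (1/2 * x))) * indicator {s..} x) \<partial>lborel) \<partial>lborel)"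
  proof (subst nn_integral_exp_law, measurable, intro nn_integral_cong)
    fix x :: real
    have "ennreal (2 * exp (x / 2)) * (\<integral>\<^sup>+s. ennreal ((h s)\<^sup>2 * exp (- (s / 2))) * indicator {0<..x} s \<partial>lborel) * (ennreal (exp (- x)) * indicator {0<..} x)
      = (\<integral>\<^sup>+s. (ennreal (2 * exp (x / 2)) * (ennreal (exp (- x)) * indicator {0<..} x)) * (ennreal ((h s)\<^sup>2 * exp (- (s / 2))) * indicator {0<..x} s) \<partial>lborel)"
      by (subst nn_integral_cmult) (auto simp: ac_simps)
    also have "\<dots> = (\<integral>\<^sup>+s. (ennreal (2 * (h s)\<^sup>2 * exp (- (s / 2))) * indicator {0<..} s) * (ennreal (exp (- (1/2 * x))) * indicator {s..} x) \<partial>lborel)"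
      by (intro nn_integral_cong)
         (auto simp: indicator_def ennreal_mult[symmetric] exp_add[symmetric] mult.assoc[symmetric] intro!: arg_cong[where f=ennreal])
    finally show "ennreal (2 * exp (x / 2)) * (\<integral>\<^sup>+s. ennreal ((h s)\<^sup>2 * exp (- (s / 2))) * indicator {0<..x} s \<partial>lborel) * (ennreal (exp (- x)) * indicator {0<..} x)
      = (\<integral>\<^sup>+s. (ennreal (2 * (h s)\<^sup>2 * exp (- (s / 2))) * indicator {0<..} s) * (ennreal (exp (- (1/2 * x))) * indicator {s..} x) \<partial>lborel)" .
  qed
  also have "\<dots> = (\<integral>\<^sup>+s. (\<integral>\<^sup>+x. (ennreal (2 * (h s)\<^sup>2 * exp (- (s / 2))) * indicator {0<..} s) * (ennreal (exp (- (1/2 * x))) * indicator {s..} x) \<partial>lborel) \<partial>lborel)"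
    by (rule lborel_pair.Fubini') measurable
  also have "\<dots> = (\<integral>\<^sup>+s. (ennreal (2 * (h s)\<^sup>2 * exp (- (s / 2))) * indicator {0<..} s) * ennreal (2 * exp (- (s / 2))) \<partial>lborel)"
    by (intro nn_integral_cong, subst nn_integral_cmult, measurable, subst nn_integral_exp_tail) (auto simp: ac_simps)
  also have "\<dots> = (\<integral>\<^sup>+s. 4 * (ennreal ((h s)\<^sup>2) * (ennreal (exp (- s)) * indicator {0<..} s)) \<partial>lborel)"
    by (intro nn_integral_cong)
       (auto simp: indicator_def ennreal_mult[symmetric] ennreal_numeral[symmetric] exp_add[symmetric] simp del: ennreal_numeral intro!: arg_cong[where f=ennreal])
  also have "\<dots> = 4 * (\<integral>\<^sup>+x. ennreal ((h x)\<^sup>2) \<partial>exp_law)"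
    by (subst nn_integral_exp_law, measurable, subst nn_integral_cmult) auto
  finally show ?thesis .
qed

section \<open>Sequences of independent exponential variables\<close>

definition expseq :: "(nat \<Rightarrow> real) measure" where
  "expseq = PiM UNIV (\<lambda>_. exp_law)"

abbreviation seqS :: "(nat \<Rightarrow> real) measure" where
  "seqS \<equiv> PiM UNIV (\<lambda>_. borel)"

lemma sets_expseq [measurable_cong]: "sets expseq = sets seqS"
  unfolding expseq_def by (intro sets_PiM_cong) auto

lemma space_seqS [simp]: "space seqS = UNIV"
  by (simp add: space_PiM)

lemma space_expseq [simp]: "space expseq = UNIV"
  by (simp add: expseq_def space_PiM)

lemma measurable_expseq [simp]: "measurable expseq M = measurable seqS M"
  by (rule measurable_cong_sets) (auto simp: sets_expseq)

lemma prob_space_expseq: "prob_space expseq"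
  unfolding expseq_def by (rule prob_space_PiM) (rule prob_space_exp_law)

interpretation expseq: prob_space expseq by (rule prob_space_expseq)

interpretation exp_law_expseq: pair_prob_space exp_law expseq ..

lemma measurable_seq_upd [measurable (raw)]:
  assumes "f \<in> measurable M seqS" "g \<in> borel_measurable M"
  shows "(\<lambda>x. (f x)(n := g x)) \<in> measurable M seqS"
  by (rule measurable_fun_upd[where J=UNIV]) (use assms in auto)

text \<open>Replacing one coordinate by an independent copy leaves a product law unchanged. This
  takes the place of conditioning on the other gaps and keeps \<open>w\<close> a full
  sequence.\<close>

lemma distr_resample: "distr (exp_law \<Otimes>\<^sub>M expseq) seqS (\<lambda>(x, w). w(n := x)) = expseq"
proof -
  have "distr (exp_law \<Otimes>\<^sub>M (\<Pi>\<^sub>M i\<in>UNIV. exp_law)) (\<Pi>\<^sub>M i\<in>insert n UNIV. exp_law) (\<lambda>(x, X). X(n := x)) = (\<Pi>\<^sub>M i\<in>insert n UNIV. exp_law)"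
    by (rule distr_pair_PiM_eq_PiM) (auto intro: prob_space_exp_law)
  moreover have "distr (exp_law \<Otimes>\<^sub>M expseq) seqS (\<lambda>(x, w). w(n := x)) = distr (exp_law \<Otimes>\<^sub>M expseq) expseq (\<lambda>(x, w). w(n := x))"
    by (rule distr_cong) (auto simp: sets_expseq)
  ultimately show ?thesis by (simp add: expseq_def)
qed

lemma nn_integral_resample:
  assumes [measurable]: "G \<in> borel_measurable seqS"
  shows "(\<integral>\<^sup>+w. G w \<partial>expseq) = (\<integral>\<^sup>+w. (\<integral>\<^sup>+x. G (w(n := x)) \<partial>exp_law) \<partial>expseq)"
proof -
  have "(\<integral>\<^sup>+w. G w \<partial>expseq) = (\<integral>\<^sup>+p. G (case p of (x, w) \<Rightarrow> w(n := x)) \<partial>(exp_law \<Otimes>\<^sub>M expseq))"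
    by (subst (1) distr_resample[of n, symmetric], subst nn_integral_distr) auto
  also have "\<dots> = (\<integral>\<^sup>+w. (\<integral>\<^sup>+x. G (w(n := x)) \<partial>exp_law) \<partial>expseq)"
    by (subst exp_law_expseq.nn_integral_snd[symmetric]) (auto simp: case_prod_beta)
  finally show ?thesis .
qed

text \<open>A null set has null sections in coordinate \<open>n\<close> for almost all values of the
  others. What holds for the observed gap thus holds for almost all values the gap could have
  taken.\<close>

lemma AE_resample:
  assumes "AE w in expseq. P w"
  shows "AE w in expseq. AE x in exp_law. P (w(n := x))"
proof -
  obtain N where N: "N \<in> null_sets expseq" "{w. \<not> P w} \<subseteq> N"
    using assms by (auto simp: eventually_ae_filter)
  have N0: "emeasure expseq N = 0" using N by (simp add: null_sets_def)
  have [measurable]: "N \<in> sets seqS" using N sets_expseq by auto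
  have "0 = (\<integral>\<^sup>+w. indicator N w \<partial>expseq)" using N0 N by (subst nn_integral_indicator) auto
  also have "\<dots> = (\<integral>\<^sup>+w. (\<integral>\<^sup>+x. indicator N (w(n := x)) \<partial>exp_law) \<partial>expseq)"
    by (rule nn_integral_resample) measurable
  finally have "AE w in expseq. (\<integral>\<^sup>+x. indicator N (w(n := x)) \<partial>exp_law) = 0"
    by (subst (asm) eq_commute, subst (asm) nn_integral_0_iff_AE) auto
  then show ?thesis
  proof eventually_elim
    case (elim w)
    then have "AE x in exp_law. indicator N (w(n := x)) = (0::ennreal)"
      by (subst (asm) nn_integral_0_iff_AE) auto
    then show ?case by eventually_elim (use N(2) in \<open>auto simp: indicator_def split: if_splits\<close>)
  qed
qed

lemma AE_expseq_pos: "AE w in expseq. \<forall>i. 0 < w i"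
  unfolding AE_all_countable expseq_def
  by (intro allI AE_PiM_component) (auto intro: prob_space_exp_law AE_exp_law_pos)

text \<open>Stands in for measurability with respect to the first \<open>n\<close> gaps. Being
  pointwise, it also applies to functions whose values are whole rate functions.\<close>

definition adapted :: "nat \<Rightarrow> ((nat \<Rightarrow> real) \<Rightarrow> 'b) \<Rightarrow> bool" where
  "adapted n F \<longleftrightarrow> (\<forall>w w'. (\<forall>i<n. w i = w' i) \<longrightarrow> F w = F w')"

lemma adaptedD: "adapted n F \<Longrightarrow> (\<And>i. i < n \<Longrightarrow> w i = w' i) \<Longrightarrow> F w = F w'"
  unfolding adapted_def by blast

lemma adapted_upd [simp]: "adapted n F \<Longrightarrow> n \<le> m \<Longrightarrow> F (w(m := x)) = F w"
  by (rule adaptedD[of n]) auto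

lemma adapted_mono: "adapted n F \<Longrightarrow> n \<le> m \<Longrightarrow> adapted m F"
  unfolding adapted_def by (meson order_less_le_trans)

lemma measurable_nn_integral_Ioc [measurable (raw)]:
  fixes g :: "'a \<Rightarrow> real" and f :: "'a \<Rightarrow> real \<Rightarrow> ennreal"
  assumes [measurable]: "(\<lambda>(x, s). f x s) \<in> borel_measurable (M \<Otimes>\<^sub>M borel)" "g \<in> borel_measurable M"
  shows "(\<lambda>x. \<integral>\<^sup>+s. f x s * indicator {0<..g x} s \<partial>lborel) \<in> borel_measurable M"
  by measurable

text \<open>An adapted \<open>f\<close> does not see gap \<open>n\<close>, so after resampling this
  gap only the identity for a single exponential variable is left.\<close>

lemma nn_integral_compensator:
  fixes f :: "(nat \<Rightarrow> real) \<Rightarrow> real \<Rightarrow> ennreal"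
  assumes [measurable]: "(\<lambda>(w, s). f w s) \<in> borel_measurable (seqS \<Otimes>\<^sub>M borel)" and f: "adapted n f"
  shows "(\<integral>\<^sup>+w. f w (w n) \<partial>expseq) = (\<integral>\<^sup>+w. (\<integral>\<^sup>+s. f w s * indicator {0<..w n} s \<partial>lborel) \<partial>expseq)"
proof -
  have "(\<integral>\<^sup>+w. f w (w n) \<partial>expseq) = (\<integral>\<^sup>+w. (\<integral>\<^sup>+x. f w x \<partial>exp_law) \<partial>expseq)"
    by (subst nn_integral_resample[of _ n]) (use f in auto)
  also have "\<dots> = (\<integral>\<^sup>+w. (\<integral>\<^sup>+x. (\<integral>\<^sup>+s. f w s * indicator {0<..x} s \<partial>lborel) \<partial>exp_law) \<partial>expseq)"
    by (intro nn_integral_cong nn_integral_exp_law_compensator[symmetric]) measurable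
  also have "\<dots> = (\<integral>\<^sup>+w. (\<integral>\<^sup>+s. f w s * indicator {0<..w n} s \<partial>lborel) \<partial>expseq)"
    by (subst nn_integral_resample[of _ n]) (use f in auto)
  finally show ?thesis .
qed

text \<open>Positive and negative part are compensated separately. Integrability at the jump makes
  both compensators finite almost surely, so their difference is a genuine Lebesgue
  integral.\<close>

lemma integral_compensator:
  fixes f :: "(nat \<Rightarrow> real) \<Rightarrow> real \<Rightarrow> real"
  assumes [measurable]: "(\<lambda>(w, s). f w s) \<in> borel_measurable (seqS \<Otimes>\<^sub>M borel)" and f: "adapted n f"
    and int: "integrable expseq (\<lambda>w. f w (w n))"
  shows "integrable expseq (\<lambda>w. LINT s:{0<..w n}|lborel. f w s)"
    and "(LINT w|expseq. f w (w n)) = (LINT w|expseq. (LINT s:{0<..w n}|lborel. f w s))"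
    and "AE w in expseq. set_integrable lborel {0<..w n} (f w)"
proof -
  define P where "P w = (\<integral>\<^sup>+s. ennreal (f w s) * indicator {0<..w n} s \<partial>lborel)" for w
  define Q where "Q w = (\<integral>\<^sup>+s. ennreal (- f w s) * indicator {0<..w n} s \<partial>lborel)" for w
  have [measurable]: "P \<in> borel_measurable seqS" "Q \<in> borel_measurable seqS" unfolding P_def Q_def by measurable
  have ad: "adapted n (\<lambda>w s. ennreal (f w s))" "adapted n (\<lambda>w s. ennreal (- f w s))"
    using f unfolding adapted_def by metis+
  have eP: "(\<integral>\<^sup>+w. P w \<partial>expseq) = (\<integral>\<^sup>+w. ennreal (f w (w n)) \<partial>expseq)"
    unfolding P_def by (rule nn_integral_compensator[symmetric]) (use ad in auto)
  have eQ: "(\<integral>\<^sup>+w. Q w \<partial>expseq) = (\<integral>\<^sup>+w. ennreal (- f w (w n)) \<partial>expseq)"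
    unfolding Q_def by (rule nn_integral_compensator[symmetric]) (use ad in auto)
  have finP: "(\<integral>\<^sup>+w. P w \<partial>expseq) < \<infinity>" "(\<integral>\<^sup>+w. Q w \<partial>expseq) < \<infinity>"
    unfolding eP eQ using int by (auto simp: real_integrable_def less_top)
  then have AEfin: "AE w in expseq. P w \<noteq> \<infinity>" "AE w in expseq. Q w \<noteq> \<infinity>"
    by (intro nn_integral_PInf_AE; simp)+
  have ind: "ennreal (indicator {0<..x} s * f w s) = ennreal (f w s) * indicator {0<..x} s"
     "ennreal (- (indicator {0<..x} s * f w s)) = ennreal (- f w s) * indicator {0<..x} s" for w s x
    by (auto simp: indicator_def)
  show si: "AE w in expseq. set_integrable lborel {0<..w n} (f w)"
    using AEfin by eventually_elim (auto simp: set_integrable_def real_integrable_def ind P_def Q_def)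
  have eq: "AE w in expseq. (LINT s:{0<..w n}|lborel. f w s) = enn2real (P w) - enn2real (Q w)"
    using si by eventually_elim (auto simp: set_integrable_def set_lebesgue_integral_def real_lebesgue_integral_def ind P_def Q_def)
  have rP: "(\<integral>\<^sup>+w. ennreal (enn2real (P w)) \<partial>expseq) = (\<integral>\<^sup>+w. P w \<partial>expseq)"
    by (rule nn_integral_cong_AE, use AEfin(1) in eventually_elim) (simp add: less_top)
  have rQ: "(\<integral>\<^sup>+w. ennreal (enn2real (Q w)) \<partial>expseq) = (\<integral>\<^sup>+w. Q w \<partial>expseq)"
    by (rule nn_integral_cong_AE, use AEfin(2) in eventually_elim) (simp add: less_top)
  have iP: "integrable expseq (\<lambda>w. enn2real (P w))" "integrable expseq (\<lambda>w. enn2real (Q w))"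
    by (rule integrableI_nonneg; use finP rP rQ in simp)+
  have [measurable]: "(\<lambda>w. LINT s:{0<..w n}|lborel. f w s) \<in> borel_measurable seqS"
    unfolding set_lebesgue_integral_def by measurable
  show "integrable expseq (\<lambda>w. LINT s:{0<..w n}|lborel. f w s)"
    by (subst integrable_cong_AE[OF _ _ eq]) (use iP in auto)
  have "(LINT w|expseq. (LINT s:{0<..w n}|lborel. f w s)) = (LINT w|expseq. enn2real (P w)) - (LINT w|expseq. enn2real (Q w))"
    by (subst integral_cong_AE[OF _ _ eq]) (use iP in \<open>auto simp: Bochner_Integration.integral_diff\<close>)
  also have "(LINT w|expseq. enn2real (P w)) = enn2real (\<integral>\<^sup>+w. P w \<partial>expseq)"
    by (subst integral_eq_nn_integral) (auto simp: rP)
  also have "(LINT w|expseq. enn2real (Q w)) = enn2real (\<integral>\<^sup>+w. Q w \<partial>expseq)"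
    by (subst integral_eq_nn_integral) (auto simp: rQ)
  finally show "(LINT w|expseq. f w (w n)) = (LINT w|expseq. (LINT s:{0<..w n}|lborel. f w s))"
    unfolding eP eQ by (simp add: real_lebesgue_integral_def[OF int])
qed

section \<open>Square integrable martingale differences\<close>

lemma integrable_mult_squares:
  fixes f g :: "'a \<Rightarrow> real"
  assumes [measurable]: "f \<in> borel_measurable M" "g \<in> borel_measurable M"
    and "integrable M (\<lambda>x. (f x)\<^sup>2)" "integrable M (\<lambda>x. (g x)\<^sup>2)"
  shows "integrable M (\<lambda>x. f x * g x)"
proof (rule Bochner_Integration.integrable_bound)
  show "integrable M (\<lambda>x. (f x)\<^sup>2 + (g x)\<^sup>2)" using assms by auto
  have "norm (a * b) \<le> norm (a\<^sup>2 + b\<^sup>2)" for a b :: real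
  proof -
    have "2 * (\<bar>a\<bar> * \<bar>b\<bar>) \<le> a\<^sup>2 + b\<^sup>2" "0 \<le> \<bar>a\<bar> * \<bar>b\<bar>"
      using sum_squares_bound[of "\<bar>a\<bar>" "\<bar>b\<bar>"] by (simp_all add: mult.assoc)
    then show ?thesis unfolding real_norm_def abs_mult by linarith
  qed
  then show "AE x in M. norm (f x * g x) \<le> norm ((f x)\<^sup>2 + (g x)\<^sup>2)" by auto
qed measurable

text \<open>\<open>xi_orth\<close> expresses conditional mean 0 given the first \<open>i\<close>
  gaps, tested against square integrable functions of them instead of through a conditional
  expectation.\<close>

locale mdiff =
  fixes \<xi> :: "nat \<Rightarrow> (nat \<Rightarrow> real) \<Rightarrow> real"
  assumes xi_meas [measurable]: "\<And>i. \<xi> i \<in> borel_measurable seqS"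
    and xi_adapted: "\<And>i. adapted (Suc i) (\<xi> i)"
    and xi_sq: "\<And>i. integrable expseq (\<lambda>w. (\<xi> i w)\<^sup>2)"
    and xi_orth: "\<And>i G. G \<in> borel_measurable seqS \<Longrightarrow> adapted i G \<Longrightarrow> integrable expseq (\<lambda>w. (G w)\<^sup>2) \<Longrightarrow>
       (LINT w|expseq. G w * \<xi> i w) = 0"
    and xi_summable: "summable (\<lambda>i. LINT w|expseq. (\<xi> i w)\<^sup>2)"
begin

abbreviation \<sigma> :: "nat \<Rightarrow> real" where "\<sigma> i \<equiv> (LINT w|expseq. (\<xi> i w)\<^sup>2)"

lemma summable_shift: "summable (\<lambda>i. \<sigma> (i + n))"
  using summable_iff_shift[of \<sigma> n] xi_summable by simp

text \<open>Weights that depend on the strict past keep the summands orthogonal, and weights bounded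
  by 1 do not increase the variances. They are there to stop the sum at a random index.\<close>

lemma square_sum:
  assumes [measurable]: "\<And>i. c i \<in> borel_measurable seqS" and ad: "\<And>i. adapted i (c i)"
    and c: "\<And>i w. \<bar>c i w\<bar> \<le> (1::real)"
  shows "integrable expseq (\<lambda>w. (\<Sum>i\<in>{n..<m}. c i w * \<xi> i w)\<^sup>2) \<and>
    (LINT w|expseq. (\<Sum>i\<in>{n..<m}. c i w * \<xi> i w)\<^sup>2) \<le> (\<Sum>i\<in>{n..<m}. \<sigma> i)"
proof (induction m)
  case (Suc m)
  show ?case
  proof (cases "n \<le> m")
    case True
    define D where "D w = (\<Sum>i\<in>{n..<m}. c i w * \<xi> i w)" for w
    have [measurable]: "D \<in> borel_measurable seqS" unfolding D_def by measurable
    have iD: "integrable expseq (\<lambda>w. (D w)\<^sup>2)" and leD: "(LINT w|expseq. (D w)\<^sup>2) \<le> (\<Sum>i\<in>{n..<m}. \<sigma> i)"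
      using Suc by (auto simp: D_def)
    have aD: "adapted m (\<lambda>w. D w * c m w)"
      unfolding adapted_def
    proof (intro allI impI)
      fix w w' :: "nat \<Rightarrow> real" assume eq: "\<forall>i<m. w i = w' i"
      have "c m w = c m w'" using ad[of m] eq by (auto intro: adaptedD)
      moreover have "D w = D w'" unfolding D_def
      proof (rule sum.cong)
        fix i assume "i \<in> {n..<m}"
        then have "c i w = c i w'" "\<xi> i w = \<xi> i w'"
          using adaptedD[OF ad, of i w w'] adaptedD[OF xi_adapted, of i w w'] eq by auto
        then show "c i w * \<xi> i w = c i w' * \<xi> i w'" by simp
      qed simp
      ultimately show "D w * c m w = D w' * c m w'" by simp
    qed
    have c2: "(c m w * x)\<^sup>2 \<le> x\<^sup>2" for w x
      using c[of m w] by (simp add: power_mult_distrib mult_left_le_one_le abs_square_le_1)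
    have iDc: "integrable expseq (\<lambda>w. (D w * c m w)\<^sup>2)"
      by (rule Bochner_Integration.integrable_bound[OF iD]) (use c2 in \<open>auto simp: mult.commute\<close>)
    have icx: "integrable expseq (\<lambda>w. (c m w * \<xi> m w)\<^sup>2)"
      by (rule Bochner_Integration.integrable_bound[OF xi_sq[of m]]) (use c2 in auto)
    have ix: "integrable expseq (\<lambda>w. (D w * c m w) * \<xi> m w)"
      by (rule integrable_mult_squares) (use iDc xi_sq in auto)
    have zero: "(LINT w|expseq. (D w * c m w) * \<xi> m w) = 0"
      by (rule xi_orth) (use aD iDc in auto)
    have e: "(\<Sum>i\<in>{n..<Suc m}. c i w * \<xi> i w)\<^sup>2 = (D w)\<^sup>2 + (2 * ((D w * c m w) * \<xi> m w) + (c m w * \<xi> m w)\<^sup>2)" for w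
      using True by (simp add: D_def power2_eq_square algebra_simps)
    have "(LINT w|expseq. (c m w * \<xi> m w)\<^sup>2) \<le> \<sigma> m"
      by (rule integral_mono[OF icx xi_sq]) (use c2 in auto)
    then show ?thesis unfolding e using iD ix icx leD zero True
      by (simp add: Bochner_Integration.integral_add)
  qed auto
qed auto

text \<open>Kolmogorov's maximal inequality: the sum stopped when it first reaches
  \<open>\<epsilon>\<close> is still a weighted sum of orthogonal terms, and Chebyshev's inequality
  applies to it.\<close>

lemma maximal_ineq:
  assumes eps: "0 < \<epsilon>"
  shows "emeasure expseq {w. \<exists>m\<ge>n. \<epsilon> \<le> \<bar>\<Sum>i\<in>{n..<m}. \<xi> i w\<bar>} \<le> ennreal ((\<Sum>i. \<sigma> (i + n)) / \<epsilon>\<^sup>2)"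
proof -
  define D where "D m w = (\<Sum>i\<in>{n..<m}. \<xi> i w)" for m w
  have [measurable]: "D m \<in> borel_measurable seqS" for m unfolding D_def by measurable
  \<comment> \<open>The weight of summand \<open>i\<close> is 1 while the partial sums up to index
    \<open>i\<close> have stayed below \<open>\<epsilon>\<close>. These use only gaps before
    \<open>i\<close>, and the summand that causes the first excess is still included.\<close>
  define c :: "nat \<Rightarrow> (nat \<Rightarrow> real) \<Rightarrow> real" where "c i w = (if \<forall>k\<in>{n..i}. \<bar>D k w\<bar> < \<epsilon> then 1 else 0)" for i w
  have [measurable]: "c i \<in> borel_measurable seqS" for i unfolding c_def by measurable
  have ac: "adapted i (c i)" for i
    unfolding adapted_def
  proof (intro allI impI)
    fix w w' :: "nat \<Rightarrow> real" assume eq: "\<forall>j<i. w j = w' j"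
    have "D k w = D k w'" if "k \<le> i" for k unfolding D_def
      by (rule sum.cong[OF refl], rule adaptedD[OF xi_adapted]) (use eq that in auto)
    then show "c i w = c i w'" unfolding c_def by (auto cong: if_cong)
  qed
  have sq: "integrable expseq (\<lambda>w. (\<Sum>i\<in>{n..<m}. c i w * \<xi> i w)\<^sup>2)"
    "(LINT w|expseq. (\<Sum>i\<in>{n..<m}. c i w * \<xi> i w)\<^sup>2) \<le> (\<Sum>i\<in>{n..<m}. \<sigma> i)" for m
    using square_sum[of c n m] ac by (auto simp: c_def)
  define B where "B m = {w. \<exists>k\<in>{n..m}. \<epsilon> \<le> \<bar>D k w\<bar>}" for m
  have [measurable]: "B m \<in> sets seqS" for m
  proof -
    have "{w \<in> space seqS. \<exists>k\<in>{n..m}. \<epsilon> \<le> \<bar>D k w\<bar>} \<in> sets seqS" by measurable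
    then show ?thesis by (simp add: B_def)
  qed
  have B: "emeasure expseq (B m) \<le> ennreal ((\<Sum>i. \<sigma> (i + n)) / \<epsilon>\<^sup>2)" for m
  proof -
    have big: "\<epsilon>\<^sup>2 \<le> (\<Sum>i\<in>{n..<m}. c i w * \<xi> i w)\<^sup>2" if "w \<in> B m" for w
    proof -
      define k where "k = (LEAST k. n \<le> k \<and> \<epsilon> \<le> \<bar>D k w\<bar>)"
      obtain k' where k': "n \<le> k'" "k' \<le> m" "\<epsilon> \<le> \<bar>D k' w\<bar>" using \<open>w \<in> B m\<close> by (auto simp: B_def)
      then have k: "n \<le> k \<and> \<epsilon> \<le> \<bar>D k w\<bar>" using LeastI[of "\<lambda>k. n \<le> k \<and> \<epsilon> \<le> \<bar>D k w\<bar>" k'] unfolding k_def by auto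
      have kl: "\<bar>D j w\<bar> < \<epsilon>" if "n \<le> j" "j < k" for j
        using not_less_Least[of j "\<lambda>k. n \<le> k \<and> \<epsilon> \<le> \<bar>D k w\<bar>"] that unfolding k_def by auto
      have km: "k \<le> m" using k' Least_le[of "\<lambda>k. n \<le> k \<and> \<epsilon> \<le> \<bar>D k w\<bar>" k'] unfolding k_def by auto
      have c1: "c i w = 1" if "i \<in> {n..<k}" for i
      proof -
        have "\<forall>j\<in>{n..i}. \<bar>D j w\<bar> < \<epsilon>" using kl that by simp
        then show ?thesis unfolding c_def by (rule if_P)
      qed
      have "(\<Sum>i\<in>{n..<m}. c i w * \<xi> i w) = (\<Sum>i\<in>{n..<k}. c i w * \<xi> i w)"
      proof (rule sum.mono_neutral_right)
        show "\<forall>i\<in>{n..<m} - {n..<k}. c i w * \<xi> i w = 0"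
        proof
          fix i assume i: "i \<in> {n..<m} - {n..<k}"
          have "k \<in> {n..i}" using k i by simp
          moreover have "\<not> \<bar>D k w\<bar> < \<epsilon>" using k by linarith
          ultimately have "\<not> (\<forall>k\<in>{n..i}. \<bar>D k w\<bar> < \<epsilon>)" by blast
          then have "c i w = 0" unfolding c_def by (rule if_not_P)
          then show "c i w * \<xi> i w = 0" by simp
        qed
      qed (use km in auto)
      also have "\<dots> = D k w" unfolding D_def
        by (rule sum.cong) (use c1 in auto)
      finally have S: "(\<Sum>i\<in>{n..<m}. c i w * \<xi> i w) = D k w" .
      have "\<bar>\<epsilon>\<bar> \<le> \<bar>D k w\<bar>" using k eps by simp
      then show ?thesis unfolding S by (simp only: abs_le_square_iff)
    qed
    have "ennreal (\<epsilon>\<^sup>2) * emeasure expseq (B m) = (\<integral>\<^sup>+w. ennreal (\<epsilon>\<^sup>2) * indicator (B m) w \<partial>expseq)"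
      by (subst nn_integral_cmult_indicator) (auto simp: sets_expseq)
    also have "\<dots> \<le> (\<integral>\<^sup>+w. ennreal ((\<Sum>i\<in>{n..<m}. c i w * \<xi> i w)\<^sup>2) \<partial>expseq)"
      by (intro nn_integral_mono) (auto simp: indicator_def intro!: ennreal_leI big)
    also have "\<dots> = ennreal (LINT w|expseq. (\<Sum>i\<in>{n..<m}. c i w * \<xi> i w)\<^sup>2)"
      by (rule nn_integral_eq_integral) (use sq in auto)
    also have "\<dots> \<le> ennreal (\<Sum>i. \<sigma> (i + n))"
    proof (rule ennreal_leI)
      have "(\<Sum>i\<in>{n..<m}. \<sigma> i) = (\<Sum>i<m - n. \<sigma> (i + n))"
        by (rule sum.reindex_bij_witness[of _ "\<lambda>i. i + n" "\<lambda>i. i - n"]) auto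
      also have "\<dots> \<le> (\<Sum>i. \<sigma> (i + n))"
        by (rule sum_le_suminf) (use summable_shift in \<open>auto intro!: integral_nonneg\<close>)
      finally show "(LINT w|expseq. (\<Sum>i\<in>{n..<m}. c i w * \<xi> i w)\<^sup>2) \<le> (\<Sum>i. \<sigma> (i + n))"
        using sq(2)[of m] by linarith
    qed
    finally have "ennreal (1 / \<epsilon>\<^sup>2) * (ennreal (\<epsilon>\<^sup>2) * emeasure expseq (B m)) \<le> ennreal (1 / \<epsilon>\<^sup>2) * ennreal (\<Sum>i. \<sigma> (i + n))"
      by (rule mult_left_mono) simp
    then show ?thesis using eps
      by (simp add: mult.assoc[symmetric] ennreal_mult[symmetric] divide_inverse)
         (simp add: ennreal_mult'[symmetric] mult.commute)
  qed
  have "{w. \<exists>m\<ge>n. \<epsilon> \<le> \<bar>\<Sum>i\<in>{n..<m}. \<xi> i w\<bar>} = (\<Union>m. B m)"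
    unfolding B_def D_def[symmetric] by fastforce
  moreover have "emeasure expseq (\<Union>m. B m) = (SUP m. emeasure expseq (B m))"
  proof (rule SUP_emeasure_incseq[symmetric])
    show "range B \<subseteq> sets expseq" by (auto simp: sets_expseq)
    show "incseq B" unfolding incseq_def B_def by fastforce
  qed
  ultimately show ?thesis using B by (auto intro: SUP_least)
qed

text \<open>The maximal inequality bounds the oscillation after \<open>n\<close> by a tail of the
  variance series, so the partial sums are almost surely Cauchy.\<close>

lemma AE_convergent: "AE w in expseq. convergent (\<lambda>m. \<Sum>i<m. \<xi> i w)"
proof -
  have tail: "(\<lambda>n. \<Sum>i. \<sigma> (i + n)) \<longlonglongrightarrow> 0"
    using suminf_exist_split2[OF xi_summable] .
  have "AE w in expseq. \<exists>n. \<forall>m\<ge>n. \<bar>\<Sum>i\<in>{n..<m}. \<xi> i w\<bar> < 1 / real (Suc j)" for j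
  proof -
    define e where "e = 1 / real (Suc j)"
    have "0 < e" by (simp add: e_def)
    let ?X = "\<lambda>n. {w. \<exists>m\<ge>n. e \<le> \<bar>\<Sum>i\<in>{n..<m}. \<xi> i w\<bar>}"
    have [measurable]: "?X n \<in> sets seqS" for n
    proof -
      have "{w \<in> space seqS. \<exists>m\<ge>n. e \<le> \<bar>\<Sum>i\<in>{n..<m}. \<xi> i w\<bar>} \<in> sets seqS" by measurable
      then show ?thesis by simp
    qed
    have le: "emeasure expseq (\<Inter>n. ?X n) \<le> ennreal ((\<Sum>i. \<sigma> (i + n)) / e\<^sup>2)" for n
      by (rule order_trans[OF emeasure_mono maximal_ineq[OF \<open>0 < e\<close>]]) (auto simp: sets_expseq)
    have "(\<lambda>n. ennreal ((\<Sum>i. \<sigma> (i + n)) / e\<^sup>2)) \<longlonglongrightarrow> ennreal (0 / e\<^sup>2)"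
      by (intro tendsto_ennrealI tendsto_divide tail tendsto_const) (use \<open>0 < e\<close> in auto)
    then have "emeasure expseq (\<Inter>n. ?X n) \<le> ennreal (0 / e\<^sup>2)"
      by (rule LIMSEQ_le_const) (use le in auto)
    then have "emeasure expseq (\<Inter>n. ?X n) = 0" by simp
    then have "(\<Inter>n. ?X n) \<in> null_sets expseq" by (auto simp: null_sets_def sets_expseq)
    then have "AE w in expseq. w \<notin> (\<Inter>n. ?X n)" by (rule AE_not_in)
    then show ?thesis unfolding e_def[symmetric]
    proof eventually_elim
      case (elim w)
      then obtain n where "w \<notin> ?X n" by blast
      then have "\<forall>m\<ge>n. \<bar>\<Sum>i\<in>{n..<m}. \<xi> i w\<bar> < e" by (simp add: not_le) (metis not_le)
      then show ?case by blast
    qed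
  qed
  then have "AE w in expseq. \<forall>j. \<exists>n. \<forall>m\<ge>n. \<bar>\<Sum>i\<in>{n..<m}. \<xi> i w\<bar> < 1 / real (Suc j)"
    by (simp add: AE_all_countable)
  then show ?thesis
  proof eventually_elim
    case (elim w)
    have "Cauchy (\<lambda>m. \<Sum>i<m. \<xi> i w)"
    proof (rule metric_CauchyI)
      fix e :: real assume "0 < e"
      then obtain j where j: "1 / real (Suc j) < e / 2" by (metis half_gt_zero nat_approx_posE)
      obtain n where n': "\<forall>m\<ge>n. \<bar>\<Sum>i\<in>{n..<m}. \<xi> i w\<bar> < 1 / real (Suc j)"
        using spec[OF elim, of j] by (rule exE)
      have n: "\<bar>\<Sum>i\<in>{n..<m}. \<xi> i w\<bar> < 1 / real (Suc j)" if "m \<ge> n" for m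
        using n' that by simp
      have s: "(\<Sum>i<m. \<xi> i w) = (\<Sum>i<n. \<xi> i w) + (\<Sum>i\<in>{n..<m}. \<xi> i w)" if "m \<ge> n" for m
        using that by (metis lessThan_atLeast0 le0 sum.atLeastLessThan_concat)
      show "\<exists>M. \<forall>m\<ge>M. \<forall>k\<ge>M. dist (\<Sum>i<m. \<xi> i w) (\<Sum>i<k. \<xi> i w) < e"
      proof (intro exI[of _ n] allI impI)
        fix m k assume "n \<le> m" "n \<le> k"
        then show "dist (\<Sum>i<m. \<xi> i w) (\<Sum>i<k. \<xi> i w) < e"
          using n[of m] n[of k] j unfolding dist_real_def by (subst (1 2) s) linarith+
      qed
    qed
    then show ?case by (simp add: Cauchy_convergent_iff)
  qed
qed

text \<open>By Fatou the squared L2 distance of the limit from partial sum \<open>n\<close> is at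
  most the tail of the variances. Convergence therefore holds in L1 too, and the zero mean passes to
  the limit.\<close>

lemma limit_integrable:
  shows "integrable expseq (\<lambda>w. lim (\<lambda>m. \<Sum>i<m. \<xi> i w))"
    and "(LINT w|expseq. lim (\<lambda>m. \<Sum>i<m. \<xi> i w)) = 0"
proof -
  define L where "L w = lim (\<lambda>m. \<Sum>i<m. \<xi> i w)" for w
  define D where "D m w = (\<Sum>i<m. \<xi> i w)" for m w
  have [measurable]: "D m \<in> borel_measurable seqS" for m unfolding D_def by measurable
  have [measurable]: "L \<in> borel_measurable seqS" unfolding L_def by measurable
  have conv: "AE w in expseq. (\<lambda>m. D m w) \<longlonglongrightarrow> L w"
    using AE_convergent by eventually_elim (simp add: D_def L_def convergent_LIMSEQ_iff)
  have DL: "(\<integral>\<^sup>+w. ennreal ((L w - D n w)\<^sup>2) \<partial>expseq) \<le> ennreal (\<Sum>i. \<sigma> (i + n))" for n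
  proof -
    have "(\<integral>\<^sup>+w. ennreal ((L w - D n w)\<^sup>2) \<partial>expseq) = (\<integral>\<^sup>+w. liminf (\<lambda>m. ennreal ((D (m + n) w - D n w)\<^sup>2)) \<partial>expseq)"
    proof (rule nn_integral_cong_AE, use conv in eventually_elim)
      case (elim w)
      then have "(\<lambda>m. D (m + n) w) \<longlonglongrightarrow> L w" by (rule LIMSEQ_ignore_initial_segment)
      then have "(\<lambda>m. ennreal ((D (m + n) w - D n w)\<^sup>2)) \<longlonglongrightarrow> ennreal ((L w - D n w)\<^sup>2)"
        by (intro tendsto_ennrealI tendsto_power tendsto_diff tendsto_const)
      from lim_imp_Liminf[OF sequentially_bot this] show ?case by simp
    qed
    also have "\<dots> \<le> liminf (\<lambda>m. \<integral>\<^sup>+w. ennreal ((D (m + n) w - D n w)\<^sup>2) \<partial>expseq)"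
      by (rule nn_integral_liminf) measurable
    also have "\<dots> \<le> ennreal (\<Sum>i. \<sigma> (i + n))"
    proof (rule order_trans[OF Liminf_le_Limsup[OF sequentially_bot] Limsup_bounded], rule always_eventually, rule allI)
      fix m
      have e: "D (m + n) w - D n w = (\<Sum>i\<in>{n..<m+n}. 1 * \<xi> i w)" for w
        using sum.atLeastLessThan_concat[of 0 n "m + n" "\<lambda>i. \<xi> i w"] unfolding D_def lessThan_atLeast0 by simp
      have s: "integrable expseq (\<lambda>w. (\<Sum>i\<in>{n..<m+n}. 1 * \<xi> i w)\<^sup>2)"
        "(LINT w|expseq. (\<Sum>i\<in>{n..<m+n}. 1 * \<xi> i w)\<^sup>2) \<le> (\<Sum>i\<in>{n..<m+n}. \<sigma> i)"
        using square_sum[of "\<lambda>_ _. 1" n "m + n"] by (auto simp: adapted_def)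
      have "(\<integral>\<^sup>+w. ennreal ((D (m + n) w - D n w)\<^sup>2) \<partial>expseq) = ennreal (LINT w|expseq. (\<Sum>i\<in>{n..<m+n}. 1 * \<xi> i w)\<^sup>2)"
        unfolding e by (rule nn_integral_eq_integral) (use s in auto)
      also have "\<dots> \<le> ennreal (\<Sum>i. \<sigma> (i + n))"
      proof (rule ennreal_leI)
        have "(\<Sum>i\<in>{n..<m+n}. \<sigma> i) = (\<Sum>i<m. \<sigma> (i + n))"
          by (rule sum.reindex_bij_witness[of _ "\<lambda>i. i + n" "\<lambda>i. i - n"]) auto
        also have "\<dots> \<le> (\<Sum>i. \<sigma> (i + n))"
          by (rule sum_le_suminf) (use summable_shift in \<open>auto intro!: integral_nonneg\<close>)
        finally show "(LINT w|expseq. (\<Sum>i\<in>{n..<m+n}. 1 * \<xi> i w)\<^sup>2) \<le> (\<Sum>i. \<sigma> (i + n))"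
          using s(2) by linarith
      qed
      finally show "(\<integral>\<^sup>+w. ennreal ((D (m + n) w - D n w)\<^sup>2) \<partial>expseq) \<le> ennreal (\<Sum>i. \<sigma> (i + n))" .
    qed
    finally show ?thesis .
  qed
  have i2: "integrable expseq (\<lambda>w. (L w - D n w)\<^sup>2)" "(LINT w|expseq. (L w - D n w)\<^sup>2) \<le> (\<Sum>i. \<sigma> (i + n))" for n
  proof -
    show i: "integrable expseq (\<lambda>w. (L w - D n w)\<^sup>2)"
      by (rule integrableI_nonneg) (auto intro: order.strict_trans1[OF DL])
    have "ennreal (LINT w|expseq. (L w - D n w)\<^sup>2) \<le> ennreal (\<Sum>i. \<sigma> (i + n))"
      using DL[of n] by (subst nn_integral_eq_integral[OF i, symmetric]) auto
    then show "(LINT w|expseq. (L w - D n w)\<^sup>2) \<le> (\<Sum>i. \<sigma> (i + n))"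
      by (subst (asm) ennreal_le_iff) (auto intro!: suminf_nonneg integral_nonneg summable_shift)
  qed
  have iLD: "integrable expseq (\<lambda>w. L w - D n w)" for n
    using integrable_mult_squares[of "\<lambda>w. L w - D n w" expseq "\<lambda>_. 1"] i2[of n] by simp
  have ixi: "integrable expseq (\<xi> i)" for i
    using integrable_mult_squares[of "\<xi> i" expseq "\<lambda>_. 1"] xi_sq[of i] by simp
  then have iD: "integrable expseq (D n)" for n unfolding D_def by auto
  show iL: "integrable expseq L" using iLD[of 0] by (simp add: D_def)
  have ED: "(LINT w|expseq. D n w) = 0" for n
  proof -
    have "(LINT w|expseq. \<xi> i w) = 0" for i
      using xi_orth[of "\<lambda>_. 1" i] by (simp add: adapted_def)
    then show ?thesis unfolding D_def by (subst Bochner_Integration.integral_sum) (auto simp: ixi)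
  qed
  \<comment> \<open>The inequality \<open>|x| <= eps + x^2 / eps\<close> trades the first moment for
    the second; afterwards \<open>n\<close> tends to infinity before \<open>\<epsilon>\<close> tends
    to 0.\<close>
  have bound: "\<bar>LINT w|expseq. L w\<bar> \<le> \<epsilon> + (\<Sum>i. \<sigma> (i + n)) / \<epsilon>" if eps: "0 < \<epsilon>" for \<epsilon> n
  proof -
    have "\<bar>LINT w|expseq. L w\<bar> = \<bar>LINT w|expseq. L w - D n w\<bar>"
      using iL iD ED by simp
    also have "\<dots> \<le> (LINT w|expseq. \<bar>L w - D n w\<bar>)" by (rule integral_abs_bound)
    also have "\<dots> \<le> (LINT w|expseq. \<epsilon> + (L w - D n w)\<^sup>2 / \<epsilon>)"
    proof (rule integral_mono)
      fix w
      have "x \<le> \<epsilon> + x\<^sup>2 / \<epsilon>" if "0 \<le> x" for x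
      proof (cases "x \<le> \<epsilon>")
        case True
        then show ?thesis using eps by (simp add: add_increasing2)
      next
        case False
        then have "x * \<epsilon> \<le> x * x" using that by (intro mult_left_mono) auto
        then have "x \<le> x\<^sup>2 / \<epsilon>" using eps by (simp add: field_simps power2_eq_square)
        then show ?thesis using eps by linarith
      qed
      from this[of "\<bar>L w - D n w\<bar>"] show "\<bar>L w - D n w\<bar> \<le> \<epsilon> + (L w - D n w)\<^sup>2 / \<epsilon>" by simp
    qed (use iLD i2 in auto)
    also have "\<dots> = \<epsilon> + (LINT w|expseq. (L w - D n w)\<^sup>2) / \<epsilon>"
      using i2 by (simp add: expseq.prob_space[simplified])
    also have "\<dots> \<le> \<epsilon> + (\<Sum>i. \<sigma> (i + n)) / \<epsilon>" using i2(2)[of n] eps by (simp add: divide_right_mono)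
    finally show ?thesis .
  qed
  have le: "\<bar>LINT w|expseq. L w\<bar> \<le> \<epsilon> + 0 / \<epsilon>" if "0 < \<epsilon>" for \<epsilon>
  proof (rule LIMSEQ_le_const)
    show "(\<lambda>n. \<epsilon> + (\<Sum>i. \<sigma> (i + n)) / \<epsilon>) \<longlonglongrightarrow> \<epsilon> + 0 / \<epsilon>"
      using suminf_exist_split2[OF xi_summable] that by (intro tendsto_intros) auto
  qed (use bound[OF that] in auto)
  have "\<bar>LINT w|expseq. L w\<bar> \<le> 0"
  proof (rule field_le_epsilon)
    fix e :: real assume "0 < e"
    from le[OF this] show "\<bar>LINT w|expseq. L w\<bar> \<le> 0 + e" by simp
  qed
  then show "(LINT w|expseq. L w) = 0" by simp
qed

end

section \<open>Measurable dependence of integrated rates and their inverses on a parameter\<close>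

lemma cumint_nonpos_arg: "t \<le> 0 \<Longrightarrow> cumint a t = 0"
  by (simp add: cumint_def)

lemma measurable_cumint [measurable (raw)]:
  assumes [measurable]: "(\<lambda>(x, s). b x s) \<in> borel_measurable (M \<Otimes>\<^sub>M borel)" "g \<in> borel_measurable M"
  shows "(\<lambda>x. cumint (b x) (g x)) \<in> borel_measurable M"
  unfolding cumint_def by measurable

text \<open>Finiteness is not assumed, so \<open>cumint b\<close> may fall to 0 where the integral
  becomes infinite. Before a time with a positive value it is increasing and left continuous, so a
  rational time slightly earlier still exceeds \<open>v\<close>.\<close>

lemma cumint_left_approx:
  assumes [measurable]: "b \<in> borel_measurable borel" and v: "0 \<le> v" "v < cumint b s"
  shows "\<exists>q::rat. of_rat q < s \<and> v < cumint b (of_rat q)"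
proof -
  define X where "X t = (\<integral>\<^sup>+ x. ennreal (b x) * indicator {0<..t} x \<partial>lborel)" for t
  have cX: "cumint b t = enn2real (X t)" for t by (simp add: cumint_def X_def)
  have mono: "X t \<le> X t'" if "t \<le> t'" for t t'
    unfolding X_def by (intro nn_integral_mono) (use that in \<open>auto simp: indicator_def\<close>)
  have fin: "X s < \<infinity>" and vX: "ennreal v < X s"
  proof -
    have "X s \<noteq> \<infinity>" using v unfolding cX by auto
    then show fin: "X s < \<infinity>" by (simp add: less_top)
    have "ennreal v < ennreal (enn2real (X s))" using v unfolding cX by (simp add: ennreal_less_iff)
    then show "ennreal v < X s" using fin by simp
  qed
  have "X s = (\<integral>\<^sup>+ x. (SUP n. ennreal (b x) * indicator {0<..s - 1 / real (Suc n)} x) \<partial>lborel)"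
    unfolding X_def
  proof (rule nn_integral_cong_AE, use AE_lborel_singleton[of s] in eventually_elim)
    case (elim x)
    show ?case
    proof (rule antisym)
      show "ennreal (b x) * indicator {0<..s} x \<le> (SUP n. ennreal (b x) * indicator {0<..s - 1 / real (Suc n)} x)"
      proof (cases "0 < x \<and> x < s")
        case True
        then obtain n where "1 / real (Suc n) < s - x" using nat_approx_posE[of "s - x"] by auto
        then show ?thesis using True by (intro SUP_upper2[of n]) (auto simp: indicator_def)
      next
        case False
        then have "indicator {0<..s} x = (0::ennreal)" using elim by (auto simp: indicator_def)
        then show ?thesis by simp
      qed
      have "x \<le> s - 1 / (1 + real n) \<Longrightarrow> x \<le> s" for n using divide_nonneg_nonneg[of 1 "1 + real n"] by linarith
      then show "(SUP n. ennreal (b x) * indicator {0<..s - 1 / real (Suc n)} x) \<le> ennreal (b x) * indicator {0<..s} x"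
        by (intro SUP_least) (auto simp: indicator_def)
    qed
  qed
  also have "\<dots> = (SUP n. X (s - 1 / real (Suc n)))"
    unfolding X_def
  proof (rule nn_integral_monotone_convergence_SUP)
    have "s - 1 / real (Suc m) \<le> s - 1 / real (Suc n)" if "m \<le> n" for m n
      using that by (auto simp: frac_le)
    then have "{0<..s - 1 / real (Suc m)} \<subseteq> {0<..s - 1 / real (Suc n)}" if "m \<le> n" for m n
      using that by fastforce
    then have "indicator {0<..s - 1 / real (Suc m)} x \<le> (indicator {0<..s - 1 / real (Suc n)} x :: ennreal)" if "m \<le> n" for m n x
      using that by (intro indicator_leI) blast
    then show "incseq (\<lambda>n x. ennreal (b x) * indicator {0<..s - 1 / real (Suc n)} x)"
      unfolding incseq_def le_fun_def by (intro allI impI mult_left_mono) (simp_all del: of_nat_Suc)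
  qed measurable
  finally obtain n where n: "ennreal v < X (s - 1 / real (Suc n))"
    using vX by (auto simp: less_SUP_iff)
  obtain q where q: "s - 1 / real (Suc n) < of_rat q" "of_rat q < s"
    using of_rat_dense[of "s - 1 / real (Suc n)" s] by auto
  have "ennreal v < X (of_rat q)" using n mono[of "s - 1 / real (Suc n)" "of_rat q"] q by auto
  moreover have "X (of_rat q) < \<infinity>" using fin mono[of "of_rat q" s] q by auto
  ultimately have "v < cumint b (of_rat q)" unfolding cX using v
    by (cases "X (of_rat q)") (auto simp: ennreal_less_iff)
  then show ?thesis using q by blast
qed

text \<open>The infimum lies below \<open>c\<close> iff some rational time before \<open>c\<close>
  already qualifies, which is a countable condition.\<close>

lemma measurable_cuminv [measurable (raw)]:
  assumes [measurable]: "(\<lambda>(x, s). b x s) \<in> borel_measurable (M \<Otimes>\<^sub>M borel)" "v \<in> borel_measurable M"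
  shows "(\<lambda>x. cuminv (b x) (v x)) \<in> borel_measurable M"
  unfolding borel_measurable_iff_less
proof
  fix c
  \<comment> \<open>For \<open>v x < 0\<close> every time qualifies, and for \<open>v x\<close>
    above all values none does. The inverse is then one of the fixed reals \<open>Inf UNIV\<close>
    and \<open>Inf {}\<close>, whose values do not matter.\<close>
  have eq: "cuminv (b x) (v x) < c \<longleftrightarrow> (if v x < 0 then Inf (UNIV::real set) < c
      else if \<exists>q::rat. v x < cumint (b x) (of_rat q) then \<exists>q::rat. of_rat q < c \<and> v x < cumint (b x) (of_rat q)
      else Inf ({}::real set) < c)" if x: "x \<in> space M" for x
  proof -
    have [measurable]: "b x \<in> borel_measurable borel"
      using measurable_Pair2[OF assms(1) x] by simp
    define A where "A = {s. v x < cumint (b x) s}"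
    consider "v x < 0" | "0 \<le> v x" "A = {}" | "0 \<le> v x" "A \<noteq> {}" by fastforce
    then show ?thesis
    proof cases
      case 1
      have "0 \<le> cumint (b x) s" for s by (simp add: cumint_def)
      then have "{s. v x < cumint (b x) s} = UNIV" using 1 by (auto intro: less_le_trans)
      then show ?thesis using 1 by (simp add: cuminv_def)
    next
      case 2
      then show ?thesis unfolding cuminv_def A_def by auto
    next
      case 3
      have "0 < s" if "s \<in> A" for s using that 3 cumint_nonpos_arg[of s "b x"] by (force simp: A_def)
      then have "bdd_below A" by (intro bdd_belowI[of _ 0]) (auto intro: less_imp_le)
      then have "cuminv (b x) (v x) < c \<longleftrightarrow> (\<exists>s\<in>A. s < c)"
        using 3 unfolding cuminv_def A_def[symmetric] by (simp add: cInf_less_iff)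
      also have "\<dots> \<longleftrightarrow> (\<exists>q::rat. of_rat q < c \<and> v x < cumint (b x) (of_rat q))"
      proof
        assume "\<exists>s\<in>A. s < c"
        then obtain s where s: "v x < cumint (b x) s" "s < c" by (auto simp: A_def)
        then obtain q :: rat where "of_rat q < s" "v x < cumint (b x) (of_rat q)"
          using cumint_left_approx[of "b x" "v x" s] 3(1) by auto
        then show "\<exists>q::rat. of_rat q < c \<and> v x < cumint (b x) (of_rat q)"
          using s by (intro exI[of _ q]) simp
      qed (auto simp: A_def)
      finally have eq: "cuminv (b x) (v x) < c \<longleftrightarrow> (\<exists>q::rat. of_rat q < c \<and> v x < cumint (b x) (of_rat q))" .
      obtain s where "v x < cumint (b x) s" using 3(2) by (auto simp: A_def)
      then have "\<exists>q::rat. v x < cumint (b x) (of_rat q)"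
        using cumint_left_approx[of "b x" "v x" s] 3(1) by auto
      then show ?thesis using 3(1) eq by simp
    qed
  qed
  have "{x \<in> space M. if v x < 0 then Inf (UNIV::real set) < c
      else if \<exists>q::rat. v x < cumint (b x) (of_rat q) then \<exists>q::rat. of_rat q < c \<and> v x < cumint (b x) (of_rat q)
      else Inf ({}::real set) < c} \<in> sets M" by measurable
  moreover have "{x \<in> space M. cuminv (b x) (v x) < c} = {x \<in> space M. if v x < 0 then Inf (UNIV::real set) < c
      else if \<exists>q::rat. v x < cumint (b x) (of_rat q) then \<exists>q::rat. of_rat q < c \<and> v x < cumint (b x) (of_rat q)
      else Inf ({}::real set) < c}" using eq by blast
  ultimately show "{x \<in> space M. cuminv (b x) (v x) < c} \<in> sets M" by simp
qed

lemma emeasure_exp_law_Ioi: "0 \<le> c \<Longrightarrow> emeasure exp_law {c<..} = ennreal (exp (- c))"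
proof -
  assume c: "0 \<le> c"
  have "emeasure exp_law {c<..} = (\<integral>\<^sup>+x. ennreal (exp (- x)) * indicator {c<..} x \<partial>lborel)"
    unfolding exp_law_def using c by (subst emeasure_density) (auto intro!: nn_integral_cong simp: indicator_def)
  then show ?thesis by (simp add: nn_integral_lborel_Ioi nn_integral_exp_tail')
qed

text \<open>The factor \<open>a x * exp (x - cumint a x)\<close> turns the exponential density into
  \<open>a x * exp (- cumint a x)\<close>, the density with hazard rate \<open>a\<close>. The
  integrated hazard maps this law to the exponential one, cut off at the total hazard.\<close>

lemma (in rate) nn_integral_exp_law_tilt:
  assumes [measurable]: "g \<in> borel_measurable borel"
  shows "(\<integral>\<^sup>+x. ennreal (a x * exp (x - cumint a x)) * g (cumint a x) \<partial>exp_law) =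
    (\<integral>\<^sup>+u. g u * indicator {u. 0 < u \<and> (\<exists>x. u < cumint a x)} u \<partial>exp_law)"
proof -
  have "{u. 0 < u \<and> (\<exists>x. u < cumint a x)} = {0<..} \<inter> (\<Union>x. {..<cumint a x})" by auto
  moreover have "open ({0<..} \<inter> (\<Union>x. {..<cumint a x}))" by (intro open_Int open_UN ballI) auto
  ultimately have [measurable]: "{u. 0 < u \<and> (\<exists>x. u < cumint a x)} \<in> sets borel" by (simp only: borel_open)
  have "(\<integral>\<^sup>+x. ennreal (a x * exp (x - cumint a x)) * g (cumint a x) \<partial>exp_law) =
    (\<integral>\<^sup>+x. (g (cumint a x) * ennreal (exp (- cumint a x))) * (ennreal (a x) * indicator {0<..} x) \<partial>lborel)"
  proof (subst nn_integral_exp_law, measurable, rule nn_integral_cong)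
    fix x
    show "ennreal (a x * exp (x - cumint a x)) * g (cumint a x) * (ennreal (exp (- x)) * indicator {0<..} x) =
      g (cumint a x) * ennreal (exp (- cumint a x)) * (ennreal (a x) * indicator {0<..} x)"
    proof (cases "0 < x")
      case True
      have "ennreal (a x * exp (x - cumint a x)) * ennreal (exp (- x)) = ennreal (a x * (exp (x - cumint a x) * exp (- x)))"
        using pos[OF True] by (simp add: ennreal_mult[symmetric] mult.assoc)
      also have "exp (x - cumint a x) * exp (- x) = exp (- cumint a x)" by (simp add: exp_add[symmetric])
      also have "ennreal (a x * exp (- cumint a x)) = ennreal (exp (- cumint a x)) * ennreal (a x)"
        using pos[OF True] by (simp add: ennreal_mult[symmetric] mult.commute)
      finally have "ennreal (a x * exp (x - cumint a x)) * ennreal (exp (- x)) = ennreal (exp (- cumint a x)) * ennreal (a x)" .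
      then have "g (cumint a x) * (ennreal (a x * exp (x - cumint a x)) * ennreal (exp (- x))) =
        g (cumint a x) * (ennreal (exp (- cumint a x)) * ennreal (a x))" by (rule arg_cong)
      then show ?thesis using True by (simp only: indicator_def greaterThan_iff of_bool_eq mult_1_right) (simp only: ac_simps)
    qed simp
  qed
  also have "\<dots> = (\<integral>\<^sup>+u. (g u * ennreal (exp (- u))) * indicator {u. 0 < u \<and> (\<exists>x. u < cumint a x)} u \<partial>lborel)"
    by (rule nn_integral_cumint_subst) measurable
  also have "\<dots> = (\<integral>\<^sup>+u. g u * indicator {u. 0 < u \<and> (\<exists>x. u < cumint a x)} u \<partial>exp_law)"
    by (subst nn_integral_exp_law, measurable, rule nn_integral_cong) (auto simp: indicator_def)
  finally show ?thesis .
qed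

section \<open>Change of intensity along the jump chain\<close>

text \<open>\<open>a n w s\<close> is the intensity at time \<open>s\<close> after the \<open>n\<close>-th jump, \<open>w\<close> being the sequence of gaps.\<close>

locale hazard =
  fixes a :: "nat \<Rightarrow> (nat \<Rightarrow> real) \<Rightarrow> real \<Rightarrow> real"
  assumes a_meas [measurable]: "\<And>n. (\<lambda>(w, s). a n w s) \<in> borel_measurable (seqS \<Otimes>\<^sub>M borel)"
    and a_pos: "\<And>n w s. 0 < s \<Longrightarrow> 0 < a n w s"
    and a_adapted: "\<And>n. adapted n (a n)"
    and a_fin: "AE w in expseq. \<forall>n. (\<integral>\<^sup>+s. ennreal (a n w s) * indicator {0<..w n} s \<partial>lborel) < \<infinity>"
begin

lemma a_meas1 [measurable]: "a n w \<in> borel_measurable borel"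
  using measurable_Pair2[OF a_meas[of n], of w] by simp

lemma a_upd [simp]: "n \<le> m \<Longrightarrow> a n (w(m := x)) = a n w"
  using a_adapted by (rule adapted_upd)

text \<open>\<open>a n w\<close> ignores the gap \<open>w n\<close>. Resampling this gap turns
  finiteness up to the observed gap into finiteness up to arbitrarily late times.\<close>

lemma AE_rate: "AE w in expseq. \<forall>n. rate (a n w)"
  unfolding AE_all_countable
proof
  fix n
  have "AE w in expseq. (\<integral>\<^sup>+s. ennreal (a n w s) * indicator {0<..w n} s \<partial>lborel) < \<infinity>"
    using a_fin by eventually_elim auto
  from AE_resample[OF this, of n] show "AE w in expseq. rate (a n w)"
  proof eventually_elim
    case (elim w)
    show ?case
    proof
      fix t
      obtain x where x: "x > t" "(\<integral>\<^sup>+s. ennreal (a n w s) * indicator {0<..x} s \<partial>lborel) < \<infinity>"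
        using AE_exp_law_exceeds[OF elim, of t] by auto
      have "(\<integral>\<^sup>+s. ennreal (a n w s) * indicator {0<..t} s \<partial>lborel) \<le> (\<integral>\<^sup>+s. ennreal (a n w s) * indicator {0<..x} s \<partial>lborel)"
        by (intro nn_integral_mono) (use x in \<open>auto simp: indicator_def\<close>)
      then show "(\<integral>\<^sup>+s. ennreal (a n w s) * indicator {0<..t} s \<partial>lborel) < \<infinity>" using x by auto
    qed (auto simp: a_pos)
  qed
qed

definition new_gaps :: "(nat \<Rightarrow> real) \<Rightarrow> nat \<Rightarrow> real" where
  "new_gaps w n = cumint (a n w) (w n)"

text \<open>Likelihood ratio of the first \<open>n\<close> gaps: densities with hazard rates
  \<open>a i w\<close> over exponential densities.\<close>

definition lik :: "nat \<Rightarrow> (nat \<Rightarrow> real) \<Rightarrow> real" where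
  "lik n w = (\<Prod>i<n. a i w (w i) * exp (w i - new_gaps w i))"

lemma new_gaps_meas [measurable]: "(\<lambda>w. new_gaps w n) \<in> borel_measurable seqS"
  unfolding new_gaps_def by measurable

lemma new_gaps_meas' [measurable]: "new_gaps \<in> measurable seqS seqS"
  by (rule measurable_abs_UNIV) measurable

lemma lik_meas [measurable]: "lik n \<in> borel_measurable seqS"
  unfolding lik_def by measurable

lemma new_gaps_upd: "new_gaps (w(n := x)) n = cumint (a n w) x" "m < n \<Longrightarrow> new_gaps (w(n := x)) m = new_gaps w m"
  by (auto simp: new_gaps_def)

lemma lik_upd: "lik (Suc n) (w(n := x)) = lik n w * (a n w x * exp (x - cumint (a n w) x))"
proof -
  have "lik n (w(n := x)) = lik n w" unfolding lik_def
    by (rule prod.cong) (auto simp: new_gaps_def)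
  then show ?thesis by (simp add: lik_def new_gaps_upd)
qed

lemma lik_pos: "(\<And>i. i < n \<Longrightarrow> 0 < w i) \<Longrightarrow> 0 < lik n w"
  unfolding lik_def by (intro prod_pos) (auto intro!: mult_pos_pos a_pos)

abbreviation J :: "nat \<Rightarrow> (nat \<Rightarrow> real) \<Rightarrow> real set" where
  "J n w \<equiv> {u. 0 < u \<and> (\<exists>x. u < cumint (a n w) x)}"

text \<open>Given the earlier gaps, the last factor of the likelihood tilts gap \<open>n\<close> to
  hazard rate \<open>a n w\<close>, and its integrated value is exponential on \<open>J n w\<close>.
  \<open>G\<close> must not look beyond entry \<open>n\<close>, because later new gaps change
  together with gap \<open>n\<close>.\<close>

lemma lik_step:
  assumes [measurable]: "G \<in> borel_measurable seqS" and G: "adapted (Suc n) G"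
  shows "(\<integral>\<^sup>+w. ennreal (lik (Suc n) w) * G (new_gaps w) \<partial>expseq) =
    (\<integral>\<^sup>+w. ennreal (lik n w) * (\<integral>\<^sup>+u. G ((new_gaps w)(n := u)) * indicator (J n w) u \<partial>exp_law) \<partial>expseq)"
proof -
  have "(\<integral>\<^sup>+w. ennreal (lik (Suc n) w) * G (new_gaps w) \<partial>expseq) =
    (\<integral>\<^sup>+w. (\<integral>\<^sup>+x. ennreal (lik (Suc n) (w(n := x))) * G (new_gaps (w(n := x))) \<partial>exp_law) \<partial>expseq)"
    by (rule nn_integral_resample) measurable
  also have "\<dots> = (\<integral>\<^sup>+w. ennreal (lik n w) * (\<integral>\<^sup>+u. G ((new_gaps w)(n := u)) * indicator (J n w) u \<partial>exp_law) \<partial>expseq)"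
  proof (rule nn_integral_cong_AE, use AE_rate AE_expseq_pos in eventually_elim)
    case (elim w)
    interpret rate "a n w" using elim by auto
    have pos: "0 < lik n w" using elim by (intro lik_pos) auto
    have "(\<integral>\<^sup>+x. ennreal (lik (Suc n) (w(n := x))) * G (new_gaps (w(n := x))) \<partial>exp_law) =
      (\<integral>\<^sup>+x. ennreal (lik n w) * (ennreal (a n w x * exp (x - cumint (a n w) x)) * G ((new_gaps w)(n := cumint (a n w) x))) \<partial>exp_law)"
    proof (rule nn_integral_cong)
      fix x
      have "G (new_gaps (w(n := x))) = G ((new_gaps w)(n := cumint (a n w) x))"
        by (rule adaptedD[OF G]) (auto simp: less_Suc_eq new_gaps_upd)
      then show "ennreal (lik (Suc n) (w(n := x))) * G (new_gaps (w(n := x))) =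
        ennreal (lik n w) * (ennreal (a n w x * exp (x - cumint (a n w) x)) * G ((new_gaps w)(n := cumint (a n w) x)))"
        using pos by (simp add: lik_upd ennreal_mult' mult.assoc)
    qed
    also have "\<dots> = ennreal (lik n w) * (\<integral>\<^sup>+x. ennreal (a n w x * exp (x - cumint (a n w) x)) * G ((new_gaps w)(n := cumint (a n w) x)) \<partial>exp_law)"
      by (rule nn_integral_cmult) measurable
    also have "(\<integral>\<^sup>+x. ennreal (a n w x * exp (x - cumint (a n w) x)) * G ((new_gaps w)(n := cumint (a n w) x)) \<partial>exp_law) =
      (\<integral>\<^sup>+u. G ((new_gaps w)(n := u)) * indicator (J n w) u \<partial>exp_law)"
      by (rule nn_integral_exp_law_tilt) measurable
    finally show ?case .
  qed
  finally show ?thesis .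
qed

text \<open>The loss is the exponential mass outside \<open>J n w\<close>, which is the probability
  that the tilted gap is infinite.\<close>

lemma lik_decreasing: "(\<integral>\<^sup>+w. ennreal (lik (Suc n) w) \<partial>expseq) \<le> (\<integral>\<^sup>+w. ennreal (lik n w) \<partial>expseq)"
proof -
  have "(\<integral>\<^sup>+w. ennreal (lik (Suc n) w) \<partial>expseq) = (\<integral>\<^sup>+w. ennreal (lik n w) * (\<integral>\<^sup>+u. indicator (J n w) u \<partial>exp_law) \<partial>expseq)"
    using lik_step[of "\<lambda>_. 1" n] by (simp add: adapted_def)
  also have "\<dots> \<le> (\<integral>\<^sup>+w. ennreal (lik n w) * (\<integral>\<^sup>+u. 1 \<partial>exp_law) \<partial>expseq)"
    by (intro nn_integral_mono mult_left_mono) (auto simp: indicator_def)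
  finally show ?thesis by (simp add: exp_law.emeasure_space_1[simplified])
qed

lemma lik_le_one: "(\<integral>\<^sup>+w. ennreal (lik n w) \<partial>expseq) \<le> 1"
proof (induction n)
  case 0
  show ?case by (simp add: lik_def expseq.emeasure_space_1[simplified])
next
  case (Suc n)
  then show ?case using lik_decreasing[of n] by simp
qed

text \<open>Entries from \<open>n\<close> on hold the placeholder 1, which \<open>a n\<close>
  ignores by adaptedness; every stage is thus a full sequence to which \<open>a n\<close> can be
  applied.\<close>

fun old_prefix :: "nat \<Rightarrow> (nat \<Rightarrow> real) \<Rightarrow> nat \<Rightarrow> real" where
  "old_prefix 0 u = (\<lambda>_. 1)"
| "old_prefix (Suc n) u = (old_prefix n u)(n := cuminv (a n (old_prefix n u)) (u n))"

definition old_gaps :: "(nat \<Rightarrow> real) \<Rightarrow> nat \<Rightarrow> real" where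
  "old_gaps u n = old_prefix (Suc n) u n"

lemma old_prefix_meas [measurable]: "old_prefix n \<in> measurable seqS seqS"
proof (induction n)
  case (Suc n)
  note [measurable] = Suc
  have "(\<lambda>(u, s). a n (old_prefix n u) s) \<in> borel_measurable (seqS \<Otimes>\<^sub>M borel)" by measurable
  moreover have "old_prefix (Suc n) = (\<lambda>u. (old_prefix n u)(n := cuminv (a n (old_prefix n u)) (u n)))" by (rule ext) (rule old_prefix.simps)
  ultimately show ?case by (simp only:) measurable
qed (auto intro!: measurable_abs_UNIV)

lemma old_gaps_meas [measurable]: "old_gaps \<in> measurable seqS seqS"
  unfolding old_gaps_def[abs_def] by (rule measurable_abs_UNIV) measurable

text \<open>Inductively the first \<open>n\<close> entries are already right, \<open>a n\<close>
  sees only these, and \<open>cuminv\<close> undoes the integral that defines new gap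
  \<open>n\<close>.\<close>

lemma old_gaps_new_gaps:
  assumes "\<And>n. unbounded_rate (a n w)" "\<And>n. 0 < w n"
  shows "old_gaps (new_gaps w) = w"
proof -
  have "\<forall>i<n. old_prefix n (new_gaps w) i = w i" for n
  proof (induction n)
    case (Suc n)
    interpret unbounded_rate "a n w" by fact
    have "a n (old_prefix n (new_gaps w)) = a n w" using Suc by (intro adaptedD[OF a_adapted]) auto
    then have "cuminv (a n (old_prefix n (new_gaps w))) (new_gaps w n) = w n"
      using cuminv_cumint[of "w n"] assms(2)[of n] by (simp add: new_gaps_def)
    then show ?case using Suc by (auto simp: less_Suc_eq)
  qed simp
  then show ?thesis by (auto simp: old_gaps_def fun_eq_iff simp del: old_prefix.simps)
qed

end

section \<open>Passage to the limit of the likelihoods\<close>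

locale hazard_unit = hazard +
  fixes Lam :: "(nat \<Rightarrow> real) \<Rightarrow> real"
  assumes Lam_meas [measurable]: "Lam \<in> borel_measurable seqS"
    and lik_lim: "AE w in expseq. (\<lambda>n. lik n w) \<longlonglongrightarrow> Lam w"
    and Lam_unit: "(\<integral>\<^sup>+w. ennreal (Lam w) \<partial>expseq) = 1"
begin

text \<open>The total masses decrease from 1, and by Fatou's lemma they stay above the mass 1 of the limit.\<close>

lemma lik_one: "(\<integral>\<^sup>+w. ennreal (lik n w) \<partial>expseq) = 1"
proof (rule antisym[OF lik_le_one])
  have dec: "decseq (\<lambda>n. \<integral>\<^sup>+w. ennreal (lik n w) \<partial>expseq)" by (rule decseq_SucI) (rule lik_decreasing)
  have "1 = (\<integral>\<^sup>+w. liminf (\<lambda>n. ennreal (lik n w)) \<partial>expseq)"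
    unfolding Lam_unit[symmetric]
  proof (rule nn_integral_cong_AE, use lik_lim in eventually_elim)
    case (elim w)
    then have "(\<lambda>n. ennreal (lik n w)) \<longlonglongrightarrow> ennreal (Lam w)" by (rule tendsto_ennrealI)
    from lim_imp_Liminf[OF sequentially_bot this] show ?case by simp
  qed
  also have "\<dots> \<le> liminf (\<lambda>n. \<integral>\<^sup>+w. ennreal (lik n w) \<partial>expseq)"
    by (rule nn_integral_liminf) measurable
  also have "\<dots> \<le> (\<integral>\<^sup>+w. ennreal (lik n w) \<partial>expseq)"
    by (rule order_trans[OF Liminf_le_Limsup[OF sequentially_bot] Limsup_bounded])
       (use dec in \<open>auto simp: eventually_sequentially decseq_def\<close>)
  finally show "1 \<le> (\<integral>\<^sup>+w. ennreal (lik n w) \<partial>expseq)" .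
qed

text \<open>By \<open>lik_one\<close> no mass is lost at stage \<open>n\<close>. So
  \<open>J n w\<close> has exponential mass 1 wherever \<open>lik n\<close> is positive, that is,
  almost everywhere, whereas a bounded integrated rate would miss a half line of positive
  mass.\<close>

lemma AE_unbounded_rate: "AE w in expseq. \<forall>n. unbounded_rate (a n w)"
  unfolding AE_all_countable
proof
  fix n
  define K where "K w = emeasure exp_law (J n w)" for w
  have K1: "K w \<le> 1" for w unfolding K_def by (rule exp_law.measure_le_1)
  have J_eq: "J n w = {u. 0 < u \<and> (\<exists>x::nat. u < cumint (a n w) (real x))}" if "rate (a n w)" for w
  proof -
    interpret rate "a n w" by fact
    show ?thesis
    proof safe
      fix u x assume "u < cumint (a n w) x"
      moreover obtain m :: nat where "x < real m" using reals_Archimedean2 by blast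
      ultimately show "\<exists>x::nat. u < cumint (a n w) (real x)"
        using cumint_mono[of x "real m"] by (intro exI[of _ m]) auto
    qed auto
  qed
  \<comment> \<open>Restricting the witness \<open>x\<close> to natural numbers gives a version of
    \<open>K\<close> that is visibly measurable in \<open>w\<close>.\<close>
  define K' where "K' w = (\<integral>\<^sup>+u. indicator {u. 0 < u \<and> (\<exists>x::nat. u < cumint (a n w) (real x))} u \<partial>exp_law)" for w
  have Jm: "{u. 0 < u \<and> (\<exists>x::nat. u < cumint (a n w) (real x))} \<in> sets borel" for w
  proof -
    have "{u. 0 < u \<and> (\<exists>x::nat. u < cumint (a n w) (real x))} = {0<..} \<inter> (\<Union>x. {..<cumint (a n w) (real x)})" by auto
    then show ?thesis by simp
  qed
  have KK': "AE w in expseq. K w = K' w"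
    using AE_rate
  proof eventually_elim
    case (elim w)
    then show ?case using Jm[of w] unfolding K_def K'_def by (subst J_eq) auto
  qed
  have [measurable]: "K' \<in> borel_measurable seqS"
    unfolding K'_def by measurable
  have K'1: "K' w \<le> 1" for w using Jm[of w] unfolding K'_def by (simp add: exp_law.measure_le_1)
  have e1: "(\<integral>\<^sup>+w. ennreal (lik n w) * K' w \<partial>expseq) = 1"
  proof -
    have "1 = (\<integral>\<^sup>+w. ennreal (lik n w) * (\<integral>\<^sup>+u. indicator (J n w) u \<partial>exp_law) \<partial>expseq)"
      using lik_step[of "\<lambda>_. 1" n] lik_one[of "Suc n"] by (simp add: adapted_def)
    also have "\<dots> = (\<integral>\<^sup>+w. ennreal (lik n w) * K' w \<partial>expseq)"
      by (rule nn_integral_cong_AE, use AE_rate in eventually_elim) (auto simp: J_eq K'_def)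
    finally show ?thesis by simp
  qed
  have "1 = (\<integral>\<^sup>+w. ennreal (lik n w) \<partial>expseq)" by (rule lik_one[symmetric])
  also have "\<dots> = (\<integral>\<^sup>+w. ennreal (lik n w) * K' w + ennreal (lik n w) * (1 - K' w) \<partial>expseq)"
    by (intro nn_integral_cong) (auto simp: distrib_left[symmetric] add.commute[of "K' _"] diff_add_cancel_ennreal K'1)
  also have "\<dots> = 1 + (\<integral>\<^sup>+w. ennreal (lik n w) * (1 - K' w) \<partial>expseq)"
    by (subst nn_integral_add) (auto simp: e1)
  finally have "1 + 0 = 1 + (\<integral>\<^sup>+w. ennreal (lik n w) * (1 - K' w) \<partial>expseq)" by simp
  then have "(\<integral>\<^sup>+w. ennreal (lik n w) * (1 - K' w) \<partial>expseq) = 0"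
    using ennreal_add_left_cancel[of 1 0 "\<integral>\<^sup>+w. ennreal (lik n w) * (1 - K' w) \<partial>expseq"] by auto
  then have "AE w in expseq. ennreal (lik n w) * (1 - K' w) = 0"
    by (subst (asm) nn_integral_0_iff_AE) auto
  with KK' AE_rate AE_expseq_pos show "AE w in expseq. unbounded_rate (a n w)"
  proof eventually_elim
    case (elim w)
    interpret rate "a n w" using elim by auto
    have "ennreal (lik n w) \<noteq> 0" using lik_pos[of n w] elim by (simp add: ennreal_eq_0_iff not_le)
    then have "1 - K w = 0" using elim by auto
    then have "1 \<le> K w" by (simp add: ennreal_minus_eq_0)
    show ?case
    proof
      fix u
      show "\<exists>x. u < cumint (a n w) x"
      proof (rule ccontr)
        assume *: "\<nexists>x. u < cumint (a n w) x"
        define c where "c = max 0 u"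
        have "J n w \<in> sets exp_law" using Jm[of w] elim by (subst J_eq) auto
        have "J n w \<inter> {c<..} = {}" using * by (auto simp: c_def not_less) (meson less_le_not_le order_trans less_imp_le)
        have "0 \<le> c" by (simp add: c_def)
        have "{c<..} \<in> sets exp_law" by simp
        from plus_emeasure[OF \<open>J n w \<in> sets exp_law\<close> this \<open>J n w \<inter> {c<..} = {}\<close>]
        have "emeasure exp_law (J n w \<union> {c<..}) = K w + ennreal (exp (- c))"
          unfolding emeasure_exp_law_Ioi[OF \<open>0 \<le> c\<close>] K_def by (rule sym)
        moreover have "emeasure exp_law (J n w \<union> {c<..}) \<le> 1" by (rule exp_law.measure_le_1)
        ultimately have "K w + ennreal (exp (- c)) \<le> 1" by simp
        from order_trans[OF add_right_mono[OF \<open>1 \<le> K w\<close>] this]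
        have "ennreal (1 + exp (- c)) \<le> ennreal 1" by (simp add: ennreal_plus)
        then have "1 + exp (- c) \<le> 1" by (subst (asm) ennreal_le_iff) auto
        then show False by (simp add: not_le[symmetric])
      qed
    qed
  qed
qed

text \<open>Unboundedness removes the cutoff from the last new gap. Integrating this gap out leaves
  a function of the earlier new gaps, to which the induction hypothesis applies.\<close>

lemma lik_law:
  assumes "F \<in> borel_measurable seqS" "adapted n F"
  shows "(\<integral>\<^sup>+w. ennreal (lik n w) * F (new_gaps w) \<partial>expseq) = (\<integral>\<^sup>+w. F w \<partial>expseq)"
  using assms
proof (induction n arbitrary: F)
  case 0
  have "F v = F w" for v w using 0 by (auto intro: adaptedD)
  then have "ennreal (lik 0 w) * F (new_gaps w) = F w" for w by (simp add: lik_def)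
  then show ?case by simp
next
  case (Suc n)
  note [measurable] = Suc.prems(1)
  define F' where "F' v = (\<integral>\<^sup>+u. F (v(n := u)) \<partial>exp_law)" for v
  have [measurable]: "F' \<in> borel_measurable seqS" unfolding F'_def by measurable
  have aF': "adapted n F'" unfolding adapted_def F'_def
    by (intro allI impI nn_integral_cong adaptedD[OF Suc.prems(2)]) (auto simp: less_Suc_eq)
  have "(\<integral>\<^sup>+w. ennreal (lik (Suc n) w) * F (new_gaps w) \<partial>expseq) =
    (\<integral>\<^sup>+w. ennreal (lik n w) * (\<integral>\<^sup>+u. F ((new_gaps w)(n := u)) * indicator (J n w) u \<partial>exp_law) \<partial>expseq)"
    by (rule lik_step) (use Suc.prems in auto)
  also have "\<dots> = (\<integral>\<^sup>+w. ennreal (lik n w) * F' (new_gaps w) \<partial>expseq)"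
  proof (rule nn_integral_cong_AE, use AE_unbounded_rate in eventually_elim)
    case (elim w)
    interpret unbounded_rate "a n w" using elim by auto
    have "(\<integral>\<^sup>+u. F ((new_gaps w)(n := u)) * indicator (J n w) u \<partial>exp_law) = F' (new_gaps w)"
      unfolding F'_def by (rule nn_integral_cong_AE, use AE_exp_law_pos in eventually_elim) (use unbounded in auto)
    then show ?case by simp
  qed
  also have "\<dots> = (\<integral>\<^sup>+w. F' w \<partial>expseq)" by (rule Suc.IH) (use aF' in auto)
  also have "\<dots> = (\<integral>\<^sup>+w. F w \<partial>expseq)" unfolding F'_def by (rule nn_integral_resample[symmetric]) measurable
  finally show ?case .
qed

lemma AE_Lam_nonneg: "AE w in expseq. 0 \<le> Lam w"
  using lik_lim AE_expseq_pos
proof eventually_elim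
  case (elim w)
  then show ?case by (intro LIMSEQ_le_const[OF elim(1)]) (auto intro!: less_imp_le lik_pos)
qed

text \<open>Scheffe's lemma: the likelihoods and their limit all have mass 1, so almost sure
  convergence implies convergence in L1.\<close>

lemma Lam_L1: "(\<lambda>n. \<integral>\<^sup>+w. ennreal \<bar>lik n w - Lam w\<bar> \<partial>expseq) \<longlonglongrightarrow> 0"
proof -
  have a: "(\<integral>\<^sup>+w. ennreal \<bar>Lam w\<bar> \<partial>expseq) = 1"
    unfolding Lam_unit[symmetric] by (rule nn_integral_cong_AE, use AE_Lam_nonneg in eventually_elim) auto
  have b: "(\<integral>\<^sup>+w. ennreal \<bar>lik n w\<bar> \<partial>expseq) = 1" for n
    unfolding lik_one[of n, symmetric]
    by (rule nn_integral_cong_AE, use AE_expseq_pos in eventually_elim) (auto simp: lik_pos less_imp_le)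
  have "integrable expseq Lam" using a by (auto simp: integrable_iff_bounded)
  then have "(\<lambda>n. \<integral>\<^sup>+w. ennreal (norm (lik n w - Lam w)) \<partial>expseq) \<longlonglongrightarrow> 0"
    by (intro Scheffe_lemma2) (use lik_lim a b in auto)
  then show ?thesis by simp
qed

text \<open>For each \<open>m \<ge> n\<close> the weight \<open>lik m\<close> reproduces the product
  law exactly on events of the first \<open>n\<close> new gaps, and replacing it by
  \<open>Lam\<close> costs at most the L1 distance.\<close>

lemma Lam_law_adapted:
  assumes [measurable]: "X \<in> sets seqS" and X: "adapted n (\<lambda>w. w \<in> X)"
  shows "(\<integral>\<^sup>+w. ennreal (Lam w) * indicator X (new_gaps w) \<partial>expseq) = emeasure expseq X"
proof -
  define \<epsilon> where "\<epsilon> m = (\<integral>\<^sup>+w. ennreal \<bar>lik m w - Lam w\<bar> \<partial>expseq)" for m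
  have l: "(\<integral>\<^sup>+w. ennreal (lik m w) * indicator X (new_gaps w) \<partial>expseq) = emeasure expseq X" if "n \<le> m" for m
  proof -
    have "adapted m (indicator X :: _ \<Rightarrow> ennreal)"
      unfolding adapted_def
    proof (intro allI impI)
      fix w w' :: "nat \<Rightarrow> real" assume "\<forall>i<m. w i = w' i"
      then have "(w \<in> X) = (w' \<in> X)" by (intro adaptedD[OF adapted_mono[OF X that]]) auto
      then show "indicator X w = (indicator X w' :: ennreal)" by (simp add: indicator_def)
    qed
    then show ?thesis by (subst lik_law) (auto simp: sets_expseq)
  qed
  have 1: "(\<integral>\<^sup>+w. ennreal (Lam w) * indicator X (new_gaps w) \<partial>expseq) \<le> emeasure expseq X + \<epsilon> m" if "n \<le> m" for m
  proof -
    have "(\<integral>\<^sup>+w. ennreal (Lam w) * indicator X (new_gaps w) \<partial>expseq) \<le>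
      (\<integral>\<^sup>+w. ennreal (lik m w) * indicator X (new_gaps w) + ennreal \<bar>lik m w - Lam w\<bar> \<partial>expseq)"
    proof (rule nn_integral_mono_AE, use AE_expseq_pos in eventually_elim)
      case (elim w)
      have "0 < lik m w" using elim by (intro lik_pos) auto
      then show ?case by (auto simp: indicator_def ennreal_plus[symmetric] simp del: ennreal_plus intro!: ennreal_leI)
    qed
    also have "\<dots> = emeasure expseq X + \<epsilon> m" by (subst nn_integral_add) (auto simp: l[OF that] \<epsilon>_def)
    finally show ?thesis .
  qed
  have 2: "emeasure expseq X \<le> (\<integral>\<^sup>+w. ennreal (Lam w) * indicator X (new_gaps w) \<partial>expseq) + \<epsilon> m" if "n \<le> m" for m
  proof -
    have "emeasure expseq X = (\<integral>\<^sup>+w. ennreal (lik m w) * indicator X (new_gaps w) \<partial>expseq)" using l[OF that] by simp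
    also have "\<dots> \<le> (\<integral>\<^sup>+w. ennreal (Lam w) * indicator X (new_gaps w) + ennreal \<bar>lik m w - Lam w\<bar> \<partial>expseq)"
    proof (rule nn_integral_mono_AE, use AE_Lam_nonneg in eventually_elim)
      case (elim w)
      then show ?case by (auto simp: indicator_def ennreal_plus[symmetric] simp del: ennreal_plus intro!: ennreal_leI)
    qed
    also have "\<dots> = (\<integral>\<^sup>+w. ennreal (Lam w) * indicator X (new_gaps w) \<partial>expseq) + \<epsilon> m"
      by (subst nn_integral_add) (auto simp: \<epsilon>_def)
    finally show ?thesis .
  qed
  have lim: "(\<lambda>m. c + \<epsilon> m) \<longlonglongrightarrow> c + 0" for c
    by (intro tendsto_intros) (use Lam_L1 in \<open>simp add: \<epsilon>_def\<close>)
  show ?thesis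
  proof (rule antisym)
    show "(\<integral>\<^sup>+w. ennreal (Lam w) * indicator X (new_gaps w) \<partial>expseq) \<le> emeasure expseq X"
    proof -
      have "(\<integral>\<^sup>+w. ennreal (Lam w) * indicator X (new_gaps w) \<partial>expseq) \<le> emeasure expseq X + 0"
        by (rule LIMSEQ_le_const[OF lim]) (use 1 in blast)
      then show ?thesis by simp
    qed
    show "emeasure expseq X \<le> (\<integral>\<^sup>+w. ennreal (Lam w) * indicator X (new_gaps w) \<partial>expseq)"
    proof -
      have "emeasure expseq X \<le> (\<integral>\<^sup>+w. ennreal (Lam w) * indicator X (new_gaps w) \<partial>expseq) + 0"
        by (rule LIMSEQ_le_const[OF lim]) (use 2 in blast)
      then show ?thesis by simp
    qed
  qed
qed

text \<open>Cylinder sets determine a finite measure on the sequence space, and each of them depends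
  on finitely many new gaps.\<close>

lemma distr_new_gaps: "distr (density expseq (\<lambda>w. ennreal (Lam w))) seqS new_gaps = expseq" (is "?D = _")
proof -
  have [measurable_cong]: "sets (density expseq (\<lambda>w. ennreal (Lam w))) = sets seqS" by (simp add: sets_expseq)
  have "?D = PiM UNIV (\<lambda>_. exp_law)"
  proof (rule measure_eqI_PiM_infinite)
    show "sets ?D = sets (PiM UNIV (\<lambda>_. exp_law))" by (simp add: sets_expseq[unfolded expseq_def])
    fix A and K :: "nat set" assume K: "finite K" "K \<subseteq> UNIV" and A: "\<And>i. i \<in> K \<Longrightarrow> A i \<in> sets exp_law"
    let ?X = "prod_emb UNIV (\<lambda>_. exp_law) K (Pi\<^sub>E K A)"
    have X: "?X = {w. \<forall>i\<in>K. w i \<in> A i}" by (auto simp: prod_emb_def PiE_iff)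
    have m: "?X \<in> sets seqS"
      using sets_PiM_I[of K UNIV A "\<lambda>_. exp_law"] K A sets_expseq unfolding expseq_def by auto
    \<comment> \<open>For empty \<open>K\<close> the value \<open>Max K\<close> is arbitrary, but
      the cylinder is then the whole space.\<close>
    have "adapted (Suc (Max K)) (\<lambda>w. w \<in> ?X)"
      unfolding adapted_def X
    proof (intro allI impI)
      fix w w' :: "nat \<Rightarrow> real" assume eq: "\<forall>i<Suc (Max K). w i = w' i"
      have "w i = w' i" if "i \<in> K" for i using eq Max_ge[OF K(1) that] by auto
      then show "(w \<in> {w. \<forall>i\<in>K. w i \<in> A i}) = (w' \<in> {w. \<forall>i\<in>K. w i \<in> A i})" by auto
    qed
    from Lam_law_adapted[OF m this]
    have "(\<integral>\<^sup>+w. ennreal (Lam w) * indicator ?X (new_gaps w) \<partial>expseq) = emeasure expseq ?X" .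
    moreover have "emeasure ?D ?X = (\<integral>\<^sup>+w. ennreal (Lam w) * indicator ?X (new_gaps w) \<partial>expseq)"
    proof -
      have "emeasure ?D ?X = (\<integral>\<^sup>+w. indicator ?X w \<partial>?D)" using m by simp
      also have "\<dots> = (\<integral>\<^sup>+w. indicator ?X (new_gaps w) \<partial>density expseq (\<lambda>w. ennreal (Lam w)))"
        by (rule nn_integral_distr) (use m in measurable)
      also have "\<dots> = (\<integral>\<^sup>+w. ennreal (Lam w) * indicator ?X (new_gaps w) \<partial>expseq)"
        by (rule nn_integral_density) (use m in measurable)
      finally show ?thesis .
    qed
    ultimately show "emeasure ?D ?X = emeasure (PiM UNIV (\<lambda>_. exp_law)) ?X" by (simp add: expseq_def)
  next
    have "emeasure ?D UNIV = (\<integral>\<^sup>+w. 1 \<partial>?D)" by simp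
    also have "\<dots> = (\<integral>\<^sup>+w. 1 \<partial>density expseq (\<lambda>w. ennreal (Lam w)))"
      by (rule nn_integral_distr) measurable
    also have "\<dots> = (\<integral>\<^sup>+w. ennreal (Lam w) * 1 \<partial>expseq)"
      by (rule nn_integral_density) measurable
    finally have "emeasure ?D UNIV = (\<integral>\<^sup>+w. ennreal (Lam w) \<partial>expseq)" by simp
    then show "finite_measure ?D" by (intro finite_measureI) (simp add: Lam_unit)
  qed simp
  then show ?thesis by (simp add: expseq_def)
qed

lemma nn_integral_new_gaps:
  assumes [measurable]: "f \<in> borel_measurable seqS"
  shows "(\<integral>\<^sup>+w. ennreal (Lam w) * f (new_gaps w) \<partial>expseq) = (\<integral>\<^sup>+w. f w \<partial>expseq)"
proof -
  have [measurable_cong]: "sets (density expseq (\<lambda>w. ennreal (Lam w))) = sets seqS" by (simp add: sets_expseq)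
  have "(\<integral>\<^sup>+w. f w \<partial>expseq) = (\<integral>\<^sup>+w. f (new_gaps w) \<partial>density expseq (\<lambda>w. ennreal (Lam w)))"
    by (subst distr_new_gaps[symmetric], rule nn_integral_distr) measurable
  also have "\<dots> = (\<integral>\<^sup>+w. ennreal (Lam w) * f (new_gaps w) \<partial>expseq)"
    by (rule nn_integral_density) measurable
  finally show ?thesis by simp
qed

end

section \<open>Convergence of the log-likelihood\<close>

definition log_gap :: "real \<Rightarrow> real" where
  "log_gap x = x - 1 - ln x"

lemma log_gap_meas [measurable]: "log_gap \<in> borel_measurable borel"
  unfolding log_gap_def by measurable

lemma log_gap_nonneg: "0 < x \<Longrightarrow> 0 \<le> log_gap x"
  using ln_le_minus_one[of x] by (simp add: log_gap_def)

text \<open>With \<open>b = sqrt x\<close> one has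
  \<open>log_gap x = (b - 1)^2 + 2 * log_gap b\<close>, and the last term is nonnegative. The left
  side is the Hellinger integrand from \<open>Ppp2\<close>.\<close>

lemma log_gap_ge_sqrt:
  assumes "0 < x" shows "(sqrt x - 1)\<^sup>2 \<le> log_gap x"
proof -
  define b where "b = sqrt x"
  have b: "0 < b" "x = b\<^sup>2" using assms by (auto simp: b_def)
  have "ln x = 2 * ln b" using b by (simp add: ln_realpow)
  then have "log_gap x = (b - 1)\<^sup>2 + 2 * log_gap b" using b by (simp add: log_gap_def power2_eq_square algebra_simps)
  then show ?thesis using log_gap_nonneg[OF b(1)] by (simp add: b_def)
qed

text \<open>Both bounds pass through \<open>b = sqrt x\<close> and
  \<open>(b - 1)^2 <= log_gap x\<close>. The constant 16 arises for \<open>x\<close> slightly below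
  1: there \<open>b >= 1/2\<close> gives \<open>- ln b <= 2 * (1 - b)\<close>, hence
  \<open>(ln x)^2 <= 16 * (b - 1)^2\<close>. The other cases yield smaller constants.\<close>

lemma ln_log_gap_bounds:
  assumes x: "0 < x"
  shows "\<bar>ln x\<bar> \<le> 1 \<Longrightarrow> (ln x)\<^sup>2 \<le> 16 * log_gap x" and "1 < \<bar>ln x\<bar> \<Longrightarrow> \<bar>ln x\<bar> \<le> 16 * log_gap x"
proof -
  define b where "b = sqrt x"
  have b: "0 < b" "x = b\<^sup>2" using x by (auto simp: b_def)
  have lnb: "ln x = 2 * ln b" using b by (simp add: ln_realpow)
  have ge: "(b - 1)\<^sup>2 \<le> log_gap x" using log_gap_ge_sqrt[OF x] by (simp add: b_def)
  have nn: "0 \<le> log_gap x" by (rule log_gap_nonneg[OF x])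
  have "(\<bar>ln x\<bar> \<le> 1 \<longrightarrow> (ln x)\<^sup>2 \<le> 16 * log_gap x) \<and> (1 < \<bar>ln x\<bar> \<longrightarrow> \<bar>ln x\<bar> \<le> 16 * log_gap x)"
  proof (cases "1 \<le> b")
    case True
    then have "0 \<le> ln b" "ln b \<le> b - 1" using ln_le_minus_one[OF b(1)] by auto
    then have "(ln b)\<^sup>2 \<le> (b - 1)\<^sup>2" by (intro power_mono) auto
    then have sq: "(ln x)\<^sup>2 \<le> 4 * log_gap x" using ge by (simp add: lnb power_mult_distrib)
    have "\<bar>ln x\<bar> \<le> (ln x)\<^sup>2" if "1 < \<bar>ln x\<bar>"
      using that mult_left_mono[of 1 "\<bar>ln x\<bar>" "\<bar>ln x\<bar>"] by (simp add: power2_eq_square)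
    then show ?thesis using sq nn by auto
  next
    case False
    then have lb: "ln b < 0" using b by (simp add: ln_less_zero)
    show ?thesis
    proof (intro conjI impI)
      assume "\<bar>ln x\<bar> \<le> 1"
      then have "- (1/2) \<le> ln b" using lnb by auto
      then have "exp (- (1/2)) \<le> b" using b by (metis exp_le_cancel_iff exp_ln)
      moreover have "1 / 2 \<le> exp (- (1/2) :: real)" using exp_ge_add_one_self[of "- (1/2) :: real"] by simp
      ultimately have b2: "1 / 2 \<le> b" by linarith
      have "- ln b = ln (1 / b)" using b by (simp add: ln_div)
      also have "\<dots> \<le> 1 / b - 1" using b by (intro ln_le_minus_one) auto
      also have "\<dots> = (1 - b) * (1 / b)" using b by (simp add: field_simps)
      also have "\<dots> \<le> (1 - b) * 2" using b2 b False by (intro mult_left_mono) (auto simp: field_simps)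
      finally have "- ln b \<le> 2 * (1 - b)" by simp
      then have "(- ln b)\<^sup>2 \<le> (2 * (1 - b))\<^sup>2" using lb by (intro power_mono) auto
      also have "\<dots> = 4 * (b - 1)\<^sup>2" by (simp add: power2_eq_square algebra_simps)
      finally show "(ln x)\<^sup>2 \<le> 16 * log_gap x" using ge by (simp add: lnb power_mult_distrib)
    next
      assume "1 < \<bar>ln x\<bar>"
      then have l: "ln b < - (1/2)" "1 < - ln x" using lb lnb by auto
      \<comment> \<open>For \<open>ln x < -1\<close> the point \<open>b\<close> stays away from 1,
        so \<open>log_gap x >= 1/9\<close> absorbs the 1 in
        \<open>- ln x <= log_gap x + 1\<close>.\<close>
      have "3 / 2 \<le> exp (1 / 2 :: real)" using exp_ge_add_one_self[of "1/2 :: real"] by simp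
      then have "exp (- (1/2) :: real) \<le> 2 / 3" by (simp add: exp_minus field_simps)
      moreover have "b < exp (- (1/2))" using l(1) b by (metis exp_less_cancel_iff exp_ln)
      ultimately have "1 / 3 \<le> 1 - b" by linarith
      then have "(1 / 3)\<^sup>2 \<le> (1 - b)\<^sup>2" by (intro power_mono) auto
      then have "1 / 9 \<le> log_gap x" using ge by (simp add: power2_eq_square algebra_simps)
      moreover have "- ln x - 1 \<le> log_gap x" using x by (simp add: log_gap_def)
      ultimately show "\<bar>ln x\<bar> \<le> 16 * log_gap x" using l nn by linarith
    qed
  qed
  then show "\<bar>ln x\<bar> \<le> 1 \<Longrightarrow> (ln x)\<^sup>2 \<le> 16 * log_gap x" and "1 < \<bar>ln x\<bar> \<Longrightarrow> \<bar>ln x\<bar> \<le> 16 * log_gap x" by auto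
qed

text \<open>If \<open>f\<close> is not integrable, its integral is 0 by convention and the bound is
  trivial; this spares integrability side conditions later.\<close>

lemma abs_LINT_Ioc_le:
  fixes f :: "real \<Rightarrow> real"
  shows "ennreal \<bar>LINT s:{0<..x}|lborel. f s\<bar> \<le> (\<integral>\<^sup>+s. ennreal \<bar>f s\<bar> * indicator {0<..x} s \<partial>lborel)"
proof (cases "set_integrable lborel {0<..x} f")
  case True
  have "ennreal (norm (LINT s:{0<..x}|lborel. f s)) \<le> (\<integral>\<^sup>+s. norm (indicator {0<..x} s *\<^sub>R f s) \<partial>lborel)"
    unfolding set_lebesgue_integral_def by (rule integral_norm_bound_ennreal) (use True in \<open>simp add: set_integrable_def\<close>)
  also have "\<dots> = (\<integral>\<^sup>+s. ennreal \<bar>f s\<bar> * indicator {0<..x} s \<partial>lborel)"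
    by (rule nn_integral_cong) (auto simp: indicator_def)
  finally show ?thesis by simp
next
  case False
  then have "(LINT s:{0<..x}|lborel. f s) = 0"
    unfolding set_lebesgue_integral_def set_integrable_def by (rule not_integrable_integral_eq)
  then show ?thesis by simp
qed

section \<open>Series of functions with summable means\<close>

lemma suminf_finite_tendsto_0:
  fixes f :: "nat \<Rightarrow> ennreal"
  assumes "(\<Sum>n. f n) \<noteq> \<infinity>" shows "(\<lambda>n. enn2real (f n)) \<longlonglongrightarrow> 0" and "f n \<noteq> \<infinity>"
proof -
  have fin: "f n \<noteq> \<infinity>" for n
  proof
    assume "f n = \<infinity>"
    then have "\<infinity> \<le> (\<Sum>n. f n)" using sum_le_suminf[of f "{n}"] by simp
    then show False using assms by (simp add: top_unique)
  qed
  then show "f n \<noteq> \<infinity>" .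
  have "ennreal (enn2real (f n)) = f n" for n using fin[of n] by (simp add: less_top)
  then have "summable (\<lambda>n. enn2real (f n))"
    using assms by (intro summable_suminf_not_top) auto
  then show "(\<lambda>n. enn2real (f n)) \<longlonglongrightarrow> 0" by (rule summable_LIMSEQ_zero)
qed

lemma AE_suminf_finite:
  fixes f :: "nat \<Rightarrow> 'a \<Rightarrow> ennreal"
  assumes [measurable]: "\<And>n. f n \<in> borel_measurable M" and "(\<Sum>n. \<integral>\<^sup>+x. f n x \<partial>M) < \<infinity>"
  shows "AE x in M. (\<Sum>n. f n x) \<noteq> \<infinity>"
proof (rule nn_integral_PInf_AE)
  show "(\<integral>\<^sup>+x. (\<Sum>n. f n x) \<partial>M) \<noteq> \<infinity>"
    using assms(2) by (subst nn_integral_suminf) auto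
qed measurable

lemma integral_series:
  fixes f :: "nat \<Rightarrow> 'a \<Rightarrow> real"
  assumes [measurable]: "\<And>n. f n \<in> borel_measurable M" and fin: "(\<Sum>n. \<integral>\<^sup>+x. ennreal \<bar>f n x\<bar> \<partial>M) < \<infinity>"
  shows "AE x in M. summable (\<lambda>n. f n x)" "integrable M (\<lambda>x. \<Sum>n. f n x)" "\<And>n. integrable M (f n)"
    "(LINT x|M. (\<Sum>n. f n x)) = (\<Sum>n. (LINT x|M. f n x))"
proof -
  have n: "(\<integral>\<^sup>+x. ennreal \<bar>f n x\<bar> \<partial>M) \<noteq> \<infinity>" for n
    using suminf_finite_tendsto_0(2)[of "\<lambda>n. \<integral>\<^sup>+x. ennreal \<bar>f n x\<bar> \<partial>M"] fin by auto
  show i: "integrable M (f n)" for n using n[of n] by (auto simp: integrable_iff_bounded less_top)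
  have s: "AE x in M. summable (\<lambda>n. norm (f n x))"
  proof -
    have "AE x in M. (\<Sum>n. ennreal \<bar>f n x\<bar>) \<noteq> \<infinity>" by (rule AE_suminf_finite) (use fin in auto)
    then show ?thesis by eventually_elim (simp add: summable_suminf_not_top)
  qed
  then show "AE x in M. summable (\<lambda>n. f n x)" by (auto elim!: eventually_mono intro: summable_norm_cancel)
  have "(\<integral>\<^sup>+x. ennreal \<bar>f n x\<bar> \<partial>M) = ennreal (LINT x|M. norm (f n x))" for n
    using i[of n] by (subst nn_integral_eq_integral) auto
  then have "summable (\<lambda>n. LINT x|M. norm (f n x))"
    using fin by (intro summable_suminf_not_top) auto
  with i s show "integrable M (\<lambda>x. \<Sum>n. f n x)" "(LINT x|M. (\<Sum>n. f n x)) = (\<Sum>n. (LINT x|M. f n x))"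
    by (auto intro!: integrable_suminf integral_suminf)
qed

locale hazard_entropy = hazard +
  assumes ent_fin: "(\<integral>\<^sup>+w. (\<Sum>n. \<integral>\<^sup>+s. ennreal (log_gap (a n w s)) * indicator {0<..w n} s \<partial>lborel) \<partial>expseq) < \<infinity>"
begin

definition gap_entropy :: "nat \<Rightarrow> ennreal" where
  "gap_entropy n = (\<integral>\<^sup>+w. (\<integral>\<^sup>+s. ennreal (log_gap (a n w s)) * indicator {0<..w n} s \<partial>lborel) \<partial>expseq)"

lemma suminf_gap_entropy: "(\<integral>\<^sup>+w. (\<Sum>n. \<integral>\<^sup>+s. ennreal (log_gap (a n w s)) * indicator {0<..w n} s \<partial>lborel) \<partial>expseq) = (\<Sum>n. gap_entropy n)"
  unfolding gap_entropy_def by (rule nn_integral_suminf) measurable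

lemma suminf_gap_entropy_fin: "(\<Sum>n. gap_entropy n) < \<infinity>" using ent_fin by (simp add: suminf_gap_entropy)

lemma suminf_gap_entropy_cmult: "(\<Sum>n. ennreal c * gap_entropy n) < \<infinity>"
  using suminf_gap_entropy_fin by (simp add: ennreal_suminf_cmult ennreal_mult_less_top)

lemma gap_entropy_fin: "gap_entropy n < \<infinity>"
  using suminf_finite_tendsto_0(2)[of gap_entropy n] suminf_gap_entropy_fin by (simp add: less_top)

lemma adapted_comp: "adapted n (\<lambda>w s. F (a n w s))"
  using a_adapted[of n] unfolding adapted_def by metis

text \<open>The compensator formula makes the integral along the gap and the value at the jump equal
  in mean, so pointwise bounds by \<open>log_gap\<close> may be used at either place.\<close>

lemma gap_entropy_eq: "gap_entropy n = (\<integral>\<^sup>+w. ennreal (log_gap (a n w (w n))) \<partial>expseq)"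
  unfolding gap_entropy_def by (rule nn_integral_compensator[symmetric]) (auto intro!: adapted_comp)

text \<open>\<open>log_gap\<close> dominates the square of the small logarithms and the absolute value of the large ones.
  Hence the former are summed as a square integrable martingale and the latter absolutely.\<close>

definition small_log :: "nat \<Rightarrow> (nat \<Rightarrow> real) \<Rightarrow> real \<Rightarrow> real" where
  "small_log n w s = (if \<bar>ln (a n w s)\<bar> \<le> 1 then ln (a n w s) else 0)"

definition large_log :: "nat \<Rightarrow> (nat \<Rightarrow> real) \<Rightarrow> real \<Rightarrow> real" where
  "large_log n w s = (if \<bar>ln (a n w s)\<bar> \<le> 1 then 0 else ln (a n w s))"

lemma small_log_meas [measurable]: "(\<lambda>(w, s). small_log n w s) \<in> borel_measurable (seqS \<Otimes>\<^sub>M borel)"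
  unfolding small_log_def by measurable

lemma large_log_meas [measurable]: "(\<lambda>(w, s). large_log n w s) \<in> borel_measurable (seqS \<Otimes>\<^sub>M borel)"
  unfolding large_log_def by measurable

lemma small_log_meas1 [measurable]: "small_log n w \<in> borel_measurable borel"
  using measurable_Pair2[OF small_log_meas[of n], of w] by simp

lemma small_log_adapted: "adapted n (small_log n)" unfolding small_log_def[abs_def] by (rule adapted_comp)

lemma large_log_adapted: "adapted n (large_log n)" unfolding large_log_def[abs_def] by (rule adapted_comp)

lemma small_log_large_log: "small_log n w s + large_log n w s = ln (a n w s)"
  by (simp add: small_log_def large_log_def)

lemma small_log_bound: "\<bar>small_log n w s\<bar> \<le> 1" by (simp add: small_log_def)

lemma small_log_sq: "0 < s \<Longrightarrow> (small_log n w s)\<^sup>2 \<le> 16 * log_gap (a n w s)"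
  using ln_log_gap_bounds(1)[OF a_pos[of s n w]] log_gap_nonneg[OF a_pos[of s n w]] by (auto simp: small_log_def)

lemma large_log_le: "0 < s \<Longrightarrow> \<bar>large_log n w s\<bar> \<le> 16 * log_gap (a n w s)"
  using ln_log_gap_bounds(2)[OF a_pos[of s n w]] log_gap_nonneg[OF a_pos[of s n w]] by (auto simp: large_log_def)

lemma nn_integral_le_gap_entropy:
  assumes [measurable]: "(\<lambda>(w, s). f w s) \<in> borel_measurable (seqS \<Otimes>\<^sub>M borel)"
    and f: "\<And>w s. 0 < s \<Longrightarrow> f w s \<le> 16 * log_gap (a n w s)"
  shows "(\<integral>\<^sup>+w. ennreal (f w (w n)) \<partial>expseq) \<le> ennreal 16 * gap_entropy n"
proof -
  have "(\<integral>\<^sup>+w. ennreal (f w (w n)) \<partial>expseq) \<le> (\<integral>\<^sup>+w. ennreal 16 * ennreal (log_gap (a n w (w n))) \<partial>expseq)"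
  proof (rule nn_integral_mono_AE, use AE_expseq_pos in eventually_elim)
    case (elim w)
    then have "f w (w n) \<le> 16 * log_gap (a n w (w n))" using f by auto
    then show ?case by (subst ennreal_mult'[symmetric]) (auto intro: ennreal_leI)
  qed
  also have "\<dots> = ennreal 16 * gap_entropy n" unfolding gap_entropy_eq by (rule nn_integral_cmult) measurable
  finally show ?thesis .
qed

lemma small_log_int: "(\<integral>\<^sup>+w. ennreal ((small_log n w (w n))\<^sup>2) \<partial>expseq) \<le> ennreal 16 * gap_entropy n"
  by (rule nn_integral_le_gap_entropy[of "\<lambda>w s. (small_log n w s)\<^sup>2"]) (auto simp: small_log_sq)

lemma large_log_int: "(\<integral>\<^sup>+w. ennreal \<bar>large_log n w (w n)\<bar> \<partial>expseq) \<le> ennreal 16 * gap_entropy n"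
  by (rule nn_integral_le_gap_entropy[of "\<lambda>w s. \<bar>large_log n w s\<bar>"]) (auto simp: large_log_le)

lemma large_log_comp: "(\<integral>\<^sup>+w. (\<integral>\<^sup>+s. ennreal \<bar>large_log n w s\<bar> * indicator {0<..w n} s \<partial>lborel) \<partial>expseq) \<le> ennreal 16 * gap_entropy n"
proof -
  have "adapted n (\<lambda>w s. ennreal \<bar>large_log n w s\<bar>)" using large_log_adapted[of n] unfolding adapted_def by metis
  then show ?thesis using large_log_int[of n] by (subst nn_integral_compensator[symmetric]) auto
qed

text \<open>Given the earlier gaps this is Hardy's inequality in gap \<open>n\<close>: the L2 norm
  of the compensator is bounded by that of the jump term. The constant is 4 times 16.\<close>

lemma small_log_Hardy: "(\<integral>\<^sup>+w. (\<integral>\<^sup>+s. ennreal \<bar>small_log n w s\<bar> * indicator {0<..w n} s \<partial>lborel)\<^sup>2 \<partial>expseq) \<le> ennreal 64 * gap_entropy n"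
proof -
  have ad: "small_log n (w(n := x)) = small_log n w" for w x using small_log_adapted[of n] by simp
  have "(\<integral>\<^sup>+w. (\<integral>\<^sup>+s. ennreal \<bar>small_log n w s\<bar> * indicator {0<..w n} s \<partial>lborel)\<^sup>2 \<partial>expseq) =
    (\<integral>\<^sup>+w. (\<integral>\<^sup>+x. (\<integral>\<^sup>+s. ennreal \<bar>small_log n w s\<bar> * indicator {0<..x} s \<partial>lborel)\<^sup>2 \<partial>exp_law) \<partial>expseq)"
    by (subst nn_integral_resample[of _ n]) (auto simp: ad)
  also have "\<dots> \<le> (\<integral>\<^sup>+w. 4 * (\<integral>\<^sup>+x. ennreal ((small_log n w x)\<^sup>2) \<partial>exp_law) \<partial>expseq)"
    by (intro nn_integral_mono nn_integral_exp_law_Hardy) measurable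
  also have "\<dots> = 4 * (\<integral>\<^sup>+w. (\<integral>\<^sup>+x. ennreal ((small_log n w x)\<^sup>2) \<partial>exp_law) \<partial>expseq)"
    by (rule nn_integral_cmult) measurable
  also have "(\<integral>\<^sup>+w. (\<integral>\<^sup>+x. ennreal ((small_log n w x)\<^sup>2) \<partial>exp_law) \<partial>expseq) = (\<integral>\<^sup>+w. ennreal ((small_log n w (w n))\<^sup>2) \<partial>expseq)"
    by (subst nn_integral_resample[of "\<lambda>w. ennreal ((small_log n w (w n))\<^sup>2)" n]) (auto simp: ad)
  also have "4 * \<dots> \<le> 4 * (ennreal 16 * gap_entropy n)" by (rule mult_left_mono[OF small_log_int]) simp
  also have "\<dots> = ennreal 64 * gap_entropy n" by (simp add: mult.assoc[symmetric] ennreal_mult[symmetric] flip: ennreal_numeral)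
  finally show ?thesis .
qed

text \<open>The logarithm of likelihood factor \<open>n\<close> splits as
  \<open>xi + kap - psi\<close>: compensated small logarithm, compensated large logarithm, and
  entropy along the gap.\<close>

definition xi :: "nat \<Rightarrow> (nat \<Rightarrow> real) \<Rightarrow> real" where
  "xi n w = small_log n w (w n) - (LINT s:{0<..w n}|lborel. small_log n w s)"

definition kap :: "nat \<Rightarrow> (nat \<Rightarrow> real) \<Rightarrow> real" where
  "kap n w = large_log n w (w n) - (LINT s:{0<..w n}|lborel. large_log n w s)"

definition psi :: "nat \<Rightarrow> (nat \<Rightarrow> real) \<Rightarrow> real" where
  "psi n w = (LINT s:{0<..w n}|lborel. log_gap (a n w s))"

lemma LINT_meas [measurable]:
  assumes [measurable]: "(\<lambda>(w, s). f w s) \<in> borel_measurable (seqS \<Otimes>\<^sub>M borel)"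
  shows "(\<lambda>w. LINT s:{0<..w n}|lborel. f w s :: real) \<in> borel_measurable seqS"
  unfolding set_lebesgue_integral_def by measurable

lemma xi_meas [measurable]: "xi n \<in> borel_measurable seqS"
  unfolding xi_def by measurable

lemma kap_meas [measurable]: "kap n \<in> borel_measurable seqS"
  unfolding kap_def by measurable

lemma psi_meas [measurable]: "psi n \<in> borel_measurable seqS"
  unfolding psi_def by measurable

text \<open>From \<open>(x - y)^2 <= 2 * x^2 + 2 * y^2\<close>, with 16 for the jump term and 64 for
  its compensator: \<open>160 = 2 * 16 + 2 * 64\<close>.\<close>

lemma xi_sq: "(\<integral>\<^sup>+w. ennreal ((xi n w)\<^sup>2) \<partial>expseq) \<le> ennreal 160 * gap_entropy n"
proof -
  have "(\<integral>\<^sup>+w. ennreal ((xi n w)\<^sup>2) \<partial>expseq) \<le>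
    (\<integral>\<^sup>+w. 2 * ennreal ((small_log n w (w n))\<^sup>2) + 2 * (\<integral>\<^sup>+s. ennreal \<bar>small_log n w s\<bar> * indicator {0<..w n} s \<partial>lborel)\<^sup>2 \<partial>expseq)"
  proof (rule nn_integral_mono)
    fix w
    let ?I = "LINT s:{0<..w n}|lborel. small_log n w s"
    have "(x - y)\<^sup>2 \<le> 2 * x\<^sup>2 + 2 * y\<^sup>2" for x y :: real
      using sum_squares_ge_zero[of "x + y" 0] by (simp add: power2_eq_square algebra_simps)
    then have "ennreal ((xi n w)\<^sup>2) \<le> ennreal (2 * (small_log n w (w n))\<^sup>2 + 2 * \<bar>?I\<bar>\<^sup>2)"
      unfolding xi_def power2_abs by (rule ennreal_leI)
    also have "\<dots> = 2 * ennreal ((small_log n w (w n))\<^sup>2) + 2 * (ennreal \<bar>?I\<bar>)\<^sup>2"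
      by (simp add: ennreal_plus ennreal_mult ennreal_power)
    also have "\<dots> \<le> 2 * ennreal ((small_log n w (w n))\<^sup>2) + 2 * (\<integral>\<^sup>+s. ennreal \<bar>small_log n w s\<bar> * indicator {0<..w n} s \<partial>lborel)\<^sup>2"
      by (intro add_left_mono mult_left_mono power_mono abs_LINT_Ioc_le) auto
    finally show "ennreal ((xi n w)\<^sup>2) \<le> 2 * ennreal ((small_log n w (w n))\<^sup>2) + 2 * (\<integral>\<^sup>+s. ennreal \<bar>small_log n w s\<bar> * indicator {0<..w n} s \<partial>lborel)\<^sup>2" .
  qed
  also have "\<dots> = 2 * (\<integral>\<^sup>+w. ennreal ((small_log n w (w n))\<^sup>2) \<partial>expseq) + 2 * (\<integral>\<^sup>+w. (\<integral>\<^sup>+s. ennreal \<bar>small_log n w s\<bar> * indicator {0<..w n} s \<partial>lborel)\<^sup>2 \<partial>expseq)"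
    by (subst nn_integral_add, measurable, subst (1 2) nn_integral_cmult) auto
  also have "\<dots> \<le> 2 * (ennreal 16 * gap_entropy n) + 2 * (ennreal 64 * gap_entropy n)"
    by (intro add_mono mult_left_mono small_log_int small_log_Hardy) auto
  also have "\<dots> = ennreal 160 * gap_entropy n"
    by (simp add: mult.assoc[symmetric] ennreal_mult[symmetric] distrib_right[symmetric] ennreal_plus[symmetric] del: ennreal_plus flip: ennreal_numeral)
  finally show ?thesis .
qed

lemma xi_sq_int: "integrable expseq (\<lambda>w. (xi n w)\<^sup>2)"
proof (rule integrableI_nonneg)
  show "(\<integral>\<^sup>+w. ennreal ((xi n w)\<^sup>2) \<partial>expseq) < \<infinity>"
    using gap_entropy_fin[of n] by (rule_tac order.strict_trans1[OF xi_sq]) (simp add: ennreal_mult_less_top)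
qed auto

text \<open>A function \<open>G\<close> of the first \<open>i\<close> gaps can be pulled into the
  integrand, which stays adapted; jump term and compensator then have equal means.\<close>

lemma mdiff_xi: "mdiff xi"
proof
  fix i
  show "adapted (Suc i) (xi i)"
    unfolding adapted_def
  proof (intro allI impI)
    fix w w' :: "nat \<Rightarrow> real" assume eq: "\<forall>j<Suc i. w j = w' j"
    have "small_log i w = small_log i w'" by (rule adaptedD[OF small_log_adapted]) (use eq in auto)
    then show "xi i w = xi i w'" using eq by (simp add: xi_def)
  qed
  fix G :: "(nat \<Rightarrow> real) \<Rightarrow> real"
  assume [measurable]: "G \<in> borel_measurable seqS" and G: "adapted i G" "integrable expseq (\<lambda>w. (G w)\<^sup>2)"
  have "integrable expseq (\<lambda>w. (small_log i w (w i))\<^sup>2)"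
    using gap_entropy_fin[of i] by (intro integrableI_nonneg) (auto intro!: order.strict_trans1[OF small_log_int] simp: ennreal_mult_less_top)
  then have i: "integrable expseq (\<lambda>w. G w * small_log i w (w i))"
    by (intro integrable_mult_squares) (use G in auto)
  have ad: "adapted i (\<lambda>w s. G w * small_log i w s)"
    using small_log_adapted[of i] G(1) unfolding adapted_def by metis
  have m: "(\<lambda>(w, s). G w * small_log i w s) \<in> borel_measurable (seqS \<Otimes>\<^sub>M borel)" by measurable
  note c = integral_compensator[OF m ad i]
  have e: "(LINT s:{0<..w i}|lborel. G w * small_log i w s) = G w * (LINT s:{0<..w i}|lborel. small_log i w s)" for w
    by (rule set_integral_mult_right)
  have "(LINT w|expseq. G w * xi i w) = (LINT w|expseq. G w * small_log i w (w i) - G w * (LINT s:{0<..w i}|lborel. small_log i w s))"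
    by (simp add: xi_def right_diff_distrib)
  also have "\<dots> = 0" using c i unfolding e by (subst Bochner_Integration.integral_diff) auto
  finally show "(LINT w|expseq. G w * xi i w) = 0" .
next
  show "summable (\<lambda>i. LINT w|expseq. (xi i w)\<^sup>2)"
  proof (rule summable_suminf_not_top)
    have "(\<Sum>i. ennreal (LINT w|expseq. (xi i w)\<^sup>2)) \<le> (\<Sum>i. ennreal 160 * gap_entropy i)"
    proof (rule suminf_le)
      fix i
      show "ennreal (LINT w|expseq. (xi i w)\<^sup>2) \<le> ennreal 160 * gap_entropy i"
        using xi_sq[of i] xi_sq_int[of i] by (subst nn_integral_eq_integral[symmetric]) auto
    qed auto
    then show "(\<Sum>i. ennreal (LINT w|expseq. (xi i w)\<^sup>2)) \<noteq> \<top>"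
      using suminf_gap_entropy_cmult[of 160] by (auto simp: top_unique)
  qed auto
qed (auto simp: xi_sq_int)

text \<open>Large logarithms are dominated by the entropy itself, so their jump terms and
  compensators are absolutely summable in mean, each with constant 16.\<close>

lemma kap_series: "(\<Sum>n. \<integral>\<^sup>+w. ennreal \<bar>kap n w\<bar> \<partial>expseq) < \<infinity>"
proof -
  have "(\<integral>\<^sup>+w. ennreal \<bar>kap n w\<bar> \<partial>expseq) \<le> ennreal 32 * gap_entropy n" for n
  proof -
    have "(\<integral>\<^sup>+w. ennreal \<bar>kap n w\<bar> \<partial>expseq) \<le>
      (\<integral>\<^sup>+w. ennreal \<bar>large_log n w (w n)\<bar> + (\<integral>\<^sup>+s. ennreal \<bar>large_log n w s\<bar> * indicator {0<..w n} s \<partial>lborel) \<partial>expseq)"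
    proof (rule nn_integral_mono)
      fix w
      have "ennreal \<bar>kap n w\<bar> \<le> ennreal (\<bar>large_log n w (w n)\<bar> + \<bar>LINT s:{0<..w n}|lborel. large_log n w s\<bar>)"
        unfolding kap_def by (intro ennreal_leI) linarith
      also have "\<dots> = ennreal \<bar>large_log n w (w n)\<bar> + ennreal \<bar>LINT s:{0<..w n}|lborel. large_log n w s\<bar>" by simp
      also have "\<dots> \<le> ennreal \<bar>large_log n w (w n)\<bar> + (\<integral>\<^sup>+s. ennreal \<bar>large_log n w s\<bar> * indicator {0<..w n} s \<partial>lborel)"
        by (intro add_left_mono abs_LINT_Ioc_le)
      finally show "ennreal \<bar>kap n w\<bar> \<le> ennreal \<bar>large_log n w (w n)\<bar> + (\<integral>\<^sup>+s. ennreal \<bar>large_log n w s\<bar> * indicator {0<..w n} s \<partial>lborel)" .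
    qed
    also have "\<dots> = (\<integral>\<^sup>+w. ennreal \<bar>large_log n w (w n)\<bar> \<partial>expseq) + (\<integral>\<^sup>+w. (\<integral>\<^sup>+s. ennreal \<bar>large_log n w s\<bar> * indicator {0<..w n} s \<partial>lborel) \<partial>expseq)"
      by (rule nn_integral_add) measurable
    also have "\<dots> \<le> ennreal 16 * gap_entropy n + ennreal 16 * gap_entropy n" by (intro add_mono large_log_int large_log_comp)
    also have "\<dots> = ennreal 32 * gap_entropy n"
      by (simp add: distrib_right[symmetric] ennreal_plus[symmetric] del: ennreal_plus flip: ennreal_numeral)
    finally show ?thesis .
  qed
  then have "(\<Sum>n. \<integral>\<^sup>+w. ennreal \<bar>kap n w\<bar> \<partial>expseq) \<le> (\<Sum>n. ennreal 32 * gap_entropy n)"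
    by (intro suminf_le) auto
  then show ?thesis using suminf_gap_entropy_cmult[of 32] by (rule order.strict_trans1)
qed

lemma large_log_integrable: "integrable expseq (\<lambda>w. large_log n w (w n))"
  using gap_entropy_fin[of n] by (subst integrable_iff_bounded) (auto intro!: order.strict_trans1[OF large_log_int] simp: ennreal_mult_less_top)

lemma small_log_integrable: "integrable expseq (\<lambda>w. small_log n w (w n))"
  by (rule expseq.integrable_const_bound[of _ 1]) (auto simp: small_log_bound)

lemma kap_mean: "(LINT w|expseq. kap n w) = 0"
  using integral_compensator[OF large_log_meas large_log_adapted large_log_integrable, of n] large_log_integrable[of n]
  by (simp add: kap_def)

lemma log_gap_meas2: "(\<lambda>(w, s). log_gap (a n w s)) \<in> borel_measurable (seqS \<Otimes>\<^sub>M borel)"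
  by measurable

lemma log_gap_integrable: "integrable expseq (\<lambda>w. log_gap (a n w (w n)))"
proof (rule integrableI_nonneg)
  show "(\<integral>\<^sup>+w. ennreal (log_gap (a n w (w n))) \<partial>expseq) < \<infinity>" using gap_entropy_fin[of n] by (simp add: gap_entropy_eq)
  show "AE w in expseq. 0 \<le> log_gap (a n w (w n))"
    using AE_expseq_pos by eventually_elim (auto intro!: log_gap_nonneg a_pos)
qed auto

lemma psi_nonneg: "0 \<le> psi n w"
  unfolding psi_def set_lebesgue_integral_def
  by (rule Bochner_Integration.integral_nonneg) (auto simp: indicator_def intro!: log_gap_nonneg a_pos)

lemma psi_nn: "(\<integral>\<^sup>+w. ennreal \<bar>psi n w\<bar> \<partial>expseq) = gap_entropy n" "(LINT w|expseq. psi n w) = enn2real (gap_entropy n)"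
proof -
  note c = integral_compensator[OF log_gap_meas2 adapted_comp log_gap_integrable, of n]
  have "(LINT w|expseq. psi n w) = (LINT w|expseq. log_gap (a n w (w n)))" using c(2) by (simp add: psi_def)
  also have "\<dots> = enn2real (gap_entropy n)"
    unfolding gap_entropy_eq using AE_expseq_pos
    by (intro integral_eq_nn_integral) (auto elim!: eventually_mono intro!: log_gap_nonneg a_pos)
  finally show i: "(LINT w|expseq. psi n w) = enn2real (gap_entropy n)" .
  have "(\<integral>\<^sup>+w. ennreal \<bar>psi n w\<bar> \<partial>expseq) = ennreal (LINT w|expseq. psi n w)"
    using c(1) psi_nonneg by (subst nn_integral_eq_integral[symmetric]) (auto simp: psi_def[abs_def])
  then show "(\<integral>\<^sup>+w. ennreal \<bar>psi n w\<bar> \<partial>expseq) = gap_entropy n" using i gap_entropy_fin[of n] by simp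
qed

lemma psi_series: "(\<Sum>n. \<integral>\<^sup>+w. ennreal \<bar>psi n w\<bar> \<partial>expseq) < \<infinity>"
  using suminf_gap_entropy_fin by (simp add: psi_nn)

text \<open>Pointwise \<open>1 - a = - log_gap a - ln a\<close>. Integrated over the gap, this turns
  \<open>w n - new_gaps w n\<close> into minus the entropy minus the compensators of small and large
  logarithms.\<close>

lemma AE_log_step: "AE w in expseq. \<forall>n. ln (a n w (w n)) + (w n - new_gaps w n) = xi n w + kap n w - psi n w"
  unfolding AE_all_countable
proof
  fix n
  have "AE w in expseq. set_integrable lborel {0<..w n} (small_log n w)"
    by (rule integral_compensator(3)[OF small_log_meas small_log_adapted small_log_integrable])
  moreover have "AE w in expseq. set_integrable lborel {0<..w n} (large_log n w)"
    by (rule integral_compensator(3)[OF large_log_meas large_log_adapted large_log_integrable])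
  moreover have "AE w in expseq. set_integrable lborel {0<..w n} (\<lambda>s. log_gap (a n w s))"
    by (rule integral_compensator(3)[OF log_gap_meas2 adapted_comp log_gap_integrable])
  ultimately show "AE w in expseq. ln (a n w (w n)) + (w n - new_gaps w n) = xi n w + kap n w - psi n w"
    using AE_rate AE_expseq_pos
  proof eventually_elim
    case (elim w)
    interpret rate "a n w" using elim by auto
    have w: "0 < w n" using elim by auto
    have one: "set_integrable lborel {0<..w n} (\<lambda>s. 1 :: real)"
      using w by (simp add: set_integrable_def integrable_indicator_iff)
    have "w n - new_gaps w n = (LINT s:{0<..w n}|lborel. 1) - (LINT s:{0<..w n}|lborel. a n w s)"
      unfolding new_gaps_def cumint_eq_LINT using w by (simp add: set_lebesgue_integral_def)
    also have "\<dots> = (LINT s:{0<..w n}|lborel. 1 - a n w s)"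
      by (rule set_integral_diff(2)[symmetric, OF one set_integrable_rate])
    also have "\<dots> = (LINT s:{0<..w n}|lborel. - log_gap (a n w s) - (small_log n w s + large_log n w s))"
      by (simp add: small_log_large_log log_gap_def)
    also have "\<dots> = (LINT s:{0<..w n}|lborel. - log_gap (a n w s)) - (LINT s:{0<..w n}|lborel. small_log n w s + large_log n w s)"
      using elim by (intro set_integral_diff(2) set_integral_add(1)) (auto simp: set_integrable_def)
    also have "(LINT s:{0<..w n}|lborel. small_log n w s + large_log n w s) = (LINT s:{0<..w n}|lborel. small_log n w s) + (LINT s:{0<..w n}|lborel. large_log n w s)"
      using elim by (intro set_integral_add(2))
    also have "(LINT s:{0<..w n}|lborel. - log_gap (a n w s)) = - psi n w"
      unfolding psi_def set_lebesgue_integral_def by (simp del: integral_minus add: integral_minus[symmetric])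
    finally show ?case
      unfolding xi_def kap_def small_log_large_log[symmetric] by linarith
  qed
qed

lemma ln_lik: "(\<And>i. 0 < w i) \<Longrightarrow> ln (lik n w) = (\<Sum>i<n. ln (a i w (w i)) + (w i - new_gaps w i))"
proof -
  assume w: "\<And>i. 0 < w i"
  have p: "0 < a i w (w i)" for i by (rule a_pos[OF w])
  have nz: "a i w (w i) \<noteq> 0" for i using p[of i] by simp
  have "ln (lik n w) = (\<Sum>i<n. ln (a i w (w i) * exp (w i - new_gaps w i)))"
    unfolding lik_def using p by (intro ln_prod) (auto simp: nz)
  also have "\<dots> = (\<Sum>i<n. ln (a i w (w i)) + (w i - new_gaps w i))"
    using p by (intro sum.cong) (auto simp: ln_mult nz)
  finally show ?thesis .
qed

section \<open>Limit and mean of the log-likelihood\<close>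

definition logLam :: "(nat \<Rightarrow> real) \<Rightarrow> real" where
  "logLam w = lim (\<lambda>m. \<Sum>i<m. xi i w) + (\<Sum>n. kap n w) - (\<Sum>n. psi n w)"

lemma logLam_meas [measurable]: "logLam \<in> borel_measurable seqS"
  unfolding logLam_def by measurable

lemma ln_lik_tendsto: "AE w in expseq. (\<lambda>n. ln (lik n w)) \<longlonglongrightarrow> logLam w"
  using AE_log_step AE_expseq_pos mdiff.AE_convergent[OF mdiff_xi]
    integral_series(1)[OF kap_meas[folded measurable_expseq] kap_series]
    integral_series(1)[OF psi_meas[folded measurable_expseq] psi_series]
proof eventually_elim
  case (elim w)
  have "(\<lambda>n. (\<Sum>i<n. xi i w) + (\<Sum>i<n. kap i w) - (\<Sum>i<n. psi i w)) \<longlonglongrightarrow> logLam w"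
    unfolding logLam_def using elim
    by (intro tendsto_add tendsto_diff summable_LIMSEQ) (auto simp: convergent_LIMSEQ_iff)
  moreover have "ln (lik n w) = (\<Sum>i<n. xi i w) + (\<Sum>i<n. kap i w) - (\<Sum>i<n. psi i w)" for n
    using elim by (subst ln_lik) (auto simp: sum.distrib sum_subtractf)
  ultimately show ?case by simp
qed

lemma lik_tendsto: "AE w in expseq. (\<lambda>n. lik n w) \<longlonglongrightarrow> exp (logLam w)"
  using ln_lik_tendsto AE_expseq_pos
proof eventually_elim
  case (elim w)
  then have "(\<lambda>n. exp (ln (lik n w))) \<longlonglongrightarrow> exp (logLam w)" by (intro tendsto_exp) auto
  moreover have "exp (ln (lik n w)) = lik n w" for n using elim lik_pos[of n w] by simp
  ultimately show ?case by simp
qed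

text \<open>The martingale limit and the compensated large logarithms have mean 0, so only the
  entropy series contributes.\<close>

lemma logLam_integrable: "integrable expseq logLam"
  and logLam_mean: "(LINT w|expseq. logLam w) = - enn2real (\<Sum>n. gap_entropy n)"
proof -
  note k = integral_series[OF kap_meas[folded measurable_expseq] kap_series]
  note p = integral_series[OF psi_meas[folded measurable_expseq] psi_series]
  note x = mdiff.limit_integrable[OF mdiff_xi]
  show "integrable expseq logLam" unfolding logLam_def using k(2) p(2) x(1) by auto
  have "(LINT w|expseq. logLam w) = (\<Sum>n. (LINT w|expseq. kap n w)) - (\<Sum>n. (LINT w|expseq. psi n w))"
    unfolding logLam_def using k(2,4) p(2,4) x by simp
  also have "\<dots> = - (\<Sum>n. enn2real (gap_entropy n))" by (simp add: kap_mean psi_nn)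
  also have "(\<Sum>n. enn2real (gap_entropy n)) = enn2real (\<Sum>n. gap_entropy n)"
  proof -
    have e: "ennreal (enn2real (gap_entropy n)) = gap_entropy n" for n using gap_entropy_fin[of n] by simp
    have "summable (\<lambda>n. enn2real (gap_entropy n))"
      using suminf_gap_entropy_fin by (intro summable_suminf_not_top) (auto simp: e)
    then have "(\<Sum>n. ennreal (enn2real (gap_entropy n))) = ennreal (\<Sum>n. enn2real (gap_entropy n))"
      by (intro suminf_ennreal2) auto
    then show ?thesis using \<open>summable _\<close> by (simp add: e suminf_nonneg)
  qed
  finally show "(LINT w|expseq. logLam w) = - enn2real (\<Sum>n. gap_entropy n)" .
qed

text \<open>Bounds the drift of the log-likelihood inside one gap, which is needed to pass from jump
  times to continuous time. \<open>|1 - a|\<close> is at most the entropy plus the small and large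
  logarithms. Their integrals over gap \<open>n\<close> are terms of convergent series, for the
  small logarithms only after squaring, and so tend to 0.\<close>

lemma gap_integral_tendsto_0:
  "AE w in expseq. (\<lambda>n. \<integral>\<^sup>+s. ennreal \<bar>1 - a n w s\<bar> * indicator {0<..w n} s \<partial>lborel) \<longlonglongrightarrow> 0"
proof -
  define P where "P n w = (\<integral>\<^sup>+s. ennreal (log_gap (a n w s)) * indicator {0<..w n} s \<partial>lborel)" for n w
  define Q where "Q n w = (\<integral>\<^sup>+s. ennreal \<bar>large_log n w s\<bar> * indicator {0<..w n} s \<partial>lborel)" for n w
  define R where "R n w = (\<integral>\<^sup>+s. ennreal \<bar>small_log n w s\<bar> * indicator {0<..w n} s \<partial>lborel)" for n w
  have [measurable]: "P n \<in> borel_measurable seqS" "Q n \<in> borel_measurable seqS" "R n \<in> borel_measurable seqS" for n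
    unfolding P_def Q_def R_def by measurable
  have "AE w in expseq. (\<Sum>n. P n w) \<noteq> \<infinity>"
    by (rule AE_suminf_finite) (use suminf_gap_entropy_fin in \<open>auto simp: P_def gap_entropy_def\<close>)
  moreover have "AE w in expseq. (\<Sum>n. Q n w) \<noteq> \<infinity>"
  proof (rule AE_suminf_finite)
    have "(\<Sum>n. \<integral>\<^sup>+w. Q n w \<partial>expseq) \<le> (\<Sum>n. ennreal 16 * gap_entropy n)"
      unfolding Q_def by (intro suminf_le large_log_comp) auto
    then show "(\<Sum>n. \<integral>\<^sup>+w. Q n w \<partial>expseq) < \<infinity>" using suminf_gap_entropy_cmult[of 16] by (rule order.strict_trans1)
  qed auto
  moreover have "AE w in expseq. (\<Sum>n. (R n w)\<^sup>2) \<noteq> \<infinity>"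
  proof (rule AE_suminf_finite)
    have "(\<Sum>n. \<integral>\<^sup>+w. (R n w)\<^sup>2 \<partial>expseq) \<le> (\<Sum>n. ennreal 64 * gap_entropy n)"
      unfolding R_def by (intro suminf_le small_log_Hardy) auto
    then show "(\<Sum>n. \<integral>\<^sup>+w. (R n w)\<^sup>2 \<partial>expseq) < \<infinity>" using suminf_gap_entropy_cmult[of 64] by (rule order.strict_trans1)
  qed auto
  ultimately show ?thesis
  proof eventually_elim
    case (elim w)
    note P = suminf_finite_tendsto_0[OF elim(1)] and Q = suminf_finite_tendsto_0[OF elim(2)] and R = suminf_finite_tendsto_0[OF elim(3)]
    have Rf: "R n w \<noteq> \<infinity>" for n
    proof
      assume "R n w = \<infinity>"
      then have "(R n w)\<^sup>2 = \<infinity>" by (simp add: power2_eq_square)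
      then show False using R(2)[of n] by simp
    qed
    have "enn2real ((R n w)\<^sup>2) = (enn2real (R n w))\<^sup>2" for n
      by (simp add: power2_eq_square enn2real_mult)
    then have "(\<lambda>n. (enn2real (R n w))\<^sup>2) \<longlonglongrightarrow> 0" using R(1) by simp
    then have "(\<lambda>n. sqrt ((enn2real (R n w))\<^sup>2)) \<longlonglongrightarrow> sqrt 0" by (rule tendsto_real_sqrt)
    then have "(\<lambda>n. enn2real (R n w)) \<longlonglongrightarrow> 0" by simp
    then have "(\<lambda>n. ennreal (enn2real (P n w) + (enn2real (R n w) + enn2real (Q n w)))) \<longlonglongrightarrow> ennreal (0 + (0 + 0))"
      by (intro tendsto_ennrealI tendsto_add P Q)
    moreover have "ennreal (enn2real (P n w) + (enn2real (R n w) + enn2real (Q n w))) = P n w + (R n w + Q n w)" for n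
      using P(2)[of n] Q(2)[of n] Rf[of n] by (simp add: ennreal_plus less_top)
    ultimately have lim: "(\<lambda>n. P n w + (R n w + Q n w)) \<longlonglongrightarrow> 0" by simp
    have le: "(\<integral>\<^sup>+s. ennreal \<bar>1 - a n w s\<bar> * indicator {0<..w n} s \<partial>lborel) \<le> P n w + (R n w + Q n w)" for n
    proof -
      have [measurable]: "large_log n w \<in> borel_measurable borel" using measurable_Pair2[OF large_log_meas[of n], of w] by simp
      have "(\<integral>\<^sup>+s. ennreal \<bar>1 - a n w s\<bar> * indicator {0<..w n} s \<partial>lborel) \<le>
        (\<integral>\<^sup>+s. ennreal (log_gap (a n w s)) * indicator {0<..w n} s + (ennreal \<bar>small_log n w s\<bar> * indicator {0<..w n} s + ennreal \<bar>large_log n w s\<bar> * indicator {0<..w n} s) \<partial>lborel)"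
      proof (rule nn_integral_mono)
        fix s
        show "ennreal \<bar>1 - a n w s\<bar> * indicator {0<..w n} s \<le>
          ennreal (log_gap (a n w s)) * indicator {0<..w n} s + (ennreal \<bar>small_log n w s\<bar> * indicator {0<..w n} s + ennreal \<bar>large_log n w s\<bar> * indicator {0<..w n} s)"
        proof (cases "0 < s \<and> s \<le> w n")
          case True
          then have nn: "0 \<le> log_gap (a n w s)" by (intro log_gap_nonneg a_pos) auto
          have "1 - a n w s = - log_gap (a n w s) - (small_log n w s + large_log n w s)" by (simp add: small_log_large_log log_gap_def)
          then have "\<bar>1 - a n w s\<bar> \<le> log_gap (a n w s) + (\<bar>small_log n w s\<bar> + \<bar>large_log n w s\<bar>)" using nn by linarith
          then have "ennreal \<bar>1 - a n w s\<bar> \<le> ennreal (log_gap (a n w s)) + (ennreal \<bar>small_log n w s\<bar> + ennreal \<bar>large_log n w s\<bar>)"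
            using nn by (simp add: ennreal_plus[symmetric] ennreal_leI del: ennreal_plus)
          then show ?thesis using True by simp
        qed auto
      qed
      also have "\<dots> = P n w + (R n w + Q n w)"
        unfolding P_def Q_def R_def by (subst nn_integral_add, measurable, subst nn_integral_add) auto
      finally show ?thesis .
    qed
    show ?case
      by (rule tendsto_sandwich[OF _ _ tendsto_const lim]) (use le in auto)
  qed
qed

end

section \<open>The path space\<close>

lemma paths_nonpos: "N \<in> paths \<Longrightarrow> t \<le> 0 \<Longrightarrow> N t = 0"
  by (auto simp: paths_def)

lemma paths_mono: "N \<in> paths \<Longrightarrow> s \<le> t \<Longrightarrow> N s \<le> N t"
  by (auto simp: paths_def dest: monoD)

lemma paths_right: "N \<in> paths \<Longrightarrow> \<exists>e>0. \<forall>s. t \<le> s \<and> s < t + e \<longrightarrow> N s = N t"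
  by (auto simp: paths_def)

lemma paths_jump: "N \<in> paths \<Longrightarrow> \<exists>e>0. \<forall>s. t - e < s \<and> s < t \<longrightarrow> N t \<le> N s + 1"
  by (auto simp: paths_def)

lemma space_Ninf [simp]: "space Ninf = paths"
  by (simp add: Ninf_def space_measure_of_conv)

lemma space_Nsig [simp]: "space (Nsig t) = paths"
  by (simp add: Nsig_def space_measure_of_conv)

lemma sets_Ninf: "sets Ninf = sigma_sets paths {{N \<in> paths. N s = k} | s k. True}"
  unfolding Ninf_def by (rule sets_measure_of) auto

lemma sets_Nsig: "sets (Nsig t) = sigma_sets paths {{N \<in> paths. N s = k} | s k. s \<le> t}"
  unfolding Nsig_def by (rule sets_measure_of) auto

lemma Nsig_mono: "s \<le> t \<Longrightarrow> sets (Nsig s) \<subseteq> sets (Nsig t)"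
  unfolding sets_Nsig by (rule sigma_sets_mono') fastforce

lemma Nsig_Ninf: "sets (Nsig s) \<subseteq> sets Ninf"
  unfolding sets_Nsig sets_Ninf by (rule sigma_sets_mono') fastforce

lemma measurable_eval_Nsig: "s \<le> t \<Longrightarrow> (\<lambda>N. N s) \<in> measurable (Nsig t) (count_space UNIV)"
proof (rule measurableI)
  fix A :: "nat set" assume "s \<le> t"
  then have "{N \<in> paths. N s = k} \<in> sets (Nsig t)" for k
    unfolding sets_Nsig by (intro sigma_sets.Basic) auto
  then have "(\<Union>k\<in>A. {N \<in> paths. N s = k}) \<in> sets (Nsig t)" by (intro sets.countable_UN') auto
  moreover have "(\<lambda>N. N s) -` A \<inter> space (Nsig t) = (\<Union>k\<in>A. {N \<in> paths. N s = k})" by auto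
  ultimately show "(\<lambda>N. N s) -` A \<inter> space (Nsig t) \<in> sets (Nsig t)" by simp
qed simp

lemma measurable_eval [measurable]: "(\<lambda>N. N s) \<in> measurable Ninf (count_space UNIV)"
proof (rule measurableI)
  fix A :: "nat set"
  have "(\<lambda>N. N s) -` A \<inter> space (Nsig s) \<in> sets (Nsig s)"
    using measurable_eval_Nsig[of s s] by (intro measurable_sets[of _ _ "count_space UNIV"]) auto
  then show "(\<lambda>N. N s) -` A \<inter> space Ninf \<in> sets Ninf" using Nsig_Ninf by auto
qed simp

lemma measurable_NinfI:
  assumes "\<And>x. x \<in> space M \<Longrightarrow> f x \<in> paths" "\<And>s k. {x \<in> space M. f x s = k} \<in> sets M"
  shows "f \<in> measurable M Ninf"
  unfolding Ninf_def
proof (rule measurable_measure_of)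
  fix Y assume "Y \<in> {{N \<in> paths. N s = k} |s k. True}"
  then obtain s k where "Y = {N \<in> paths. N s = k}" by auto
  then have "f -` Y \<inter> space M = {x \<in> space M. f x s = k}" using assms(1) by auto
  then show "f -` Y \<inter> space M \<in> sets M" using assms(2) by simp
qed (use assms(1) in auto)

lemma Nsig_agree:
  assumes "A \<in> sets (Nsig s)" "N \<in> paths" "N' \<in> paths" "\<And>u. u \<le> s \<Longrightarrow> N u = N' u"
  shows "N \<in> A \<longleftrightarrow> N' \<in> A"
  using assms(1) unfolding sets_Nsig
proof (induction rule: sigma_sets.induct)
  case (Basic a)
  then show ?case using assms by auto
qed (use assms in auto)

lemma Nsig_subset: "A \<in> sets (Nsig s) \<Longrightarrow> A \<subseteq> paths"
  using sets.sets_into_space[of A "Nsig s"] by simp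

lemma space_predictable: "space predictable = {0<..} \<times> paths"
  by (simp add: predictable_def space_measure_of_conv)

lemma sets_predictable: "sets predictable = sigma_sets ({0<..} \<times> paths)
     {{s<..t} \<times> A | s t A. 0 \<le> s \<and> s \<le> t \<and> A \<in> sets (Nsig s)}"
  unfolding predictable_def
  by (rule sets_measure_of) (auto dest: Nsig_subset[THEN subsetD])

text \<open>On a generator \<open>{a<..b} \<times> A\<close> the event \<open>A\<close> belongs to
  time \<open>a\<close>, and the half-open interval forces \<open>a < s\<close>; so only the strict
  past of \<open>s\<close> matters.\<close>

lemma predictable_set_agree:
  assumes "B \<in> sets predictable" "0 < s" "N \<in> paths" "N' \<in> paths" "\<And>u. u < s \<Longrightarrow> N u = N' u"
  shows "(s, N) \<in> B \<longleftrightarrow> (s, N') \<in> B"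
  using assms(1) unfolding sets_predictable
proof (induction rule: sigma_sets.induct)
  case (Basic B)
  then obtain a b A where B: "B = {a<..b} \<times> A" "A \<in> sets (Nsig a)" by auto
  show ?case
  proof (cases "a < s")
    case True
    then have "N \<in> A \<longleftrightarrow> N' \<in> A" using assms by (intro Nsig_agree[OF B(2)]) auto
    then show ?thesis by (simp add: B(1))
  qed (simp add: B(1))
qed (use assms in auto)

text \<open>The level set of \<open>H\<close> through \<open>(s, N)\<close> is itself a predictable
  set, to which the statement about sets applies.\<close>

lemma predictable_agree:
  fixes H :: "real \<times> cpath \<Rightarrow> real"
  assumes H: "H \<in> borel_measurable predictable" and s: "0 < s" "N \<in> paths" "N' \<in> paths" "\<And>u. u < s \<Longrightarrow> N u = N' u"
  shows "H (s, N) = H (s, N')"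
proof -
  let ?B = "H -` {H (s, N)} \<inter> space predictable"
  have "?B \<in> sets predictable" by (rule measurable_sets[OF H]) simp
  from predictable_set_agree[OF this s] show ?thesis using s by (auto simp: space_predictable)
qed

lemma sets_predictable_subset: "sets predictable \<subseteq> sets (borel \<Otimes>\<^sub>M Ninf)"
proof
  fix B assume "B \<in> sets predictable"
  then show "B \<in> sets (borel \<Otimes>\<^sub>M Ninf)" unfolding sets_predictable
  proof (induction rule: sigma_sets.induct)
    case (Basic B)
    then obtain a b A where B: "B = {a<..b} \<times> A" "A \<in> sets (Nsig a)" by auto
    then have "A \<in> sets Ninf" using Nsig_Ninf by auto
    then show ?case unfolding B by (intro pair_measureI) auto
  next
    case (Compl B)
    have "{0::real<..} \<times> paths \<in> sets (borel \<Otimes>\<^sub>M Ninf)" using sets.top[of Ninf] by (intro pair_measureI) auto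
    then show ?case using Compl by auto
  qed auto
qed

text \<open>Predictable sets live on positive times. A constant on the remaining times gives a
  function on the whole product space, where Fubini and composition are available.\<close>

lemma predictable_extend:
  fixes H :: "real \<times> cpath \<Rightarrow> real"
  assumes H: "H \<in> borel_measurable predictable"
  shows "(\<lambda>p. if 0 < fst p then H p else c) \<in> borel_measurable (borel \<Otimes>\<^sub>M Ninf)"
proof (rule measurableI)
  fix A :: "real set" assume A: "A \<in> sets borel"
  have "H -` A \<inter> space predictable \<in> sets (borel \<Otimes>\<^sub>M Ninf)"
    using measurable_sets[OF H A] sets_predictable_subset by auto
  moreover have "{..0::real} \<times> paths \<in> sets (borel \<Otimes>\<^sub>M Ninf)" using sets.top[of Ninf] by (intro pair_measureI) auto
  moreover have "(\<lambda>p. if 0 < fst p then H p else c) -` A \<inter> space (borel \<Otimes>\<^sub>M Ninf) =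
    (H -` A \<inter> space predictable) \<union> (if c \<in> A then {..0} \<times> paths else {})"
    by (auto simp: space_pair_measure space_predictable not_less split: if_splits)
  ultimately show "(\<lambda>p. if 0 < fst p then H p else c) -` A \<inter> space (borel \<Otimes>\<^sub>M Ninf) \<in> sets (borel \<Otimes>\<^sub>M Ninf)" by simp
qed simp

section \<open>Paths from inter-arrival times\<close>

definition arr :: "nat \<Rightarrow> (nat \<Rightarrow> real) \<Rightarrow> real" where
  "arr n w = sum w {..<n}"

text \<open>Positive gaps and no accumulation of jumps; natural thresholds keep the condition
  countable.\<close>

definition regular :: "(nat \<Rightarrow> real) \<Rightarrow> bool" where
  "regular w \<longleftrightarrow> (\<forall>i. 0 < w i) \<and> (\<forall>m::nat. \<exists>n. real m \<le> arr n w)"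

text \<open>Irregular sequences are sent to the empty configuration, so that the map is total with
  values in \<open>paths\<close>.\<close>

definition path_of :: "(nat \<Rightarrow> real) \<Rightarrow> cpath" where
  "path_of w t = (if regular w then LEAST k. t < arr (Suc k) w else 0)"

lemma arr_0 [simp]: "arr 0 w = 0" and arr_Suc: "arr (Suc n) w = arr n w + w n"
  by (auto simp: arr_def)

lemma arr_meas [measurable]: "arr n \<in> borel_measurable seqS"
  unfolding arr_def by measurable

lemma regular_meas [measurable]: "Measurable.pred seqS regular"
  unfolding regular_def by measurable

lemma regular_pos: "regular w \<Longrightarrow> 0 < w i" by (simp add: regular_def)

lemma arr_strict_mono: "regular w \<Longrightarrow> m < n \<Longrightarrow> arr m w < arr n w"
  by (rule lift_Suc_mono_less[of "\<lambda>n. arr n w"]) (auto simp: arr_Suc regular_pos)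

lemma arr_mono: "regular w \<Longrightarrow> m \<le> n \<Longrightarrow> arr m w \<le> arr n w"
  using arr_strict_mono[of w m n] by (cases "m = n") auto

lemma arr_pos: "regular w \<Longrightarrow> 0 < n \<Longrightarrow> 0 < arr n w"
  using arr_strict_mono[of w 0 n] by simp

lemma arr_nonneg: "regular w \<Longrightarrow> 0 \<le> arr n w"
  using arr_mono[of w 0 n] by simp

lemma regular_exceeds: "regular w \<Longrightarrow> \<exists>k. t < arr (Suc k) w"
proof -
  assume w: "regular w"
  obtain m :: nat where "t < real m" using reals_Archimedean2 by blast
  moreover obtain n where "real m \<le> arr n w" using w by (auto simp: regular_def)
  ultimately show ?thesis using arr_mono[OF w, of n "Suc n"] by (intro exI[of _ n]) auto
qed

lemma le_path_of_iff: "regular w \<Longrightarrow> 0 < n \<Longrightarrow> n \<le> path_of w t \<longleftrightarrow> arr n w \<le> t"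
proof -
  assume w: "regular w" and n: "0 < n"
  let ?k = "LEAST k. t < arr (Suc k) w"
  obtain k where "t < arr (Suc k) w" using regular_exceeds[OF w] by blast
  then have k: "t < arr (Suc ?k) w" by (rule LeastI)
  show ?thesis
  proof
    assume "n \<le> path_of w t"
    then have "n - 1 < ?k" using n w by (simp add: path_of_def)
    from not_less_Least[OF this] show "arr n w \<le> t" using n by simp
  next
    assume "arr n w \<le> t"
    then have "arr n w < arr (Suc ?k) w" using k by simp
    then have "n < Suc ?k" using arr_mono[OF w, of "Suc ?k" n] by (meson not_less)
    then show "n \<le> path_of w t" using w by (simp add: path_of_def)
  qed
qed

lemma path_of_less_arr: "regular w \<Longrightarrow> t < arr (Suc (path_of w t)) w"
  using le_path_of_iff[of w "Suc (path_of w t)" t] by auto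

lemma arr_path_of_le: "regular w \<Longrightarrow> 0 \<le> t \<Longrightarrow> arr (path_of w t) w \<le> t"
  using le_path_of_iff[of w "path_of w t" t] by (cases "path_of w t = 0") auto

text \<open>For \<open>k = 0\<close> the lower bound is dropped, since the count is 0 at negative
  times although these lie before \<open>arr 0 w = 0\<close>.\<close>

lemma path_of_eq_iff: "path_of w t = k \<longleftrightarrow> (if regular w then (k = 0 \<or> arr k w \<le> t) \<and> t < arr (Suc k) w else k = 0)"
proof (cases "regular w")
  case True
  have 1: "k \<le> path_of w t \<longleftrightarrow> k = 0 \<or> arr k w \<le> t"
    using le_path_of_iff[OF True, of k t] by (cases "k = 0") simp_all
  have 2: "Suc k \<le> path_of w t \<longleftrightarrow> arr (Suc k) w \<le> t" by (rule le_path_of_iff[OF True]) simp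
  have "path_of w t = k \<longleftrightarrow> k \<le> path_of w t \<and> \<not> Suc k \<le> path_of w t" by linarith
  then show ?thesis unfolding 1 2 using True by (simp add: not_le)
qed (auto simp: path_of_def)

lemma path_of_in_paths [simp]: "path_of w \<in> paths"
proof (cases "regular w")
  case True
  have mono: "path_of w s \<le> path_of w t" if "s \<le> t" for s t
    using le_path_of_iff[OF True, of "path_of w s" s] le_path_of_iff[OF True, of "path_of w s" t] that
    by (cases "path_of w s = 0") auto
  have zero: "path_of w t = 0" if "t \<le> 0" for t
    using le_path_of_iff[OF True, of 1 t] arr_pos[OF True, of 1] that by (cases "path_of w t = 0") auto
  have right: "\<exists>e>0. \<forall>s. t \<le> s \<and> s < t + e \<longrightarrow> path_of w s = path_of w t" for t
  proof (intro exI conjI allI impI)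
    show "arr (Suc (path_of w t)) w - t > 0" using path_of_less_arr[OF True, of t] by simp
    fix s assume s: "t \<le> s \<and> s < t + (arr (Suc (path_of w t)) w - t)"
    then have "\<not> Suc (path_of w t) \<le> path_of w s" using le_path_of_iff[OF True, of "Suc (path_of w t)" s] by auto
    then show "path_of w s = path_of w t" using mono[of t s] s by auto
  qed
  have jump: "\<exists>e>0. \<forall>s. t - e < s \<and> s < t \<longrightarrow> path_of w t \<le> path_of w s + 1" for t
  proof (cases "path_of w t \<le> 1")
    case True
    then show ?thesis by (intro exI[of _ 1]) auto
  next
    case False
    then have "arr (path_of w t) w \<le> t" using le_path_of_iff[OF True, of "path_of w t" t] by auto
    then have 1: "arr (path_of w t - 1) w < t" using arr_strict_mono[OF True, of "path_of w t - 1" "path_of w t"] False by auto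
    show ?thesis
    proof (intro exI conjI allI impI)
      show "t - arr (path_of w t - 1) w > 0" using 1 by simp
      fix s assume "t - (t - arr (path_of w t - 1) w) < s \<and> s < t"
      then show "path_of w t \<le> path_of w s + 1" using le_path_of_iff[OF True, of "path_of w t - 1" s] False by auto
    qed
  qed
  show ?thesis unfolding paths_def using mono zero right jump by (auto intro!: monoI)
next
  case False
  then show ?thesis by (auto simp: paths_def path_of_def mono_def intro!: exI[of _ 1])
qed

lemma path_of_meas [measurable]: "path_of \<in> measurable seqS Ninf"
proof (rule measurable_NinfI)
  fix s k
  have "{w \<in> space seqS. if regular w then (k = 0 \<or> arr k w \<le> s) \<and> s < arr (Suc k) w else k = 0} \<in> sets seqS" by measurable
  then show "{w \<in> space seqS. path_of w s = k} \<in> sets seqS" by (simp only: path_of_eq_iff)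
qed simp

text \<open>If the path never reaches \<open>n\<close>, this is the unspecified real
  \<open>Inf {}\<close>. Such paths do not come from regular gap sequences.\<close>

definition tau :: "nat \<Rightarrow> cpath \<Rightarrow> real" where
  "tau n N = (if n = 0 then 0 else Inf {t. n \<le> N t})"

definition gaps_of :: "cpath \<Rightarrow> nat \<Rightarrow> real" where
  "gaps_of N i = tau (Suc i) N - tau i N"

lemma tau_path_of: "regular w \<Longrightarrow> tau n (path_of w) = arr n w"
proof (cases "n = 0")
  case False
  assume w: "regular w"
  have "{t. n \<le> path_of w t} = {arr n w..}" using le_path_of_iff[OF w] False by auto
  then show ?thesis using False by (simp add: tau_def)
qed (simp add: tau_def)

lemma gaps_of_path_of: "regular w \<Longrightarrow> gaps_of (path_of w) = w"
  by (rule ext) (simp add: gaps_of_def tau_path_of arr_Suc)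

text \<open>Right continuity makes the infimum a time at which level \<open>n\<close> is reached. If
  it is never reached, which natural times detect, the value is \<open>Inf {}\<close>; in this form
  measurability is immediate.\<close>

lemma tau_le_iff:
  assumes N: "N \<in> paths" and n: "n \<noteq> 0"
  shows "tau n N \<le> c \<longleftrightarrow> (if \<exists>m::nat. n \<le> N (real m) then n \<le> N c else Inf ({}::real set) \<le> c)"
proof (cases "\<exists>m::nat. n \<le> N (real m)")
  case True
  let ?A = "{t. n \<le> N t}"
  have ne: "?A \<noteq> {}" using True by auto
  have bd: "bdd_below ?A"
  proof (rule bdd_belowI[of _ 0])
    fix t assume "t \<in> ?A"
    then show "0 \<le> t" using paths_nonpos[OF N, of t] n by (cases "t \<le> 0") auto
  qed
  have "Inf ?A \<le> c \<longleftrightarrow> n \<le> N c"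
  proof
    assume "n \<le> N c"
    then show "Inf ?A \<le> c" by (intro cInf_lower bd) auto
  next
    assume le: "Inf ?A \<le> c"
    show "n \<le> N c"
    proof (rule ccontr)
      assume "\<not> n \<le> N c"
      obtain e where "e > 0 \<and> (\<forall>s. c \<le> s \<and> s < c + e \<longrightarrow> N s = N c)"
        using paths_right[OF N, of c] by (rule exE)
      then have e: "e > 0" "\<And>s. c \<le> s \<Longrightarrow> s < c + e \<Longrightarrow> N s = N c" by blast+
      have "c + e \<le> t" if "t \<in> ?A" for t
      proof (rule ccontr)
        assume "\<not> c + e \<le> t"
        then have "N t \<le> N c" using e(2)[of t] paths_mono[OF N, of t c] by (cases "c \<le> t") auto
        then show False using that \<open>\<not> n \<le> N c\<close> by auto
      qed
      then have "c + e \<le> Inf ?A" by (intro cInf_greatest ne)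
      then show False using le e(1) by simp
    qed
  qed
  then show ?thesis using True n by (simp add: tau_def)
next
  case False
  have "\<not> n \<le> N t" for t
  proof
    assume "n \<le> N t"
    obtain m :: nat where "t < real m" using reals_Archimedean2 by blast
    then have "n \<le> N (real m)" using paths_mono[OF N, of t "real m"] \<open>n \<le> N t\<close> by auto
    then show False using False by blast
  qed
  then show ?thesis using False n by (simp add: tau_def)
qed

lemma tau_meas [measurable]: "tau n \<in> borel_measurable Ninf"
proof (cases "n = 0")
  case n: False
  show ?thesis unfolding borel_measurable_iff_le
  proof
    fix c
    have seteq: "{N \<in> space Ninf. tau n N \<le> c} =
      {N \<in> space Ninf. if \<exists>m::nat. n \<le> N (real m) then n \<le> N c else Inf ({}::real set) \<le> c}"
      by (rule Collect_cong, rule conj_cong, rule refl, rule tau_le_iff) (simp_all add: n)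
    show "{N \<in> space Ninf. tau n N \<le> c} \<in> sets Ninf" unfolding seteq by measurable
  qed
qed (simp add: tau_def[abs_def])

lemma gaps_of_meas [measurable]: "gaps_of \<in> measurable Ninf seqS"
  unfolding gaps_of_def[abs_def] by (rule measurable_abs_UNIV) measurable

text \<open>The Laplace transform of \<open>arr n\<close> at 1 is \<open>2^-n\<close>. This is
  summable, so \<open>exp (- arr n w)\<close> tends to 0 almost surely.\<close>

lemma AE_regular: "AE w in expseq. regular w"
proof -
  define E where "E n = (\<integral>\<^sup>+w. ennreal (exp (- arr n w)) \<partial>expseq)" for n
  have half: "(\<integral>\<^sup>+x. ennreal (exp (- x)) \<partial>exp_law) = ennreal (1 / 2)"
  proof -
    have "(\<integral>\<^sup>+x. ennreal (exp (- x)) \<partial>exp_law) = (\<integral>\<^sup>+x. ennreal (exp (- (2 * x))) * indicator {0<..} x \<partial>lborel)"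
      by (subst nn_integral_exp_law) (auto intro!: nn_integral_cong simp: indicator_def ennreal_mult[symmetric] exp_add[symmetric])
    then show ?thesis by (simp add: nn_integral_lborel_Ioi nn_integral_exp_tail)
  qed
  have "E n = ennreal ((1 / 2) ^ n)" for n
  proof (induction n)
    case 0
    show ?case by (simp add: E_def expseq.emeasure_space_1[simplified])
  next
    case (Suc n)
    have arr_upd: "arr n (w(n := x)) = arr n w" for w x
      unfolding arr_def by (rule sum.cong) auto
    have "E (Suc n) = (\<integral>\<^sup>+w. (\<integral>\<^sup>+x. ennreal (exp (- arr n w)) * ennreal (exp (- x)) \<partial>exp_law) \<partial>expseq)"
      unfolding E_def
      by (subst nn_integral_resample[of _ n])
         (auto simp: arr_Suc arr_upd ennreal_mult[symmetric] exp_add[symmetric] intro!: nn_integral_cong)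
    also have "\<dots> = (\<integral>\<^sup>+w. ennreal (exp (- arr n w)) * ennreal (1 / 2) \<partial>expseq)"
      by (intro nn_integral_cong) (subst nn_integral_cmult, auto simp: half)
    also have "\<dots> = E n * ennreal (1 / 2)"
      unfolding E_def by (rule nn_integral_multc) measurable
    finally have "E (Suc n) = ennreal ((1 / 2) ^ n) * ennreal (1 / 2)" unfolding Suc .
    also have "\<dots> = ennreal ((1 / 2) ^ n * (1 / 2))" by (rule ennreal_mult[symmetric]) auto
    finally show ?case by (simp only: power_Suc2)
  qed
  then have "(\<Sum>n. \<integral>\<^sup>+w. ennreal (exp (- arr n w)) \<partial>expseq) = (\<Sum>n. ennreal ((1 / 2) ^ n))" by (simp add: E_def)
  also have "\<dots> = ennreal (\<Sum>n. (1 / 2) ^ n)"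
    by (rule suminf_ennreal2) (auto intro: summable_geometric)
  finally have "(\<Sum>n. \<integral>\<^sup>+w. ennreal (exp (- arr n w)) \<partial>expseq) < \<infinity>" by simp
  then have "AE w in expseq. (\<Sum>n. ennreal (exp (- arr n w))) \<noteq> \<infinity>"
    by (intro AE_suminf_finite) auto
  with AE_expseq_pos show ?thesis
  proof eventually_elim
    case (elim w)
    have "(\<lambda>n. exp (- arr n w)) \<longlonglongrightarrow> 0" using suminf_finite_tendsto_0(1)[OF elim(2)] by simp
    have "\<exists>n. real m \<le> arr n w" for m
    proof -
      have "\<forall>\<^sub>F n in sequentially. exp (- arr n w) < exp (- real m)"
        using \<open>(\<lambda>n. exp (- arr n w)) \<longlonglongrightarrow> 0\<close> by (rule order_tendstoD) simp
      then obtain n where "exp (- arr n w) < exp (- real m)" by (auto simp: eventually_sequentially)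
      then show ?thesis by (intro exI[of _ n]) auto
    qed
    then show ?case using elim by (simp add: regular_def)
  qed
qed

text \<open>The gaps after the \<open>n\<close>-th are irrelevant for a predictable process; the value 1 keeps the sequence regular.\<close>

definition gap_ext :: "nat \<Rightarrow> real \<Rightarrow> (nat \<Rightarrow> real) \<Rightarrow> nat \<Rightarrow> real" where
  "gap_ext n s w = (\<lambda>i. if i < n then w i else if i = n then s else 1)"

lemma gap_ext_meas [measurable (raw)]:
  assumes [measurable]: "f \<in> borel_measurable M" "g \<in> measurable M seqS"
  shows "(\<lambda>x. gap_ext n (f x) (g x)) \<in> measurable M seqS"
proof -
  have "(\<lambda>x. gap_ext n (f x) (g x) i) \<in> borel_measurable M" for i
  proof -
    consider "i < n" | "i = n" | "n < i" by linarith
    then show ?thesis by cases (auto simp: gap_ext_def)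
  qed
  then show ?thesis by (rule measurable_abs_UNIV)
qed

lemma gap_ext_cong: "(\<And>i. i < n \<Longrightarrow> w i = w' i) \<Longrightarrow> gap_ext n s w = gap_ext n s w'"
  by (auto simp: gap_ext_def)

lemma arr_ext: "k \<le> n \<Longrightarrow> arr k (gap_ext n s w) = arr k w"
  unfolding arr_def by (rule sum.cong) (auto simp: gap_ext_def)

lemma arr_ext_Suc: "arr (Suc n) (gap_ext n s w) = arr n w + s"
  by (simp add: arr_Suc arr_ext) (simp add: gap_ext_def)

lemma regular_ext:
  assumes "\<And>i. i < n \<Longrightarrow> 0 < w i" "0 < s" shows "regular (gap_ext n s w)"
  unfolding regular_def
proof (intro conjI allI)
  show "0 < gap_ext n s w i" for i using assms by (auto simp: gap_ext_def)
  fix m :: nat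
  have "real m \<le> arr (Suc n + m) (gap_ext n s w)"
  proof (induction m)
    case 0
    have "0 \<le> arr n w" unfolding arr_def using assms(1) by (intro sum_nonneg) (simp add: less_imp_le)
    then show ?case using assms(2) by (simp add: arr_ext_Suc)
  next
    case (Suc m)
    then show ?case by (simp add: arr_Suc) (simp add: gap_ext_def)
  qed
  then show "\<exists>k. real m \<le> arr k (gap_ext n s w)" by blast
qed

text \<open>The two sequences have the same first \<open>n\<close> jumps, and in neither does the
  next one come before \<open>arr n w + s\<close>, because \<open>s \<le> w n\<close>.\<close>

lemma path_of_ext_agree:
  assumes w: "regular w" and s: "0 < s" "s \<le> w n" and u: "u < arr n w + s"
  shows "path_of (gap_ext n s w) u = path_of w u"
proof -
  have r: "regular (gap_ext n s w)" using regular_pos[OF w] s by (intro regular_ext) auto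
  have "k \<le> path_of (gap_ext n s w) u \<longleftrightarrow> k \<le> path_of w u" if "0 < k" for k
  proof (cases "k \<le> n")
    case True
    then show ?thesis using le_path_of_iff[OF w that] le_path_of_iff[OF r that] by (simp add: arr_ext)
  next
    case False
    have "u < arr k (gap_ext n s w)" using arr_mono[OF r, of "Suc n" k] False u by (simp add: arr_ext_Suc)
    moreover have "u < arr k w" using arr_mono[OF w, of "Suc n" k] False u s by (simp add: arr_Suc)
    ultimately show ?thesis using le_path_of_iff[OF w that, of u] le_path_of_iff[OF r that, of u] by simp
  qed
  then show ?thesis by (metis le_antisym le_refl not_gr_zero zero_le)
qed

lemma nn_integral_gaps:
  assumes w: "regular w" and [measurable]: "g \<in> borel_measurable borel"
  shows "(\<integral>\<^sup>+u. g u * indicator {0<..} u \<partial>lborel) = (\<Sum>i. \<integral>\<^sup>+x. g (arr i w + x) * indicator {0<..w i} x \<partial>lborel)"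
proof -
  let ?B = "\<lambda>i. {arr i w<..arr (Suc i) w}"
  have "(\<Union>i. ?B i) = {0<..}"
  proof (intro equalityI subsetI)
    fix u :: real assume "u \<in> {0<..}"
    then have u: "0 < u" by simp
    define k where "k = (LEAST k. u \<le> arr (Suc k) w)"
    obtain k' where "u < arr (Suc k') w" using regular_exceeds[OF w] by blast
    then have 1: "u \<le> arr (Suc k) w" unfolding k_def using LeastI[of "\<lambda>k. u \<le> arr (Suc k) w" k'] by simp
    have 2: "arr k w < u"
    proof (cases k)
      case (Suc j)
      then show ?thesis using not_less_Least[of j "\<lambda>k. u \<le> arr (Suc k) w"] unfolding k_def[symmetric] by simp
    qed (use u in simp)
    show "u \<in> (\<Union>i. ?B i)" using 1 2 by auto
  next
    fix u assume "u \<in> (\<Union>i. ?B i)"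
    then obtain i where "arr i w < u" by auto
    then show "u \<in> {0<..}" using arr_nonneg[OF w, of i] by simp
  qed
  moreover have "disjoint_family ?B"
    unfolding disjoint_family_on_def
  proof (intro ballI impI)
    fix m n :: nat assume "m \<noteq> n"
    then consider "Suc m \<le> n" | "Suc n \<le> m" by linarith
    then show "?B m \<inter> ?B n = {}"
      using arr_mono[OF w, of "Suc m" n] arr_mono[OF w, of "Suc n" m] by cases auto
  qed
  then have "(\<integral>\<^sup>+u. g u * indicator (\<Union>i. ?B i) u \<partial>lborel) = (\<Sum>i. \<integral>\<^sup>+u. g u * indicator (?B i) u \<partial>lborel)"
    by (intro nn_integral_disjoint_family) auto
  moreover have "(\<integral>\<^sup>+u. g u * indicator (?B i) u \<partial>lborel) = (\<integral>\<^sup>+x. g (arr i w + x) * indicator {0<..w i} x \<partial>lborel)" for i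
    by (subst nn_integral_real_affine[where c=1 and t="arr i w"]) (auto intro!: nn_integral_cong simp: indicator_def arr_Suc)
  ultimately show ?thesis by simp
qed

lemma path_of_increment:
  assumes w: "regular w" and st: "s \<le> t"
  shows "(of_nat (path_of w t - path_of w s) :: ennreal) = (\<Sum>i. indicator {s<..t} (arr (Suc i) w))"
proof -
  have i: "arr (Suc i) w \<in> {s<..t} \<longleftrightarrow> i \<in> {path_of w s..<path_of w t}" for i
    using le_path_of_iff[OF w, of "Suc i" s] le_path_of_iff[OF w, of "Suc i" t] by auto
  have "(\<Sum>i. indicator {s<..t} (arr (Suc i) w) :: ennreal) = (\<Sum>i\<in>{path_of w s..<path_of w t}. indicator {s<..t} (arr (Suc i) w))"
    by (rule suminf_finite) (use i in \<open>auto simp: indicator_def\<close>)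
  also have "\<dots> = (\<Sum>i\<in>{path_of w s..<path_of w t}. 1)"
    by (rule sum.cong) (use i in \<open>auto simp: indicator_def\<close>)
  finally show ?thesis by simp
qed

section \<open>The law of the path with independent exponential gaps\<close>

definition Pexp :: "cpath measure" where
  "Pexp = distr expseq Ninf path_of"

lemma sets_Pexp [simp, measurable_cong]: "sets Pexp = sets Ninf"
  and space_Pexp [simp]: "space Pexp = paths"
  by (auto simp: Pexp_def)

lemma prob_space_Pexp: "prob_space Pexp"
  unfolding Pexp_def by (rule expseq.prob_space_distr) simp

lemma nn_integral_Pexp: "f \<in> borel_measurable Ninf \<Longrightarrow> (\<integral>\<^sup>+N. f N \<partial>Pexp) = (\<integral>\<^sup>+w. f (path_of w) \<partial>expseq)"
  unfolding Pexp_def by (rule nn_integral_distr) auto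

lemma AE_PexpI:
  assumes "AE w in expseq. P (path_of w)" "{N \<in> paths. P N} \<in> sets Ninf"
  shows "AE N in Pexp. P N"
  unfolding Pexp_def using assms by (subst AE_distr_iff) auto

lemma AE_PexpD: "AE N in Pexp. P N \<Longrightarrow> AE w in expseq. P (path_of w)"
  unfolding Pexp_def by (rule AE_distrD[where f=path_of and M'=Ninf]) auto

section \<open>Watanabe's characterisation of the Poisson law\<close>

text \<open>The martingale property of \<open>N t - t\<close> written with nonnegative integrals,
  where nothing has to be integrable beforehand. Subtraction of naturals is harmless because paths
  increase.\<close>

locale unit_measure = prob_space \<mu> for \<mu> :: "cpath measure" +
  assumes sets_mu [simp, measurable_cong]: "sets \<mu> = sets Ninf"
    and unit_comp: "\<And>s t A. 0 \<le> s \<Longrightarrow> s \<le> t \<Longrightarrow> A \<in> sets (Nsig s) \<Longrightarrow>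
      (\<integral>\<^sup>+N. indicator A N * of_nat (N t - N s) \<partial>\<mu>) = ennreal (t - s) * emeasure \<mu> A"

text \<open>Each jump in \<open>(s, t]\<close> is compensated within its own gap. The sum of the
  compensators over all gaps reassembles the length of \<open>(s, t]\<close>.\<close>

lemma unit_measure_Pexp: "unit_measure Pexp"
proof -
  interpret prob_space Pexp by (rule prob_space_Pexp)
  show ?thesis
  proof
    fix s t :: real and A assume st: "0 \<le> s" "s \<le> t" and A: "A \<in> sets (Nsig s)"
    have [measurable]: "A \<in> sets Ninf" using A Nsig_Ninf by auto
    \<comment> \<open>The event is evaluated on the path whose next jump sits at the running time,
      which uses only the first \<open>i\<close> gaps. Once the running time exceeds
      \<open>s\<close>, this path agrees with the true one up to \<open>s\<close>, so the event is
      unchanged.\<close>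
    define h :: "nat \<Rightarrow> (nat \<Rightarrow> real) \<Rightarrow> real \<Rightarrow> ennreal" where
      "h i w x = indicator A (path_of (gap_ext i x w)) * indicator {s<..t} (arr i w + x)" for i w x
    have [measurable]: "(\<lambda>(w, x). h i w x) \<in> borel_measurable (seqS \<Otimes>\<^sub>M borel)" for i
      unfolding h_def by measurable
    have ad: "adapted i (h i)" for i
      unfolding adapted_def
    proof (intro allI impI ext)
      fix w w' :: "nat \<Rightarrow> real" and x assume eq: "\<forall>j<i. w j = w' j"
      have "gap_ext i x w = gap_ext i x w'" using eq by (intro gap_ext_cong) auto
      moreover have "arr i w = arr i w'" using eq by (auto simp: arr_def)
      ultimately show "h i w x = h i w' x" by (simp add: h_def)
    qed
    have h_eq: "h i w x = indicator A (path_of w) * indicator {s<..t} (arr i w + x)" if "regular w" "0 < x" "x \<le> w i" for i w x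
    proof (cases "s < arr i w + x")
      case True
      have "path_of (gap_ext i x w) \<in> A \<longleftrightarrow> path_of w \<in> A"
        by (rule Nsig_agree[OF A]) (use path_of_ext_agree[OF that] True in auto)
      then show ?thesis by (simp add: h_def indicator_def)
    qed (simp add: h_def)
    have "(\<integral>\<^sup>+N. indicator A N * of_nat (N t - N s) \<partial>Pexp) = (\<integral>\<^sup>+w. indicator A (path_of w) * of_nat (path_of w t - path_of w s) \<partial>expseq)"
      by (rule nn_integral_Pexp) measurable
    also have "\<dots> = (\<integral>\<^sup>+w. (\<Sum>i. h i w (w i)) \<partial>expseq)"
    proof (rule nn_integral_cong_AE, use AE_regular in eventually_elim)
      case (elim w)
      have "(\<Sum>i. h i w (w i)) = (\<Sum>i. indicator A (path_of w) * indicator {s<..t} (arr (Suc i) w))"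
        using regular_pos[OF elim] by (intro suminf_cong) (simp add: h_eq[OF elim] arr_Suc)
      then show ?case by (simp add: path_of_increment[OF elim st(2)] ennreal_suminf_cmult)
    qed
    also have "\<dots> = (\<Sum>i. \<integral>\<^sup>+w. h i w (w i) \<partial>expseq)" by (rule nn_integral_suminf) measurable
    also have "\<dots> = (\<Sum>i. \<integral>\<^sup>+w. (\<integral>\<^sup>+x. h i w x * indicator {0<..w i} x \<partial>lborel) \<partial>expseq)"
      by (intro suminf_cong nn_integral_compensator ad) measurable
    also have "\<dots> = (\<integral>\<^sup>+w. (\<Sum>i. \<integral>\<^sup>+x. h i w x * indicator {0<..w i} x \<partial>lborel) \<partial>expseq)"
      by (rule nn_integral_suminf[symmetric]) measurable
    also have "\<dots> = (\<integral>\<^sup>+w. indicator A (path_of w) * ennreal (t - s) \<partial>expseq)"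
    proof (rule nn_integral_cong_AE, use AE_regular in eventually_elim)
      case (elim w)
      have "(\<Sum>i. \<integral>\<^sup>+x. h i w x * indicator {0<..w i} x \<partial>lborel) =
        (\<Sum>i. \<integral>\<^sup>+x. (indicator A (path_of w) * indicator {s<..t} (arr i w + x)) * indicator {0<..w i} x \<partial>lborel)"
        by (intro suminf_cong nn_integral_cong) (auto simp: indicator_def h_eq[OF elim, unfolded indicator_def])
      also have "\<dots> = (\<integral>\<^sup>+u. (indicator A (path_of w) * indicator {s<..t} u) * indicator {0<..} u \<partial>lborel)"
        by (rule nn_integral_gaps[OF elim, symmetric]) measurable
      also have "\<dots> = (\<integral>\<^sup>+u. indicator A (path_of w) * indicator {s<..t} u \<partial>lborel)"
        by (intro nn_integral_cong) (use st in \<open>auto simp: indicator_def\<close>)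
      also have "\<dots> = indicator A (path_of w) * ennreal (t - s)"
        using st by (subst nn_integral_cmult) auto
      finally show ?case .
    qed
    also have "\<dots> = (\<integral>\<^sup>+w. indicator A (path_of w) \<partial>expseq) * ennreal (t - s)"
      by (rule nn_integral_multc) measurable
    also have "(\<integral>\<^sup>+w. indicator A (path_of w) \<partial>expseq) = emeasure Pexp A"
      by (subst nn_integral_Pexp[symmetric]) auto
    finally show "(\<integral>\<^sup>+N. indicator A N * of_nat (N t - N s) \<partial>Pexp) = ennreal (t - s) * emeasure Pexp A"
      by (simp add: mult.commute)
  qed simp
qed

text \<open>Every time has a neighbourhood in which the path rises by at most 1; \<open>d\<close> is
  a Lebesgue number of this cover of the compact interval.\<close>

lemma path_small_increments:
  assumes N: "N \<in> paths"
  shows "\<exists>d>0. \<forall>a b. r \<le> a \<longrightarrow> a \<le> b \<longrightarrow> b \<le> t \<longrightarrow> b - a < d \<longrightarrow> N b - N a \<le> 1"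
proof -
  have loc: "\<exists>e>0. \<forall>a b. a \<in> ball u e \<longrightarrow> b \<in> ball u e \<longrightarrow> N b - N a \<le> 1" for u
  proof -
    obtain e1 where "e1 > 0 \<and> (\<forall>s. u - e1 < s \<and> s < u \<longrightarrow> N u \<le> N s + 1)"
      using paths_jump[OF N, of u] by (rule exE)
    then have e1: "e1 > 0" "\<And>s. u - e1 < s \<Longrightarrow> s < u \<Longrightarrow> N u \<le> N s + 1" by blast+
    obtain e2 where "e2 > 0 \<and> (\<forall>s. u \<le> s \<and> s < u + e2 \<longrightarrow> N s = N u)"
      using paths_right[OF N, of u] by (rule exE)
    then have e2: "e2 > 0" "\<And>s. u \<le> s \<Longrightarrow> s < u + e2 \<Longrightarrow> N s = N u" by blast+
    show ?thesis
    proof (intro exI[of _ "min e1 e2"] conjI allI impI)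
      fix a b assume ab: "a \<in> ball u (min e1 e2)" "b \<in> ball u (min e1 e2)"
      have "N b \<le> N u"
      proof (cases "b < u")
        case True
        then show ?thesis using paths_mono[OF N, of b u] by simp
      next
        case False
        then show ?thesis using e2(2)[of b] ab by (auto simp: dist_real_def)
      qed
      moreover have "N u \<le> N a + 1"
      proof (cases "a < u")
        case True
        then show ?thesis using e1(2)[of a] ab by (auto simp: dist_real_def)
      next
        case False
        then show ?thesis using e2(2)[of a] ab by (auto simp: dist_real_def)
      qed
      ultimately show "N b - N a \<le> 1" by linarith
    qed (use e1(1) e2(1) in simp)
  qed
  then have "\<forall>u. \<exists>e. e > 0 \<and> (\<forall>a b. a \<in> ball u e \<longrightarrow> b \<in> ball u e \<longrightarrow> N b - N a \<le> 1)" by blast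
  then obtain e where "\<forall>u. e u > 0 \<and> (\<forall>a b. a \<in> ball u (e u) \<longrightarrow> b \<in> ball u (e u) \<longrightarrow> N b - N a \<le> 1)"
    by (rule choice[THEN exE])
  then have e: "\<And>u. e u > 0" "\<And>u a b. a \<in> ball u (e u) \<Longrightarrow> b \<in> ball u (e u) \<Longrightarrow> N b - N a \<le> 1" by blast+
  obtain d where d: "0 < d" "\<forall>x\<in>{r..t}. \<exists>G\<in>range (\<lambda>u. ball u (e u)). ball x d \<subseteq> G"
  proof (rule Heine_Borel_lemma[of "{r..t}" "range (\<lambda>u. ball u (e u))"])
    show "{r..t} \<subseteq> \<Union> (range (\<lambda>u. ball u (e u)))"
    proof
      fix x
      have "x \<in> ball x (e x)" using e(1)[of x] by simp
      then show "x \<in> \<Union> (range (\<lambda>u. ball u (e u)))" by (intro UN_I) simp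
    qed
  qed auto
  show ?thesis
  proof (intro exI[of _ d] conjI allI impI \<open>0 < d\<close>)
    fix a b assume ab: "r \<le> a" "a \<le> b" "b \<le> t" "b - a < d"
    then have "a \<in> {r..t}" by simp
    then obtain u where u: "ball a d \<subseteq> ball u (e u)" using d(2) by blast
    have "a \<in> ball a d" "b \<in> ball a d" using ab d(1) by (simp_all add: dist_real_def)
    then show "N b - N a \<le> 1" using u by (intro e(2)[of a u b]) blast+
  qed
qed

text \<open>There are \<open>Suc n\<close> cells, so the denominator is never 0.\<close>

definition grid :: "real \<Rightarrow> real \<Rightarrow> nat \<Rightarrow> nat \<Rightarrow> real" where
  "grid r t n i = r + (t - r) * real i / real (Suc n)"

context unit_measure
begin

lemma space_mu [simp]: "space \<mu> = paths"
  using sets_eq_imp_space_eq[OF sets_mu] by simp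

lemma int_count:
  assumes "0 \<le> a" "a \<le> b"
  shows "integrable \<mu> (\<lambda>N. real (N b - N a))" "(LINT N|\<mu>. real (N b - N a)) = b - a"
proof -
  have "paths \<in> sets (Nsig a)" using sets.top[of "Nsig a"] by simp
  from unit_comp[OF assms this] have e: "(\<integral>\<^sup>+N. ennreal (real (N b - N a)) \<partial>\<mu>) = ennreal (b - a)"
    using emeasure_space_1 by (subst (asm) nn_integral_cong[of _ _ "\<lambda>N. ennreal (real (N b - N a))"]) (auto simp: ennreal_of_nat_eq_real_of_nat)
  show i: "integrable \<mu> (\<lambda>N. real (N b - N a))"
    by (rule integrableI_nonneg) (auto simp: e)
  show "(LINT N|\<mu>. real (N b - N a)) = b - a"
    using e assms by (subst (asm) nn_integral_eq_integral[OF i]) auto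
qed

text \<open>The weight takes countably many values. Each event \<open>N a - N r = k\<close> belongs
  to the past of \<open>a\<close>, and there the compensator identity applies.\<close>

lemma comp_weighted:
  fixes f :: "nat \<Rightarrow> real"
  assumes r: "0 \<le> r" "r \<le> a" "a \<le> b" and A: "A \<in> sets (Nsig r)" and f: "\<And>k. 0 \<le> f k" "\<And>k. f k \<le> 1"
  shows "(LINT N|\<mu>. indicator A N * f (N a - N r) * real (N b - N a)) = (b - a) * (LINT N|\<mu>. indicator A N * f (N a - N r))"
proof -
  have [measurable]: "A \<in> sets Ninf" using A Nsig_Ninf by auto
  define B where "B k = A \<inter> {N \<in> paths. N a - N r = k}" for k
  have B: "B k \<in> sets (Nsig a)" for k
  proof -
    have [measurable]: "(\<lambda>N. N a) \<in> measurable (Nsig a) (count_space UNIV)" "(\<lambda>N. N r) \<in> measurable (Nsig a) (count_space UNIV)"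
      using r by (auto intro: measurable_eval_Nsig)
    have "{N \<in> space (Nsig a). N a - N r = k} \<in> sets (Nsig a)" by measurable
    moreover have "A \<in> sets (Nsig a)" using A Nsig_mono[OF r(2)] by auto
    ultimately show ?thesis unfolding B_def by auto
  qed
  have [measurable]: "B k \<in> sets Ninf" for k using B Nsig_Ninf by auto
  have K: "indicator A N * ennreal (f (N a - N r)) = (\<Sum>k. ennreal (f k) * indicator (B k) N)" if "N \<in> paths" for N
  proof -
    have "(\<Sum>k. ennreal (f k) * indicator (B k) N) = (\<Sum>k\<in>{N a - N r}. ennreal (f k) * indicator (B k) N)"
      by (rule suminf_finite) (auto simp: B_def indicator_def)
    then show ?thesis using that by (simp add: B_def indicator_def)
  qed
  have "(\<integral>\<^sup>+N. indicator A N * ennreal (f (N a - N r)) * of_nat (N b - N a) \<partial>\<mu>) =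
    (\<integral>\<^sup>+N. (\<Sum>k. ennreal (f k) * (indicator (B k) N * of_nat (N b - N a))) \<partial>\<mu>)"
    by (rule nn_integral_cong) (simp add: K ennreal_suminf_multc[symmetric] mult.assoc)
  also have "\<dots> = (\<Sum>k. \<integral>\<^sup>+N. ennreal (f k) * (indicator (B k) N * of_nat (N b - N a)) \<partial>\<mu>)"
    by (rule nn_integral_suminf) measurable
  also have "\<dots> = (\<Sum>k. ennreal (f k) * (ennreal (b - a) * emeasure \<mu> (B k)))"
  proof (rule suminf_cong)
    fix k
    have "(\<integral>\<^sup>+N. indicator (B k) N * of_nat (N b - N a) \<partial>\<mu>) = ennreal (b - a) * emeasure \<mu> (B k)"
      by (rule unit_comp) (use r B in auto)
    then show "(\<integral>\<^sup>+N. ennreal (f k) * (indicator (B k) N * of_nat (N b - N a)) \<partial>\<mu>) = ennreal (f k) * (ennreal (b - a) * emeasure \<mu> (B k))"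
      by (subst nn_integral_cmult) auto
  qed
  also have "\<dots> = ennreal (b - a) * (\<Sum>k. ennreal (f k) * emeasure \<mu> (B k))"
    by (subst ennreal_suminf_cmult[symmetric]) (simp add: mult.left_commute)
  also have "(\<Sum>k. ennreal (f k) * emeasure \<mu> (B k)) = (\<Sum>k. \<integral>\<^sup>+N. ennreal (f k) * indicator (B k) N \<partial>\<mu>)"
    by (intro suminf_cong nn_integral_cmult_indicator[symmetric]) auto
  also have "\<dots> = (\<integral>\<^sup>+N. (\<Sum>k. ennreal (f k) * indicator (B k) N) \<partial>\<mu>)"
    by (rule nn_integral_suminf[symmetric]) measurable
  also have "\<dots> = (\<integral>\<^sup>+N. indicator A N * ennreal (f (N a - N r)) \<partial>\<mu>)"
    by (rule nn_integral_cong) (simp add: K)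
  finally have nn: "(\<integral>\<^sup>+N. indicator A N * ennreal (f (N a - N r)) * of_nat (N b - N a) \<partial>\<mu>) =
     ennreal (b - a) * (\<integral>\<^sup>+N. indicator A N * ennreal (f (N a - N r)) \<partial>\<mu>)" .
  have e1: "(LINT N|\<mu>. indicator A N * f (N a - N r) * real (N b - N a)) = enn2real (\<integral>\<^sup>+N. indicator A N * ennreal (f (N a - N r)) * of_nat (N b - N a) \<partial>\<mu>)"
    by (subst integral_eq_nn_integral) (auto simp: f indicator_def ennreal_mult' ennreal_of_nat_eq_real_of_nat intro!: arg_cong[where f=enn2real] nn_integral_cong)
  have e2: "(LINT N|\<mu>. indicator A N * f (N a - N r)) = enn2real (\<integral>\<^sup>+N. indicator A N * ennreal (f (N a - N r)) \<partial>\<mu>)"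
    by (subst integral_eq_nn_integral) (auto simp: f indicator_def intro!: arg_cong[where f=enn2real] nn_integral_cong)
  show ?thesis unfolding e1 e2 nn using r by (simp add: enn2real_mult)
qed

text \<open>The subtraction is truncated: \<open>err a b\<close> is the mean number of points in \<open>(a, b]\<close> beyond the first.\<close>

definition err :: "real \<Rightarrow> real \<Rightarrow> real" where
  "err a b = (LINT N|\<mu>. real (N b - N a - 1))"

lemma err_int:
  assumes "0 \<le> a" "a \<le> b" shows "integrable \<mu> (\<lambda>N. real (N b - N a - 1))"
proof (rule Bochner_Integration.integrable_bound[OF int_count(1)[OF assms]])
  show "AE N in \<mu>. norm (real (N b - N a - 1)) \<le> norm (real (N b - N a))" by (rule AE_I2) simp
qed measurable

text \<open>Up to \<open>err\<close>, a short interval contains at most one point, and this with probability \<open>b - a\<close> given the past.\<close>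

lemma recursion_step:
  fixes f :: "nat \<Rightarrow> real"
  assumes r: "0 \<le> r" "r \<le> a" "a \<le> b" and A: "A \<in> sets (Nsig r)" and f: "\<And>k. 0 \<le> f k" "\<And>k. f k \<le> 1"
  defines "V \<equiv> \<lambda>(g :: nat \<Rightarrow> real) u. (LINT N|\<mu>. indicator A N * g (N u - N r))"
  shows "\<bar>V f b - ((1 - (b - a)) * V f a + (b - a) * V (\<lambda>k. f (Suc k)) a)\<bar> \<le> 3 * err a b"
proof -
  have [measurable]: "A \<in> sets Ninf" using A Nsig_Ninf by auto
  define K where "K g N = indicator A N * g (N a - N r)" for g :: "nat \<Rightarrow> real" and N
  define D where "D N = real (N b - N a)" for N :: cpath
  have iK: "integrable \<mu> (\<lambda>N. indicator A N * g (N u - N r))" if "\<And>k. 0 \<le> g k" "\<And>k. g k \<le> 1" for g :: "nat \<Rightarrow> real" and u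
    by (rule integrable_const_bound[of _ 1]) (use that in \<open>auto simp: indicator_def\<close>)
  have iKD: "integrable \<mu> (\<lambda>N. K g N * D N)" if "\<And>k. 0 \<le> g k" "\<And>k. g k \<le> 1" for g :: "nat \<Rightarrow> real"
  proof (rule Bochner_Integration.integrable_bound[OF int_count(1)[OF _ r(3)]])
    show "AE N in \<mu>. norm (K g N * D N) \<le> norm (real (N b - N a))"
      using that by (auto simp: K_def D_def indicator_def mult_left_le_one_le)
  qed (use r in \<open>auto simp: K_def D_def\<close>)
  have cw: "(LINT N|\<mu>. K g N * D N) = (b - a) * (LINT N|\<mu>. K g N)" if "\<And>k. 0 \<le> g k" "\<And>k. g k \<le> 1" for g :: "nat \<Rightarrow> real"
    using comp_weighted[OF r A that] by (simp add: K_def D_def)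
  let ?f' = "\<lambda>k. f (Suc k)"
  have f': "\<And>k. 0 \<le> ?f' k" "\<And>k. ?f' k \<le> 1" using f by auto
  have iKf: "integrable \<mu> (K f)" "integrable \<mu> (K ?f')" unfolding K_def[abs_def] using iK[of f a] iK[of ?f' a] f by auto
  have i1: "integrable \<mu> (\<lambda>N. indicator A N * f (N b - N r))" by (rule iK) (use f in auto)
  have i2: "integrable \<mu> (\<lambda>N. K f N)" by (rule iKf(1))
  have i3: "integrable \<mu> (\<lambda>N. K f N * D N)" by (rule iKD) (use f in auto)
  have i4: "integrable \<mu> (\<lambda>N. K ?f' N * D N)" by (rule iKD) (use f in auto)
  define R where "R N = indicator A N * f (N b - N r) - (K f N - K f N * D N + K ?f' N * D N)" for N
  have "V f b - ((1 - (b - a)) * V f a + (b - a) * V ?f' a) = (LINT N|\<mu>. R N)"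
  proof -
    have "(LINT N|\<mu>. R N) = (LINT N|\<mu>. indicator A N * f (N b - N r)) -
      ((LINT N|\<mu>. K f N) - (LINT N|\<mu>. K f N * D N) + (LINT N|\<mu>. K ?f' N * D N))"
      unfolding R_def by (simp add: i1 i2 i3 i4)
    moreover have "V f a = (LINT N|\<mu>. K f N)" "V ?f' a = (LINT N|\<mu>. K ?f' N)" "V f b = (LINT N|\<mu>. indicator A N * f (N b - N r))"
      by (simp_all add: V_def K_def)
    ultimately show ?thesis unfolding cw[OF f] cw[OF f'] by (simp add: algebra_simps)
  qed
  also have "\<bar>LINT N|\<mu>. R N\<bar> \<le> (LINT N|\<mu>. \<bar>R N\<bar>)" by (rule integral_abs_bound)
  also have "\<dots> \<le> (LINT N|\<mu>. 3 * real (N b - N a - 1))"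
  proof (rule integral_mono)
    show "integrable \<mu> (\<lambda>N. \<bar>R N\<bar>)" unfolding R_def
      by (intro integrable_abs Bochner_Integration.integrable_diff Bochner_Integration.integrable_add i1 i2 i3 i4)
    show "integrable \<mu> (\<lambda>N. 3 * real (N b - N a - 1))" using err_int[of a b] r by auto
    fix N assume "N \<in> space \<mu>"
    then have N: "N \<in> paths" by simp
    define m where "m = N a - N r"
    define d where "d = N b - N a"
    have e: "N b - N r = m + d" using paths_mono[OF N, of r a] paths_mono[OF N, of a b] r by (simp add: m_def d_def)
    have R: "R N = indicator A N * (f (m + d) - f m - real d * (f (Suc m) - f m))"
      unfolding R_def K_def D_def e by (simp add: m_def[symmetric] d_def[symmetric] algebra_simps)
    \<comment> \<open>The interpolation is exact for \<open>d = 0\<close> and \<open>d = 1\<close>.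
      For larger \<open>d\<close> the error is at most \<open>1 + d <= 3 * (d - 1)\<close>, whence
      the constant 3.\<close>
    have "\<bar>f (m + d) - f m - real d * (f (Suc m) - f m)\<bar> \<le> 3 * real (d - 1)"
    proof (cases "d \<le> 1")
      case True
      then have "d = 0 \<or> d = 1" by auto
      then show ?thesis by auto
    next
      case False
      have "\<bar>f (m + d) - f m\<bar> \<le> 1" using f(1)[of "m+d"] f(2)[of "m+d"] f(1)[of m] f(2)[of m] by linarith
      moreover have "\<bar>f (Suc m) - f m\<bar> \<le> 1" using f(1)[of "Suc m"] f(2)[of "Suc m"] f(1)[of m] f(2)[of m] by linarith
      then have "real d * \<bar>f (Suc m) - f m\<bar> \<le> real d * 1" by (intro mult_left_mono) auto
      then have "\<bar>real d * (f (Suc m) - f m)\<bar> \<le> real d" by (simp add: abs_mult)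
      moreover have "1 + real d \<le> 3 * real (d - 1)" using False by auto
      ultimately show ?thesis by linarith
    qed
    then show "\<bar>R N\<bar> \<le> 3 * real (N b - N a - 1)"
      unfolding R d_def[symmetric] by (auto simp: indicator_def)
  qed
  also have "\<dots> = 3 * err a b" by (simp add: err_def)
  finally show ?thesis .
qed

text \<open>On a fixed path a fine grid separates the jumps, so the surplus points eventually
  vanish; they are dominated by the integrable count \<open>N t - N r\<close>.\<close>

lemma err_tendsto_0:
  assumes r: "0 \<le> r" "r \<le> t"
  shows "(\<lambda>n. \<Sum>i<Suc n. err (grid r t n i) (grid r t n (Suc i))) \<longlonglongrightarrow> 0"
proof -
  have grid: "grid r t n i \<le> grid r t n j" if "i \<le> j" for n i j
    using r that by (auto simp: grid_def intro!: divide_right_mono mult_left_mono)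
  have grid0: "grid r t n 0 = r" "grid r t n (Suc n) = t" for n by (auto simp: grid_def)
  have ptr: "r \<le> grid r t n i" for n i using grid[of 0 i n] grid0 by simp
  have ptt: "grid r t n i \<le> t" if "i \<le> Suc n" for n i using grid[OF that, of n] grid0 by simp
  define S where "S n N = (\<Sum>i<Suc n. real (N (grid r t n (Suc i)) - N (grid r t n i) - 1))" for n and N :: cpath
  have "(\<lambda>n. LINT N|\<mu>. S n N) \<longlonglongrightarrow> (LINT N|\<mu>. 0)"
  proof (rule integral_dominated_convergence[where w="\<lambda>N. real (N t - N r)"])
    show "integrable \<mu> (\<lambda>N. real (N t - N r))" by (rule int_count[OF r])
    show "S n \<in> borel_measurable \<mu>" for n unfolding S_def by measurable
    show "AE N in \<mu>. (\<lambda>n. S n N) \<longlonglongrightarrow> 0"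
    proof (rule AE_I2)
      fix N assume "N \<in> space \<mu>"
      then have N: "N \<in> paths" by simp
      obtain d where d: "d > 0" "\<And>a b. r \<le> a \<Longrightarrow> a \<le> b \<Longrightarrow> b \<le> t \<Longrightarrow> b - a < d \<Longrightarrow> N b - N a \<le> 1"
        using path_small_increments[OF N, of r t] by blast
      obtain n0 :: nat where n0: "(t - r) / d < real n0" using reals_Archimedean2 by blast
      have "S n N = 0" if "n0 \<le> n" for n
        unfolding S_def
      proof (rule sum.neutral, rule ballI)
        fix i assume i: "i \<in> {..<Suc n}"
        have "grid r t n (Suc i) - grid r t n i = (t - r) / real (Suc n)"
          by (simp add: grid_def field_simps del: of_nat_Suc) (simp add: field_simps)
        also have "\<dots> < d"
        proof -
          have "(t - r) / d < real (Suc n)" using n0 that by linarith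
          then show ?thesis using d(1) by (simp add: field_simps)
        qed
        finally have "N (grid r t n (Suc i)) - N (grid r t n i) \<le> 1"
          using ptr grid[of i "Suc i" n] ptt[of "Suc i" n] i by (intro d(2)) auto
        then show "real (N (grid r t n (Suc i)) - N (grid r t n i) - 1) = 0" by simp
      qed
      then show "(\<lambda>n. S n N) \<longlonglongrightarrow> 0"
        by (intro tendsto_eventually) (auto simp: eventually_sequentially)
    qed
    show "AE N in \<mu>. norm (S n N) \<le> real (N t - N r)" for n
    proof (rule AE_I2)
      fix N assume "N \<in> space \<mu>"
      then have N: "N \<in> paths" by simp
      have "S n N \<le> (\<Sum>i<Suc n. real (N (grid r t n (Suc i))) - real (N (grid r t n i)))"
        unfolding S_def
      proof (rule sum_mono)
        fix i
        have "N (grid r t n i) \<le> N (grid r t n (Suc i))" by (rule paths_mono[OF N grid]) simp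
        then show "real (N (grid r t n (Suc i)) - N (grid r t n i) - 1) \<le> real (N (grid r t n (Suc i))) - real (N (grid r t n i))" by linarith
      qed
      also have "\<dots> = real (N t) - real (N r)" by (subst sum_lessThan_telescope) (simp add: grid0)
      also have "\<dots> = real (N t - N r)" using paths_mono[OF N r(2)] by (simp only: of_nat_diff)
      finally have "S n N \<le> real (N t - N r)" .
      moreover have "0 \<le> S n N" unfolding S_def by (intro sum_nonneg of_nat_0_le_iff)
      ultimately show "norm (S n N) \<le> real (N t - N r)" by (simp only: real_norm_def abs_of_nonneg)
    qed
  qed simp
  moreover have "(LINT N|\<mu>. S n N) = (\<Sum>i<Suc n. err (grid r t n i) (grid r t n (Suc i)))" for n
    unfolding S_def err_def
    by (rule Bochner_Integration.integral_sum) (rule err_int[OF order_trans[OF r(1) ptr]], rule grid, simp)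
  ultimately show ?thesis by simp
qed

end

lemma abs_diff_recursion:
  fixes U W :: real
  assumes "\<bar>U - (U1 + U2)\<bar> \<le> x" "\<bar>W - (W1 + W2)\<bar> \<le> y" "\<bar>U1 - W1\<bar> = p" "\<bar>U2 - W2\<bar> = q"
  shows "\<bar>U - W\<bar> \<le> p + q + (x + y)"
  using assms by linarith

text \<open>Up to \<open>err\<close>, both measures obey the same recursion along a grid, whose
  right side is a convex combination of values at the previous point. The discrepancy therefore
  grows only by the errors, whose sum tends to 0 with the mesh. All \<open>f\<close> are treated at
  once, as the recursion also calls the shifted function.\<close>

lemma unit_measure_increment_eq:
  assumes \<mu>: "unit_measure \<mu>" and \<nu>: "unit_measure \<nu>"
    and r: "0 \<le> r" "r \<le> t" and A: "A \<in> sets (Nsig r)" and eq: "measure \<mu> A = measure \<nu> A"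
    and f: "\<And>k. 0 \<le> f k" "\<And>k. f k \<le> (1::real)"
  shows "(LINT N|\<mu>. indicator A N * f (N t - N r)) = (LINT N|\<nu>. indicator A N * f (N t - N r))"
proof -
  interpret m: unit_measure \<mu> by fact
  interpret v: unit_measure \<nu> by fact
  have [measurable]: "A \<in> sets Ninf" using A Nsig_Ninf by auto
  define d where "d f u = \<bar>(LINT N|\<mu>. indicator A N * f (N u - N r)) - (LINT N|\<nu>. indicator A N * f (N u - N r))\<bar>" for f :: "nat \<Rightarrow> real" and u
  have grid: "grid r t n i \<le> grid r t n j" if "i \<le> j" for n i j
    using r that by (auto simp: grid_def intro!: divide_right_mono mult_left_mono)
  have ptr: "r \<le> grid r t n i" for n i using grid[of 0 i n] by (simp add: grid_def)
  define e where "e n i = 3 * m.err (grid r t n i) (grid r t n (Suc i)) + 3 * v.err (grid r t n i) (grid r t n (Suc i))" for n i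
  have main: "d g (grid r t n i) \<le> (\<Sum>j<i. e n j)" if nt: "t - r \<le> real (Suc n)" and "\<And>k. 0 \<le> g k" "\<And>k. g k \<le> 1" for g n i
    using that(2,3)
  proof (induction i arbitrary: g)
    case 0
    have "grid r t n 0 = r" by (simp add: grid_def)
    moreover have "A \<inter> paths = A" using Nsig_subset[OF A] by (rule Int_absorb2)
    ultimately show ?case using eq by (simp add: d_def)
  next
    case (Suc i)
    let ?a = "grid r t n i" and ?b = "grid r t n (Suc i)"
    let ?h = "?b - ?a"
    let ?U = "\<lambda>f u. (LINT N|\<mu>. indicator A N * f (N u - N r))" and ?W = "\<lambda>f u. (LINT N|\<nu>. indicator A N * f (N u - N r))"
    let ?g' = "\<lambda>k. g (Suc k)"
    have ab: "?a \<le> ?b" by (rule grid) simp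
    have h: "?h = (t - r) / real (Suc n)" by (simp add: grid_def field_simps del: of_nat_Suc) (simp add: field_simps)
    \<comment> \<open>The mesh is at most 1, so \<open>1 - ?h\<close> and \<open>?h\<close> are the
      weights of a convex combination.\<close>
    have h01: "0 \<le> ?h" "0 \<le> 1 - ?h" using nt r unfolding h by (auto simp: field_simps)
    have 1: "\<bar>?U g ?b - ((1 - ?h) * ?U g ?a + ?h * ?U ?g' ?a)\<bar> \<le> 3 * m.err ?a ?b"
      by (rule m.recursion_step[OF r(1) ptr ab A]) (use Suc.prems in auto)
    have 2: "\<bar>?W g ?b - ((1 - ?h) * ?W g ?a + ?h * ?W ?g' ?a)\<bar> \<le> 3 * v.err ?a ?b"
      by (rule v.recursion_step[OF r(1) ptr ab A]) (use Suc.prems in auto)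
    have i1: "d g ?a \<le> (\<Sum>j<i. e n j)" by (rule Suc.IH) (use Suc.prems in auto)
    have i2: "d ?g' ?a \<le> (\<Sum>j<i. e n j)" by (rule Suc.IH) (use Suc.prems in auto)
    have "(1 - ?h) * d g ?a + ?h * d ?g' ?a \<le> (1 - ?h) * (\<Sum>j<i. e n j) + ?h * (\<Sum>j<i. e n j)"
      using h01 i1 i2 by (intro add_mono mult_left_mono)
    also have "\<dots> = (\<Sum>j<i. e n j)" by (simp add: algebra_simps)
    finally have 3: "(1 - ?h) * d g ?a + ?h * d ?g' ?a \<le> (\<Sum>j<i. e n j)" .
    have 4: "\<bar>(1 - ?h) * (?U g ?a - ?W g ?a)\<bar> = (1 - ?h) * d g ?a" "\<bar>?h * (?U ?g' ?a - ?W ?g' ?a)\<bar> = ?h * d ?g' ?a"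
      using h01 by (simp_all only: abs_mult d_def abs_of_nonneg)
    have "d g ?b \<le> (1 - ?h) * d g ?a + ?h * d ?g' ?a + e n i"
      unfolding e_def d_def[of g ?b]
      by (rule abs_diff_recursion[OF 1 2 4[unfolded right_diff_distrib]])
    also have "\<dots> \<le> (\<Sum>j<i. e n j) + e n i" by (rule add_right_mono[OF 3])
    finally show ?case by simp
  qed
  have "d f t \<le> 0"
  proof (rule LIMSEQ_le_const)
    have "(\<lambda>n. 3 * (\<Sum>i<Suc n. m.err (grid r t n i) (grid r t n (Suc i))) + 3 * (\<Sum>i<Suc n. v.err (grid r t n i) (grid r t n (Suc i)))) \<longlonglongrightarrow> 3 * 0 + 3 * 0"
      by (intro tendsto_intros m.err_tendsto_0 v.err_tendsto_0 r)
    then show "(\<lambda>n. \<Sum>j<Suc n. e n j) \<longlonglongrightarrow> 0" by (simp only: e_def sum.distrib sum_distrib_left) simp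
    obtain n0 :: nat where "t - r < real n0" using reals_Archimedean2 by blast
    have "d f t \<le> (\<Sum>j<Suc n. e n j)" if "n0 \<le> n" for n
    proof -
      have "t - r \<le> real (Suc n)" using \<open>t - r < real n0\<close> that by linarith
      then have "d f (grid r t n (Suc n)) \<le> (\<Sum>j<Suc n. e n j)" by (rule main) (rule f)+
      then show ?thesis by (simp add: grid_def)
    qed
    then show "\<exists>n0. \<forall>n\<ge>n0. d f t \<le> (\<Sum>j<Suc n. e n j)" by blast
  qed
  then show ?thesis by (simp add: d_def)
qed

text \<open>Finite-dimensional events form a generator closed under intersection. On them one argues
  by induction on the latest time: given the past, the value at \<open>t\<close> is fixed by the
  increment since the previous time, whose law is the same under both measures.\<close>

lemma unit_measure_unique:
  assumes \<mu>: "unit_measure \<mu>" and \<nu>: "unit_measure \<nu>"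
  shows "\<mu> = \<nu>"
proof -
  interpret m: unit_measure \<mu> by fact
  interpret v: unit_measure \<nu> by fact
  define G where "G = {{N \<in> paths. \<forall>s\<in>F. N s = f s} | F f. finite F}"
  have gen: "{N \<in> paths. \<forall>s\<in>F. N s = f s} \<in> sets (Nsig u)" if "finite F" "\<forall>s\<in>F. s \<le> u" for F f u
  proof -
    have "{N \<in> space (Nsig u). \<forall>s\<in>F. N s = f s} \<in> sets (Nsig u)"
    proof (rule sets.sets_Collect_finite_All[OF _ that(1)])
      fix s assume "s \<in> F"
      then have [measurable]: "(\<lambda>N. N s) \<in> measurable (Nsig u) (count_space UNIV)" using that(2) by (intro measurable_eval_Nsig) auto
      show "{N \<in> space (Nsig u). N s = f s} \<in> sets (Nsig u)" by measurable
    qed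
    then show ?thesis by simp
  qed
  have step: "measure \<mu> {N \<in> paths. \<forall>s\<in>F. N s = f s} = measure \<nu> {N \<in> paths. \<forall>s\<in>F. N s = f s}" if "finite F" for F f
    using that
  proof (induction F rule: finite_linorder_max_induct)
    case empty
    show ?case using m.prob_space v.prob_space by simp
  next
    case (insert t F)
    let ?A = "{N \<in> paths. \<forall>s\<in>F. N s = f s}"
    show ?case
    proof (cases "t \<le> 0")
      case True
      have "{N \<in> paths. \<forall>s\<in>insert t F. N s = f s} = (if f t = 0 then ?A else {})"
        by (auto simp: paths_nonpos[OF _ True])
      then show ?thesis using insert.IH by simp
    next
      case False
      \<comment> \<open>Adding 0 provides a base time with known value even if \<open>F\<close> is
        empty or contains only negative times.\<close>
      define s where "s = Max (insert 0 F)"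
      have s: "0 \<le> s" "s \<le> t" "\<forall>u\<in>F. u \<le> s" using insert False by (auto simp: s_def less_imp_le)
      have sF: "s = 0 \<or> s \<in> F" using Max_in[of "insert 0 F"] insert(1) by (auto simp: s_def)
      define c where "c = (if s = 0 then 0 else f s)"
      have c: "N s = c" if "N \<in> ?A" for N
        using that sF paths_nonpos[of N 0] by (auto simp: c_def)
      have A: "?A \<in> sets (Nsig s)" by (rule gen) (use insert s in auto)
      have AI: "?A \<in> sets Ninf" using A Nsig_Ninf by auto
      define g :: "nat \<Rightarrow> real" where "g k = (if k + c = f t then 1 else 0)" for k
      have "measure M {N \<in> paths. \<forall>s\<in>insert t F. N s = f s} = (LINT N|M. indicator ?A N * g (N t - N s))"
        if M: "unit_measure M" for M
      proof -
        interpret unit_measure M by fact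
        have XI: "{N \<in> paths. \<forall>s\<in>insert t F. N s = f s} \<inter> space M = {N \<in> paths. \<forall>s\<in>insert t F. N s = f s}"
          unfolding space_mu by blast
        have "measure M {N \<in> paths. \<forall>s\<in>insert t F. N s = f s} = (LINT N|M. indicator {N \<in> paths. \<forall>s\<in>insert t F. N s = f s} N)"
          by (subst Bochner_Integration.integral_indicator) (simp only: XI)
        also have "\<dots> = (LINT N|M. indicator ?A N * g (N t - N s))"
        proof (rule Bochner_Integration.integral_cong[OF refl])
          fix N assume "N \<in> space M"
          then have N: "N \<in> paths" by simp
          show "indicator {N \<in> paths. \<forall>s\<in>insert t F. N s = f s} N = indicator ?A N * g (N t - N s)"
          proof (cases "N \<in> ?A")
            case True
            then have "N t - N s + c = N t" using c[OF True] paths_mono[OF N s(2)] by simp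
            then show ?thesis using True by (simp add: indicator_def g_def)
          qed (auto simp: indicator_def)
        qed
        finally show ?thesis .
      qed
      moreover have "(LINT N|\<mu>. indicator ?A N * g (N t - N s)) = (LINT N|\<nu>. indicator ?A N * g (N t - N s))"
        by (rule unit_measure_increment_eq[OF \<mu> \<nu> s(1,2) A insert.IH]) (auto simp: g_def)
      ultimately show ?thesis using \<mu> \<nu> by simp
    qed
  qed
  have Gs: "sigma_sets paths G = sets Ninf"
  proof
    show "sigma_sets paths G \<subseteq> sets Ninf"
    proof (rule sets.sigma_sets_subset[of G Ninf, simplified], rule subsetI)
      fix X assume "X \<in> G"
      then obtain F f where X: "X = {N \<in> paths. \<forall>s\<in>F. N s = f s}" "finite F" by (auto simp: G_def)
      have "X \<in> sets (Nsig (Max (insert 0 F)))" unfolding X(1) by (rule gen) (use X(2) in auto)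
      then show "X \<in> sets Ninf" using Nsig_Ninf by auto
    qed
    show "sets Ninf \<subseteq> sigma_sets paths G"
      unfolding sets_Ninf
    proof (rule sigma_sets_mono', rule subsetI)
      fix X assume "X \<in> {{N \<in> paths. N s = k} |s k. True}"
      then obtain s k where "X = {N \<in> paths. N s = k}" by auto
      then show "X \<in> G" unfolding G_def by (intro CollectI exI[of _ "{s}"] exI[of _ "\<lambda>_. k"]) auto
    qed
  qed
  show ?thesis
  proof (rule measure_eqI_generator_eq[where E=G and \<Omega>=paths and A="\<lambda>_. paths"])
    show "Int_stable G"
    proof (rule Int_stableI)
      fix a b assume "a \<in> G" "b \<in> G"
      then obtain F f F' f' where a: "a = {N \<in> paths. \<forall>s\<in>F. N s = f s}" "finite F" and b: "b = {N \<in> paths. \<forall>s\<in>F'. N s = f' s}" "finite F'"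
        by (auto simp: G_def)
      show "a \<inter> b \<in> G"
      proof (cases "\<exists>s\<in>F \<inter> F'. f s \<noteq> f' s")
        case True
        then obtain s where s: "s \<in> F" "s \<in> F'" "f s \<noteq> f' s" by blast
        have "N \<notin> b" if "N \<in> a" for N
        proof
          assume "N \<in> b"
          then have "N s = f' s" using b(1) s(2) by blast
          moreover have "N s = f s" using that a(1) s(1) by blast
          ultimately show False using s(3) by (metis)
        qed
        then have "a \<inter> b = {}" by blast
        \<comment> \<open>Paths vanish at 0, so prescribing the value 1 there presents the empty set
          in the form required of members of \<open>G\<close>.\<close>
        also have "{} = {N \<in> paths. \<forall>s\<in>{0}. N s = (\<lambda>_. 1) s}" 
        proof -
          have "N \<notin> {N \<in> paths. \<forall>s\<in>{0}. N s = (\<lambda>_. 1) s}" for N :: "real \<Rightarrow> nat"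
            using paths_nonpos[of N 0] by force
          then show ?thesis by blast
        qed
        finally show ?thesis unfolding G_def
          by (intro CollectI exI[of _ "{0}"] exI[of _ "\<lambda>_. 1"] conjI) simp_all
      next
        case False
        have "a \<inter> b = {N \<in> paths. \<forall>s\<in>F \<union> F'. N s = (if s \<in> F then f s else f' s)}"
        proof (rule set_eqI)
          fix N
          have ff: "f s = f' s" if "s \<in> F" "s \<in> F'" for s using False that by blast
          show "N \<in> a \<inter> b \<longleftrightarrow> N \<in> {N \<in> paths. \<forall>s\<in>F \<union> F'. N s = (if s \<in> F then f s else f' s)}"
          proof
            assume "N \<in> a \<inter> b"
            then have N: "N \<in> paths" "\<forall>s\<in>F. N s = f s" "\<forall>s\<in>F'. N s = f' s" unfolding a(1) b(1) by blast+
            have "N s = (if s \<in> F then f s else f' s)" if "s \<in> F \<union> F'" for s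
              using bspec[OF N(2), of s] bspec[OF N(3), of s] that by (cases "s \<in> F") simp_all
            then show "N \<in> {N \<in> paths. \<forall>s\<in>F \<union> F'. N s = (if s \<in> F then f s else f' s)}" using N(1) by blast
          next
            assume "N \<in> {N \<in> paths. \<forall>s\<in>F \<union> F'. N s = (if s \<in> F then f s else f' s)}"
            then have N: "N \<in> paths" and h: "\<forall>s\<in>F \<union> F'. N s = (if s \<in> F then f s else f' s)" by blast+
            have "N s = f s" if "s \<in> F" for s using bspec[OF h, of s] that by simp
            moreover have "N s = f' s" if "s \<in> F'" for s
              using bspec[OF h, of s] ff[of s] that by (cases "s \<in> F") simp_all
            ultimately show "N \<in> a \<inter> b" unfolding a(1) b(1) using N by blast
          qed
        qed
        moreover have "finite (F \<union> F')" using a(2) b(2) by simp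
        ultimately show ?thesis unfolding G_def
          by (intro CollectI exI[of _ "F \<union> F'"] exI[of _ "\<lambda>s. if s \<in> F then f s else f' s"] conjI)
      qed
    qed
    show "range (\<lambda>_::nat. paths) \<subseteq> G" 
    proof -
      have "paths \<in> G" unfolding G_def by (rule CollectI, rule exI[of _ "{}"], rule exI[of _ "\<lambda>_. 0"]) simp
      then show ?thesis by blast
    qed
    show "emeasure \<mu> X = emeasure \<nu> X" if "X \<in> G" for X
      using that step unfolding G_def by (auto simp: m.emeasure_eq_measure v.emeasure_eq_measure)
    show "G \<subseteq> Pow paths" by (auto simp: G_def)
  qed (use Gs in auto)
qed

section \<open>Existence and uniqueness behind the definite description of the unit rate law\<close>

lemma yint_one: "yint (\<lambda>N s. 1) N t = max 0 t"
proof -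
  have "(\<integral>\<^sup>+ s. ennreal 1 * indicator {0<..t} s \<partial>lborel) = ennreal (max 0 t)"
    by (cases "0 \<le> t") (auto simp: max_def)
  then show ?thesis by (simp only: yint_def enn2real_ennreal max.cobounded1)
qed

text \<open>Counts have finite mean under \<open>Pexp\<close>, so the process is a true martingale
  and the constant times \<open>n\<close> localise it.\<close>

lemma local_martingale_Pexp: "pp_local_martingale Pexp (\<lambda>N t. real (N t) - yint (\<lambda>N s. 1) N t)"
proof -
  interpret unit_measure Pexp by (rule unit_measure_Pexp)
  have iN: "integrable Pexp (\<lambda>N. real (N t))" if "0 \<le> t" for t
  proof -
    have "integrable Pexp (\<lambda>N. real (N t - N 0))" by (rule int_count) (use that in auto)
    moreover have "real (N t - N 0) = real (N t)" if "N \<in> space Pexp" for N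
      using that paths_nonpos[of N 0] by simp
    ultimately show ?thesis by (rule Bochner_Integration.integrable_cong[OF refl, THEN iffD1, rotated])
  qed
  have M: "(LINT N:A|Pexp. real (N t) - max 0 t) = (LINT N:A|Pexp. real (N s) - max 0 s)"
    if st: "0 \<le> s" "s \<le> t" and A: "A \<in> sets (Nsig s)" for s t A
  proof -
    have [measurable]: "A \<in> sets Ninf" using A Nsig_Ninf by auto
    have "(LINT N|Pexp. indicator A N * real (N t - N s)) = enn2real (\<integral>\<^sup>+N. indicator A N * of_nat (N t - N s) \<partial>Pexp)"
      by (subst integral_eq_nn_integral) (auto simp: indicator_def ennreal_of_nat_eq_real_of_nat intro!: arg_cong[where f=enn2real] nn_integral_cong)
    also have "\<dots> = (t - s) * measure Pexp A"
      using st by (subst unit_comp[OF st A]) (simp add: enn2real_mult measure_def)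
    finally have 1: "(LINT N|Pexp. indicator A N * real (N t - N s)) = (t - s) * measure Pexp A" .
    have iA: "integrable Pexp (\<lambda>N. indicator A N * real (N u))" if "0 \<le> u" for u
      using integrable_mult_indicator[of A Pexp "\<lambda>N. real (N u)"] iN[OF that] by simp
    have iA1: "integrable Pexp (\<lambda>N. indicator A N * c)" for c :: real by (auto intro!: integrable_mult_left integrable_real_indicator simp: emeasure_eq_measure)
    have "(LINT N|Pexp. indicator A N * real (N t - N s)) = (LINT N|Pexp. indicator A N * real (N t) - indicator A N * real (N s))"
    proof (rule Bochner_Integration.integral_cong[OF refl])
      fix N assume "N \<in> space Pexp"
      then show "indicat_real A N * real (N t - N s) = indicat_real A N * real (N t) - indicat_real A N * real (N s)"
        using paths_mono[of N s t] st by (simp add: right_diff_distrib of_nat_diff)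
    qed
    also have "\<dots> = (LINT N|Pexp. indicator A N * real (N t)) - (LINT N|Pexp. indicator A N * real (N s))"
      using iA[of s] iA[of t] st by (intro Bochner_Integration.integral_diff) auto
    finally have 2: "(LINT N|Pexp. indicator A N * real (N t)) - (LINT N|Pexp. indicator A N * real (N s)) = (t - s) * measure Pexp A"
      using 1 by simp
    have 3: "(LINT N:A|Pexp. real (N u) - max 0 u) = (LINT N|Pexp. indicator A N * real (N u)) - u * measure Pexp A" if "0 \<le> u" for u
      unfolding set_lebesgue_integral_def using iA[OF that] iA1[of u] that Int_absorb2[OF Nsig_subset[OF A]]
      by (simp add: right_diff_distrib mult.commute)
    show ?thesis using 2 3[of s] 3[of t] st by (simp add: algebra_simps)
  qed
  show ?thesis unfolding pp_local_martingale_def yint_one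
  proof (intro exI[of _ "\<lambda>n N. real n"] conjI allI ballI)
    show "pp_stopping (\<lambda>N. real n)" for n unfolding pp_stopping_def
    proof (intro conjI allI impI ballI)
      fix t :: real
      show "{N \<in> paths. real n \<le> t} \<in> sets (Nsig t)" using sets.top[of "Nsig t"] by (cases "real n \<le> t") auto
    qed simp
    show "AE N in Pexp. filterlim (\<lambda>n. real n) at_top sequentially" by (simp add: filterlim_real_sequentially)
    fix n
    show "pp_martingale Pexp (\<lambda>N t. real (N (min t (real n))) - max 0 (min t (real n)))"
      unfolding pp_martingale_def
    proof (intro conjI allI impI)
      fix t :: real assume t: "0 \<le> t"
      show "integrable Pexp (\<lambda>N. real (N (min t (real n))) - max 0 (min t (real n)))"
        using iN[of "min t (real n)"] t by auto
      have [measurable]: "(\<lambda>N. N (min t (real n))) \<in> measurable (Nsig t) (count_space UNIV)"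
        by (rule measurable_eval_Nsig) simp
      show "(\<lambda>N. real (N (min t (real n))) - max 0 (min t (real n))) \<in> borel_measurable (Nsig t)" by measurable
    next
      fix s t :: real and A assume st: "0 \<le> s" "s \<le> t" "A \<in> sets (Nsig s)"
      show "(LINT N:A|Pexp. real (N (min t (real n))) - max 0 (min t (real n))) = (LINT N:A|Pexp. real (N (min s (real n))) - max 0 (min s (real n)))"
      proof (cases "s \<le> real n")
        case True
        then show ?thesis using M[of s "min t (real n)" A] st by simp
      next
        case False
        then show ?thesis using st by simp
      qed
    qed
  qed simp
qed

text \<open>The stopped martingale yields the compensator identity between \<open>s\<close> and
  \<open>t\<close>, cut at the localising time. Stopped counts and stopped lengths both increase to
  the full ones, so monotone convergence removes the localisation.\<close>

lemma local_martingale_unit_measure: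
  assumes mu: "sets \<mu> = sets Ninf" "prob_space \<mu>"
    and M: "pp_local_martingale \<mu> (\<lambda>N t. real (N t) - yint (\<lambda>N s. 1) N t)"
  shows "unit_measure \<mu>"
proof -
  interpret prob_space \<mu> by fact
  note [measurable_cong] = mu(1)
  have sp: "space \<mu> = paths" using sets_eq_imp_space_eq[OF mu(1)] by simp
  obtain R where R: "\<And>n. pp_stopping (R n)" "\<And>n N. N \<in> paths \<Longrightarrow> R n N \<le> R (Suc n) N"
      "AE N in \<mu>. filterlim (\<lambda>n. R n N) at_top sequentially"
      "\<And>n. pp_martingale \<mu> (\<lambda>N t. real (N (min t (R n N))) - max 0 (min t (R n N)))"
    using M unfolding pp_local_martingale_def yint_one by blast
  have R0: "0 \<le> R n N" if "N \<in> paths" for n N using R(1)[of n] that by (auto simp: pp_stopping_def)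
  have Rm [measurable]: "R n \<in> borel_measurable Ninf" for n
    unfolding borel_measurable_iff_le
  proof
    fix c
    show "{N \<in> space Ninf. R n N \<le> c} \<in> sets Ninf"
    proof (cases "0 \<le> c")
      case True
      then show ?thesis using R(1)[of n] Nsig_Ninf[of c] by (auto simp: pp_stopping_def)
    next
      case False
      then have "{N \<in> space Ninf. R n N \<le> c} = {}" using R0[of _ n] by fastforce
      then show ?thesis by (simp only: sets.empty_sets)
    qed
  qed
  show ?thesis
  proof
    fix s t :: real and A assume st: "0 \<le> s" "s \<le> t" and A: "A \<in> sets (Nsig s)"
    have [measurable]: "A \<in> sets Ninf" using A Nsig_Ninf by auto
    define Y where "Y n N = N (min t (R n N)) - N (min s (R n N))" for n and N :: cpath
    define Z where "Z n N = min t (R n N) - min s (R n N)" for n and N :: cpath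
    have X: "integrable \<mu> (\<lambda>N. real (N (min u (R n N))))" if "0 \<le> u" for u n
    proof -
      have "integrable \<mu> (\<lambda>N. real (N (min u (R n N))) - max 0 (min u (R n N)))"
        using R(4)[of n] that by (auto simp: pp_martingale_def)
      moreover have "integrable \<mu> (\<lambda>N. max 0 (min u (R n N)))"
        by (rule integrable_const_bound[of _ u]) (use that in auto)
      ultimately have "integrable \<mu> (\<lambda>N. (real (N (min u (R n N))) - max 0 (min u (R n N))) + max 0 (min u (R n N)))"
        by (rule Bochner_Integration.integrable_add)
      then show ?thesis by simp
    qed
    \<comment> \<open>Measurability of the count at a random time comes with the integrability
      contained in the martingale property.\<close>
    have Xm: "(\<lambda>N. real (N (min u (R n N)))) \<in> borel_measurable Ninf" if "0 \<le> u" for u n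
      using X[OF that, of n] by (auto dest!: borel_measurable_integrable simp: measurable_cong_sets[OF mu(1) refl])
    have Yr: "real (Y n N) = real (N (min t (R n N))) - real (N (min s (R n N)))" if "N \<in> paths" for n N
      unfolding Y_def using paths_mono[OF that, of "min s (R n N)" "min t (R n N)"] st by (simp add: of_nat_diff)
    have Ym: "(\<lambda>N. real (Y n N)) \<in> borel_measurable Ninf" for n
    proof -
      have "(\<lambda>N. real (N (min t (R n N))) - real (N (min s (R n N)))) \<in> borel_measurable Ninf"
        by (rule borel_measurable_diff[OF Xm Xm]) (use st in auto)
      then show ?thesis by (rule measurable_cong[THEN iffD1, rotated]) (simp add: Yr)
    qed
    have [measurable]: "Z n \<in> borel_measurable Ninf" for n unfolding Z_def by measurable
    have Z0: "0 \<le> Z n N" for n N unfolding Z_def using st by auto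
    have nn: "(\<integral>\<^sup>+N. indicator A N * ennreal (real (Y n N)) \<partial>\<mu>) = (\<integral>\<^sup>+N. indicator A N * ennreal (Z n N) \<partial>\<mu>)" for n
    proof -
      have m: "(LINT N:A|\<mu>. real (N (min t (R n N))) - max 0 (min t (R n N))) = (LINT N:A|\<mu>. real (N (min s (R n N))) - max 0 (min s (R n N)))"
        using R(4)[of n] st A unfolding pp_martingale_def by blast
      have iN: "integrable \<mu> (\<lambda>N. indicator A N * real (N (min u (R n N))))" if "0 \<le> u" for u
        using integrable_mult_indicator[of A \<mu> "\<lambda>N. real (N (min u (R n N)))"] X[OF that, of n] by (simp add: mu(1))
      have iR: "integrable \<mu> (\<lambda>N. indicator A N * max 0 (min u (R n N)))" if "0 \<le> u" for u
        by (rule integrable_const_bound[of _ u]) (use that in \<open>auto simp: indicator_def\<close>)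
      have s: "(LINT N:A|\<mu>. real (N (min u (R n N))) - max 0 (min u (R n N))) =
         (LINT N|\<mu>. indicator A N * real (N (min u (R n N)))) - (LINT N|\<mu>. indicator A N * max 0 (min u (R n N)))" if "0 \<le> u" for u
        unfolding set_lebesgue_integral_def using iN[OF that] iR[OF that] by (simp add: right_diff_distrib)
      have iY: "integrable \<mu> (\<lambda>N. indicator A N * real (Y n N))"
      proof (rule Bochner_Integration.integrable_cong[OF refl, THEN iffD1])
        show "integrable \<mu> (\<lambda>N. indicator A N * real (N (min t (R n N))) - indicator A N * real (N (min s (R n N))))"
          using iN[of s] iN[of t] st by auto
      qed (simp add: Yr sp right_diff_distrib)
      have iZ: "integrable \<mu> (\<lambda>N. indicator A N * Z n N)"
        by (rule integrable_const_bound[of _ "t - s"]) (use st in \<open>auto simp: indicator_def Z_def\<close>)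
      have "(LINT N|\<mu>. indicator A N * real (Y n N)) = (LINT N|\<mu>. indicator A N * real (N (min t (R n N))) - indicator A N * real (N (min s (R n N))))"
        by (rule Bochner_Integration.integral_cong) (auto simp: Yr sp right_diff_distrib)
      also have "\<dots> = (LINT N|\<mu>. indicator A N * real (N (min t (R n N)))) - (LINT N|\<mu>. indicator A N * real (N (min s (R n N))))"
        using iN[of s] iN[of t] st by (intro Bochner_Integration.integral_diff) auto
      also have "\<dots> = (LINT N|\<mu>. indicator A N * max 0 (min t (R n N))) - (LINT N|\<mu>. indicator A N * max 0 (min s (R n N)))"
        using m s[of s] s[of t] st by linarith
      also have "\<dots> = (LINT N|\<mu>. indicator A N * max 0 (min t (R n N)) - indicator A N * max 0 (min s (R n N)))"
        using iR[of s] iR[of t] st by (intro Bochner_Integration.integral_diff[symmetric]) auto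
      also have "\<dots> = (LINT N|\<mu>. indicator A N * Z n N)"
      proof (rule Bochner_Integration.integral_cong[OF refl])
        fix N assume "N \<in> space \<mu>"
        then have "0 \<le> R n N" using R0 sp by auto
        then show "indicat_real A N * max 0 (min t (R n N)) - indicat_real A N * max 0 (min s (R n N)) = indicat_real A N * Z n N"
          using st by (simp add: Z_def right_diff_distrib max_def)
      qed
      finally have e: "(LINT N|\<mu>. indicator A N * real (Y n N)) = (LINT N|\<mu>. indicator A N * Z n N)" .
      have "(\<integral>\<^sup>+N. indicator A N * ennreal (real (Y n N)) \<partial>\<mu>) = (\<integral>\<^sup>+N. ennreal (indicator A N * real (Y n N)) \<partial>\<mu>)"
        by (rule nn_integral_cong) (auto simp: indicator_def)
      also have "\<dots> = ennreal (LINT N|\<mu>. indicator A N * real (Y n N))"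
        by (rule nn_integral_eq_integral[OF iY]) auto
      also have "\<dots> = (\<integral>\<^sup>+N. ennreal (indicator A N * Z n N) \<partial>\<mu>)"
        unfolding e by (rule nn_integral_eq_integral[OF iZ, symmetric]) (auto simp: Z0)
      also have "\<dots> = (\<integral>\<^sup>+N. indicator A N * ennreal (Z n N) \<partial>\<mu>)"
        by (rule nn_integral_cong) (auto simp: indicator_def)
      finally show ?thesis .
    qed
    have Ymono: "Y n N \<le> Y (Suc n) N" "Z n N \<le> Z (Suc n) N" if N: "N \<in> paths" for n N
    proof -
      have RR: "R n N \<le> R (Suc n) N" by (rule R(2)[OF N])
      then show "Z n N \<le> Z (Suc n) N" unfolding Z_def using st by (auto simp: min_def)
      show "Y n N \<le> Y (Suc n) N"
      proof (cases "R n N \<le> s")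
        case True
        then have "Y n N = 0" using st by (simp add: Y_def)
        then show ?thesis by simp
      next
        case False
        then have "Y n N = N (min t (R n N)) - N s" "Y (Suc n) N = N (min t (R (Suc n) N)) - N s"
          using RR by (auto simp: Y_def)
        moreover have "N (min t (R n N)) \<le> N (min t (R (Suc n) N))" by (rule paths_mono[OF N]) (use RR in auto)
        ultimately show ?thesis by (simp add: diff_le_mono)
      qed
    qed
    have ev: "AE N in \<mu>. \<exists>n. t \<le> R n N"
      using R(3) by eventually_elim (auto simp: filterlim_at_top eventually_sequentially)
    have lim1: "AE N in \<mu>. (SUP n. indicator A N * ennreal (real (Y n N))) = indicator A N * of_nat (N t - N s)"
      using ev AE_space
    proof eventually_elim
      case (elim N)
      then have N: "N \<in> paths" using sp by simp
      obtain n where n: "t \<le> R n N" using elim by blast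
      have Yn: "Y n N = N t - N s" using n st by (simp add: Y_def)
      have Yle: "Y m N \<le> N t - N s" for m
      proof (cases "m \<le> n")
        case True
        have "incseq (\<lambda>m. Y m N)" by (rule incseq_SucI) (rule Ymono[OF N])
        then have "Y m N \<le> Y n N" using True by (rule incseqD)
        then show ?thesis by (simp only: Yn)
      next
        case False
        have "incseq (\<lambda>m. R m N)" by (rule incseq_SucI) (rule R(2)[OF N])
        then have "t \<le> R m N" using n False by (meson incseqD nat_le_linear order_trans)
        then show ?thesis using st by (simp add: Y_def)
      qed
      show ?case
      proof (rule antisym)
        show "(SUP n. indicator A N * ennreal (real (Y n N))) \<le> indicator A N * of_nat (N t - N s)"
          by (intro SUP_least mult_left_mono) (use Yle in \<open>auto simp: ennreal_of_nat_eq_real_of_nat intro!: ennreal_leI\<close>)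
        show "indicator A N * of_nat (N t - N s) \<le> (SUP n. indicator A N * ennreal (real (Y n N)))"
          by (rule SUP_upper2[of n]) (auto simp: Yn ennreal_of_nat_eq_real_of_nat)
      qed
    qed
    have lim2: "AE N in \<mu>. (SUP n. indicator A N * ennreal (Z n N)) = indicator A N * ennreal (t - s)"
      using ev
    proof eventually_elim
      case (elim N)
      then obtain n where n: "t \<le> R n N" by blast
      show ?case
      proof (rule antisym)
        show "(SUP n. indicator A N * ennreal (Z n N)) \<le> indicator A N * ennreal (t - s)"
          by (intro SUP_least mult_left_mono ennreal_leI) (use st in \<open>auto simp: Z_def\<close>)
        show "indicator A N * ennreal (t - s) \<le> (SUP n. indicator A N * ennreal (Z n N))"
          by (rule SUP_upper2[of n]) (use n st in \<open>auto simp: Z_def\<close>)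
      qed
    qed
    have "(\<integral>\<^sup>+N. indicator A N * of_nat (N t - N s) \<partial>\<mu>) = (\<integral>\<^sup>+N. (SUP n. indicator A N * ennreal (real (Y n N))) \<partial>\<mu>)"
      by (rule nn_integral_cong_AE, use lim1 in eventually_elim) simp
    also have "\<dots> = (SUP n. \<integral>\<^sup>+N. indicator A N * ennreal (real (Y n N)) \<partial>\<mu>)"
    proof (rule nn_integral_monotone_convergence_SUP_AE)
      show "AE N in \<mu>. indicator A N * ennreal (real (Y n N)) \<le> indicator A N * ennreal (real (Y (Suc n) N))" for n
        by (rule AE_I2) (use Ymono sp in \<open>auto intro!: mult_left_mono ennreal_leI\<close>)
      show "(\<lambda>N. indicator A N * ennreal (real (Y n N))) \<in> borel_measurable \<mu>" for n using Ym by measurable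
    qed
    also have "\<dots> = (SUP n. \<integral>\<^sup>+N. indicator A N * ennreal (Z n N) \<partial>\<mu>)" by (simp add: nn)
    also have "\<dots> = (\<integral>\<^sup>+N. (SUP n. indicator A N * ennreal (Z n N)) \<partial>\<mu>)"
    proof (rule nn_integral_monotone_convergence_SUP_AE[symmetric])
      show "AE N in \<mu>. indicator A N * ennreal (Z n N) \<le> indicator A N * ennreal (Z (Suc n) N)" for n
        by (rule AE_I2) (use Ymono sp in \<open>auto intro!: mult_left_mono ennreal_leI\<close>)
    qed measurable
    also have "\<dots> = (\<integral>\<^sup>+N. indicator A N * ennreal (t - s) \<partial>\<mu>)"
      by (rule nn_integral_cong_AE, use lim2 in eventually_elim) simp
    also have "\<dots> = ennreal (t - s) * emeasure \<mu> A"
      by (subst nn_integral_multc) (auto simp: mu(1) mult.commute)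
    finally show "(\<integral>\<^sup>+N. indicator A N * of_nat (N t - N s) \<partial>\<mu>) = ennreal (t - s) * emeasure \<mu> A" .
  qed (rule mu(1))
qed

lemma Ppi_eq: "Ppi = Pexp"
  unfolding Ppi_def pi_y_def
proof (rule the_equality)
  show "sets Pexp = sets Ninf \<and> prob_space Pexp \<and> pp_local_martingale Pexp (\<lambda>N t. real (N t) - yint (\<lambda>N s. 1) N t)"
    using local_martingale_Pexp prob_space_Pexp by simp
  fix \<mu> assume "sets \<mu> = sets Ninf \<and> prob_space \<mu> \<and> pp_local_martingale \<mu> (\<lambda>N t. real (N t) - yint (\<lambda>N s. 1) N t)"
  then have "unit_measure \<mu>" by (intro local_martingale_unit_measure) auto
  then show "\<mu> = Pexp" by (rule unit_measure_unique[OF _ unit_measure_Pexp])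
qed

section \<open>Transfer between paths and inter-arrival times\<close>

lemma pathsE_right:
  assumes "N \<in> paths"
  obtains e where "0 < e" "\<And>s. t \<le> s \<Longrightarrow> s < t + e \<Longrightarrow> N s = N t"
proof -
  obtain e where "e > 0 \<and> (\<forall>s. t \<le> s \<and> s < t + e \<longrightarrow> N s = N t)" using paths_right[OF assms, of t] by (rule exE)
  then show ?thesis by (intro that[of e]) blast+
qed

text \<open>Countably many conditions, hence \<open>Ymap\<close> is measurable although its definition tests \<open>Y \<in> paths\<close>.\<close>

lemma paths_countable_iff:
  fixes Y :: cpath
  assumes Y0: "\<And>t. t \<le> 0 \<Longrightarrow> Y t = 0"
    and right: "\<And>t. 0 < t \<Longrightarrow> \<exists>e>0. \<forall>s. t \<le> s \<and> s < t + e \<longrightarrow> Y s = Y t"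
  shows "Y \<in> paths \<longleftrightarrow> (\<forall>q r::rat. q \<le> r \<longrightarrow> Y (of_rat q) \<le> Y (of_rat r)) \<and>
    (\<exists>m::nat. \<forall>q::rat. of_rat q < 1 / real (Suc m) \<longrightarrow> Y (of_rat q) = 0) \<and>
    (\<forall>q::rat. \<forall>k\<le>Y (of_rat q). \<exists>r::rat. Y (of_rat r) = k)"
    (is "_ \<longleftrightarrow> ?M \<and> ?Z \<and> ?S")
proof
  assume N: "Y \<in> paths"
  have M: ?M using paths_mono[OF N] by (simp add: of_rat_less_eq)
  have Z: ?Z
  proof -
    obtain e where e: "0 < e" and ev: "\<And>s. 0 \<le> s \<Longrightarrow> s < 0 + e \<Longrightarrow> Y s = Y 0" by (rule pathsE_right[OF N, of 0]) blast
    from e obtain m where m: "1 / real (Suc m) < e" by (rule nat_approx_posE)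
    have "Y (of_rat q) = 0" if "of_rat q < 1 / real (Suc m)" for q
    proof (cases "0 \<le> (of_rat q :: real)")
      case True
      then have "Y (of_rat q) = Y 0" using that m by (intro ev) auto
      then show ?thesis by (simp add: Y0)
    qed (simp add: Y0)
    then show ?thesis by blast
  qed
  have S: ?S
  proof (intro allI impI)
    fix q :: rat and k assume k: "k \<le> Y (of_rat q)"
    show "\<exists>r::rat. Y (of_rat r) = k"
    proof (cases "k = 0")
      case True
      then show ?thesis by (intro exI[of _ 0]) (simp add: Y0)
    next
      case False
      let ?A = "{t. k \<le> Y t}"
      \<comment> \<open>The first time at which level \<open>k\<close> is reached. It is attained by
        right continuity, jumps of size 1 make the value there exactly \<open>k\<close>, and a
        rational shortly afterwards still has this value.\<close>
      define u where "u = Inf ?A"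
      have ne: "?A \<noteq> {}" using k by blast
      have bd: "bdd_below ?A"
      proof (rule bdd_belowI[of _ 0])
        fix t assume "t \<in> ?A"
        then show "0 \<le> t" using Y0[of t] False by (cases "t \<le> 0") auto
      qed
      have below: "Y s < k" if "s < u" for s
      proof (rule ccontr)
        assume "\<not> Y s < k"
        then have "u \<le> s" unfolding u_def by (intro cInf_lower bd) simp
        then show False using that by simp
      qed
      obtain e where e: "0 < e" and ev: "\<And>s. u \<le> s \<Longrightarrow> s < u + e \<Longrightarrow> Y s = Y u" by (rule pathsE_right[OF N, of u]) blast
      have "Inf ?A < u + e" using e unfolding u_def by simp
      from cInf_lessD[OF ne this] obtain t where t: "k \<le> Y t" "t < u + e" by blast
      have "u \<le> t" unfolding u_def using t by (intro cInf_lower bd) simp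
      then have "Y t = Y u" using t by (intro ev)
      then have ku: "k \<le> Y u" using t by simp
      obtain e' where e': "e' > 0 \<and> (\<forall>s. u - e' < s \<and> s < u \<longrightarrow> Y u \<le> Y s + 1)" using paths_jump[OF N, of u] by (rule exE)
      have "u - e' < u - e' / 2" "u - e' / 2 < u" using conjunct1[OF e'] by simp_all
      then have "Y u \<le> Y (u - e' / 2) + 1" using e' by blast
      moreover have "Y (u - e' / 2) < k" using conjunct1[OF e'] by (intro below) simp
      ultimately have "Y u = k" using ku by linarith
      moreover obtain r where "u < of_rat r" "of_rat r < u + e" using of_rat_dense[of u "u + e"] e by auto
      then have "Y (of_rat r) = Y u" by (intro ev) simp_all
      ultimately show ?thesis by blast
    qed
  qed
  show "?M \<and> ?Z \<and> ?S" using M Z S by blast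
next
  assume H: "?M \<and> ?Z \<and> ?S"
  have approx: "\<exists>q::rat. t \<le> of_rat q \<and> of_rat q < b \<and> Y (of_rat q) = Y t" if "0 < t" "t < b" for t b
  proof -
    from right[OF \<open>0 < t\<close>] obtain e where e: "e > 0 \<and> (\<forall>s. t \<le> s \<and> s < t + e \<longrightarrow> Y s = Y t)" by (rule exE)
    have "t < min b (t + e)" using that conjunct1[OF e] by simp
    from of_rat_dense[OF this] obtain q where q: "t < of_rat q" "of_rat q < min b (t + e)" by blast
    then have "t \<le> of_rat q" "of_rat q < t + e" by simp_all
    then have "Y (of_rat q) = Y t" using conjunct2[OF e] by blast
    then show ?thesis using q by (intro exI[of _ q]) auto
  qed
  have mono: "Y s \<le> Y t" if "s \<le> t" for s t
  proof -
    consider "s \<le> 0" | "s = t" | "0 < s" "s < t" using \<open>s \<le> t\<close> by linarith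
    then show ?thesis
    proof cases
      case 3
      obtain q where q: "of_rat q < t" "Y (of_rat q) = Y s" using approx[of s t] 3 by blast
      obtain r where r: "t \<le> of_rat r" "Y (of_rat r) = Y t" using approx[of t "t + 1"] 3 by auto
      have "(of_rat q :: real) \<le> of_rat r" using q r by linarith
      then have "q \<le> r" by (simp add: of_rat_less_eq)
      then have "Y (of_rat q) \<le> Y (of_rat r)" using H by blast
      then show ?thesis by (simp only: q r)
    qed (auto simp: Y0)
  qed
  have right': "\<exists>e>0. \<forall>s. t \<le> s \<and> s < t + e \<longrightarrow> Y s = Y t" for t
  proof -
    consider "t < 0" | "t = 0" | "0 < t" by linarith
    then show ?thesis
    proof cases
      case 1
      then show ?thesis by (intro exI[of _ "- t"]) (auto simp: Y0)
    next
      case 2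
      \<comment> \<open>\<open>right\<close> covers positive times only; constancy to the right of 0
        is what the second condition provides.\<close>
      obtain m where m: "\<forall>q::rat. of_rat q < 1 / real (Suc m) \<longrightarrow> Y (of_rat q) = 0" using H by blast
      have "Y s = 0" if "0 \<le> s" "s < 1 / real (Suc m)" for s
      proof (cases "s = 0")
        case False
        then obtain q where "of_rat q < 1 / real (Suc m)" "Y (of_rat q) = Y s" using approx[of s "1 / real (Suc m)"] \<open>0 \<le> s\<close> \<open>s < _\<close> by auto
        then show ?thesis using m by metis
      qed (simp add: Y0)
      then show ?thesis using 2 by (intro exI[of _ "1 / real (Suc m)"]) (auto simp: Y0)
    qed (rule right)
  qed
  have jump: "\<exists>e>0. \<forall>s. t - e < s \<and> s < t \<longrightarrow> Y t \<le> Y s + 1" for t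
  proof (cases "Y t \<le> 1")
    case True
    then show ?thesis by (intro exI[of _ 1]) auto
  next
    case False
    then have "0 < t" using Y0[of t] by (cases "0 < t") auto
    obtain q where q: "Y (of_rat q) = Y t" using approx[of t "t + 1"] \<open>0 < t\<close> by auto
    have "Y t - 1 \<le> Y (of_rat q)" by (simp add: q)
    \<comment> \<open>The value just below \<open>Y t\<close> is taken at a rational time,
      necessarily before \<open>t\<close>; by monotonicity the jump at \<open>t\<close> has size at
      most 1.\<close>
    then obtain r where r: "Y (of_rat r) = Y t - 1" using H by blast
    have rt: "of_rat r < t"
    proof (rule ccontr)
      assume "\<not> of_rat r < t"
      then have "Y t \<le> Y (of_rat r)" by (intro mono) simp
      then show False using r False by linarith
    qed
    have "Y t \<le> Y s + 1" if "of_rat r < s" for s using mono[of "of_rat r" s] that r by simp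
    then show ?thesis using rt by (intro exI[of _ "t - of_rat r"]) auto
  qed
  show "Y \<in> paths" unfolding paths_def using Y0 mono right' jump by (auto intro!: monoI)
qed

text \<open>The count at a random time is at least \<open>k\<close> iff jump \<open>k\<close> has
  occurred by then. Comparing two measurable times thus replaces evaluation at a random
  argument.\<close>

lemma measurable_eval_at:
  assumes [measurable]: "f \<in> borel_measurable Ninf"
  shows "{N \<in> paths. N (f N) = k} \<in> sets Ninf"
proof -
  have le: "{N \<in> paths. k \<le> N (f N)} \<in> sets Ninf" for k
  proof (cases "k = 0")
    case True
    then show ?thesis using sets.top[of Ninf] by simp
  next
    case False
    have iff: "k \<le> N u \<longleftrightarrow> (\<exists>m::nat. k \<le> N (real m)) \<and> tau k N \<le> u" if N: "N \<in> paths" for N u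
    proof -
      obtain m :: nat where "u < real m" using reals_Archimedean2 by blast
      then have "k \<le> N (real m)" if "k \<le> N u" using paths_mono[OF N, of u "real m"] that by simp
      then show ?thesis using tau_le_iff[OF N False, of u] by auto
    qed
    have eq: "{N \<in> paths. k \<le> N (f N)} = (\<Union>m::nat. {N \<in> space Ninf. k \<le> N (real m)}) \<inter> {N \<in> space Ninf. tau k N \<le> f N}"
    proof (rule set_eqI)
      fix N
      show "N \<in> {N \<in> paths. k \<le> N (f N)} \<longleftrightarrow>
        N \<in> (\<Union>m::nat. {N \<in> space Ninf. k \<le> N (real m)}) \<inter> {N \<in> space Ninf. tau k N \<le> f N}"
      proof (cases "N \<in> paths")
        case True
        then show ?thesis using iff[OF True, of "f N"] by simp
      qed simp
    qed
    have "{N \<in> space Ninf. k \<le> N (real m)} \<in> sets Ninf" for m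
    proof -
      have "(\<lambda>N. N (real m)) -` {k..} \<inter> space Ninf \<in> sets Ninf"
        by (rule measurable_sets[OF measurable_eval]) simp
      moreover have "(\<lambda>N. N (real m)) -` {k..} \<inter> space Ninf = {N \<in> space Ninf. k \<le> N (real m)}" by auto
      ultimately show ?thesis by simp
    qed
    then show ?thesis unfolding eq
      by (intro sets.Int sets.countable_UN borel_measurable_le tau_meas assms) auto
  qed
  have "{N \<in> paths. N (f N) = k} = {N \<in> paths. k \<le> N (f N)} - {N \<in> paths. Suc k \<le> N (f N)}" by auto
  then show ?thesis using le by auto
qed

text \<open>\<open>R\<close> need not be measurable. A null set of gap sequences is pulled back
  along \<open>gaps_of\<close>, and \<open>N = path_of (gaps_of N)\<close> is tested at rational
  times, which suffices by right continuity. This gives a measurable set of full measure on which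
  \<open>R\<close> holds.\<close>

lemma AE_Pexp_transfer:
  assumes "AE w in expseq. R (path_of w)" shows "AE N in Pexp. R N"
proof -
  have "AE w in expseq. regular w \<and> R (path_of w)" using assms AE_regular by eventually_elim simp
  then obtain B where B: "B \<in> null_sets expseq" "{w. \<not> (regular w \<and> R (path_of w))} \<subseteq> B"
    by (auto simp: eventually_ae_filter)
  have [measurable]: "B \<in> sets seqS" using B sets_expseq by auto
  have pm: "(\<lambda>N. path_of (gaps_of N)) \<in> measurable Ninf Ninf" by measurable
  have e1: "{N \<in> space Ninf. gaps_of N \<notin> B} \<in> sets Ninf" by measurable
  have e2: "{N \<in> space Ninf. \<forall>q::rat. N (of_rat q) = path_of (gaps_of N) (of_rat q)} \<in> sets Ninf"
  proof (rule sets.sets_Collect_countable_All)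
    fix q :: rat
    have [measurable]: "(\<lambda>N. path_of (gaps_of N) (of_rat q)) \<in> measurable Ninf (count_space UNIV)"
      using measurable_comp[OF pm measurable_eval[of "of_rat q"]] by (simp add: comp_def)
    show "{N \<in> space Ninf. N (of_rat q) = path_of (gaps_of N) (of_rat q)} \<in> sets Ninf" by measurable
  qed
  have "{N \<in> paths. gaps_of N \<notin> B \<and> (\<forall>q::rat. N (of_rat q) = path_of (gaps_of N) (of_rat q))} =
    {N \<in> space Ninf. gaps_of N \<notin> B} \<inter> {N \<in> space Ninf. \<forall>q::rat. N (of_rat q) = path_of (gaps_of N) (of_rat q)}" by auto
  then have m: "{N \<in> paths. gaps_of N \<notin> B \<and> (\<forall>q::rat. N (of_rat q) = path_of (gaps_of N) (of_rat q))} \<in> sets Ninf"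
    using e1 e2 by auto
  have "AE w in expseq. w \<notin> B" by (rule AE_not_in[OF B(1)])
  then have "AE w in expseq. gaps_of (path_of w) \<notin> B \<and> (\<forall>q::rat. path_of w (of_rat q) = path_of (gaps_of (path_of w)) (of_rat q))"
  proof eventually_elim
    case (elim w)
    then have "regular w" using B(2) by auto
    then show ?case using elim by (simp add: gaps_of_path_of)
  qed
  then have "AE N in Pexp. gaps_of N \<notin> B \<and> (\<forall>q::rat. N (of_rat q) = path_of (gaps_of N) (of_rat q))"
    by (rule AE_PexpI) (rule m)
  moreover have "AE N in Pexp. N \<in> paths" using AE_space[of Pexp] by simp
  ultimately show ?thesis
  proof eventually_elim
    case (elim N)
    have "N t = path_of (gaps_of N) t" for t
    proof -
      obtain e1 where e1: "0 < e1" "\<And>s. t \<le> s \<Longrightarrow> s < t + e1 \<Longrightarrow> N s = N t"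
        by (rule pathsE_right[OF elim(2)]) blast
      have "path_of (gaps_of N) \<in> paths" by simp
      then obtain e2 where e2: "0 < e2" "\<And>s. t \<le> s \<Longrightarrow> s < t + e2 \<Longrightarrow> path_of (gaps_of N) s = path_of (gaps_of N) t"
        by (rule pathsE_right) blast
      have "t < min (t + e1) (t + e2)" using e1(1) e2(1) by simp
      from of_rat_dense[OF this] obtain q where q: "t < of_rat q" "of_rat q < min (t + e1) (t + e2)" by blast
      have "N t = N (of_rat q)" by (rule e1(2)[symmetric]) (use q in simp_all)
      also have "\<dots> = path_of (gaps_of N) (of_rat q)" using elim(1) by blast
      also have "\<dots> = path_of (gaps_of N) t" by (rule e2(2)) (use q in simp_all)
      finally show ?thesis .
    qed
    then have "N = path_of (gaps_of N)" by (rule ext)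
    moreover have "R (path_of (gaps_of N))" using elim(1) B(2) by auto
    ultimately show ?case by simp
  qed
qed

lemma AE_Pexp_iff: "(AE N in Pexp. R N) \<longleftrightarrow> (AE w in expseq. R (path_of w))"
  using AE_Pexp_transfer AE_PexpD by blast

lemma jumps_path_of:
  assumes w: "regular w" shows "jumps (path_of w) = range (\<lambda>i. arr (Suc i) w)"
proof (intro equalityI subsetI)
  fix x assume "x \<in> jumps (path_of w)"
  then have x: "0 < x" "\<And>s. s < x \<Longrightarrow> path_of w s < path_of w x" by (auto simp: jumps_def)
  define k where "k = path_of w x"
  have "0 < k" using x(2)[of 0] x(1) by (simp add: k_def)
  then have le: "arr k w \<le> x" using le_path_of_iff[OF w, of k x] by (simp add: k_def)
  have "\<not> arr k w < x"
  proof
    assume "arr k w < x"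
    then have "path_of w (arr k w) < k" using x(2) by (simp add: k_def)
    moreover have "k \<le> path_of w (arr k w)" using le_path_of_iff[OF w \<open>0 < k\<close>] by simp
    ultimately show False by simp
  qed
  then have "x = arr (Suc (k - 1)) w" using le \<open>0 < k\<close> by simp
  then show "x \<in> range (\<lambda>i. arr (Suc i) w)" by blast
next
  fix x assume "x \<in> range (\<lambda>i. arr (Suc i) w)"
  then obtain i where x: "x = arr (Suc i) w" by blast
  have "path_of w s < path_of w x" if "s < x" for s
  proof -
    have "\<not> Suc i \<le> path_of w s" using le_path_of_iff[OF w, of "Suc i" s] that x by simp
    moreover have "Suc i \<le> path_of w x" using le_path_of_iff[OF w, of "Suc i" x] x by simp
    ultimately show ?thesis by simp
  qed
  then show "x \<in> jumps (path_of w)" using arr_pos[OF w, of "Suc i"] x by (simp add: jumps_def)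
qed

lemma yint_eq_cumint: "yint ydot N = cumint (ydot N)"
  by (rule ext) (simp add: yint_def cumint_def)

section \<open>The intensity along the jump chain\<close>

locale intensity =
  fixes ydot :: "cpath \<Rightarrow> real \<Rightarrow> real"
  assumes Ppp: "Ppp ydot"
begin

text \<open>The value 1 off the positive times makes the rate positive and jointly measurable on the
  whole line; integrals only see positive times.\<close>

definition rate_of :: "cpath \<Rightarrow> real \<Rightarrow> real" where
  "rate_of N s = (if 0 < s then ydot N s else 1)"

lemma ydot_pred: "(\<lambda>(s, N). ydot N s) \<in> borel_measurable predictable"
  using Ppp by (simp add: Ppp_def)

lemma rate_of_pos: "N \<in> paths \<Longrightarrow> 0 < rate_of N s"
  using Ppp by (auto simp: Ppp_def rate_of_def)

lemma rate_of_meas [measurable]: "(\<lambda>(N, s). rate_of N s) \<in> borel_measurable (Ninf \<Otimes>\<^sub>M borel)"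
proof -
  have "(\<lambda>p. if 0 < fst p then (case p of (s, N) \<Rightarrow> ydot N s) else 1) \<in> borel_measurable (borel \<Otimes>\<^sub>M Ninf)"
    by (rule predictable_extend[OF ydot_pred])
  then have "(\<lambda>p. (\<lambda>p. if 0 < fst p then (case p of (s, N) \<Rightarrow> ydot N s) else 1) (snd p, fst p)) \<in> borel_measurable (Ninf \<Otimes>\<^sub>M borel)"
    by (rule measurable_compose[rotated]) measurable
  then show ?thesis by (simp add: rate_of_def case_prod_beta' cong: if_cong)
qed

lemma rate_of_meas1 [measurable]: "N \<in> paths \<Longrightarrow> rate_of N \<in> borel_measurable borel"
  using measurable_Pair2[OF rate_of_meas, of N] by simp

lemma yint_rate_of: "yint ydot N t = cumint (rate_of N) t"
  unfolding yint_eq_cumint by (rule cumint_cong) (simp add: rate_of_def)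

lemma ystar_rate_of: "ystar ydot N = cuminv (rate_of N)"
  by (rule ext) (simp add: ystar_def cuminv_def yint_rate_of)

lemma rate_of_agree:
  assumes "0 < s" "N \<in> paths" "N' \<in> paths" "\<And>u. u < s \<Longrightarrow> N u = N' u"
  shows "rate_of N s = rate_of N' s"
  using predictable_agree[OF ydot_pred assms] assms(1) by (simp add: rate_of_def)

lemma AE_unbounded_rate_of: "AE N in Pexp. unbounded_rate (rate_of N)"
proof -
  have "AE N in Pexp. (\<forall>t. (\<integral>\<^sup>+ s. ennreal (ydot N s) * indicator {0<..t} s \<partial>lborel) < \<infinity>) \<and>
        filterlim (yint ydot N) at_top at_top"
    using Ppp unfolding Ppp_def Ppi_eq by blast
  moreover have "AE N in Pexp. N \<in> paths" using AE_space[of Pexp] by simp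
  ultimately show ?thesis
  proof eventually_elim
    case (elim N)
    have e: "(\<integral>\<^sup>+ s. ennreal (rate_of N s) * indicator {0<..t} s \<partial>lborel) = (\<integral>\<^sup>+ s. ennreal (ydot N s) * indicator {0<..t} s \<partial>lborel)" for t
      by (rule nn_integral_cong) (auto simp: rate_of_def indicator_def)
    show ?case
    proof
      show "rate_of N \<in> borel_measurable borel" using elim by simp
      show "0 < rate_of N s" for s using elim by (simp add: rate_of_pos)
      show "(\<integral>\<^sup>+ s. ennreal (rate_of N s) * indicator {0<..t} s \<partial>lborel) < \<infinity>" for t using elim e by simp
      fix u
      have "\<forall>\<^sub>F t in at_top. u + 1 \<le> yint ydot N t" using elim by (simp add: filterlim_at_top)
      then obtain t where "u + 1 \<le> yint ydot N t" by (auto simp: eventually_at_top_linorder)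
      then show "\<exists>x. u < cumint (rate_of N) x" by (intro exI[of _ t]) (simp add: yint_rate_of)
    qed
  qed
qed

text \<open>By predictability the intensity at \<open>arr n w + s\<close> depends only on the path
  strictly before that time, so the next jump may be placed exactly there. This defines the rate for
  \<open>s > w n\<close> too, without reference to gap \<open>n\<close>.\<close>

definition gap_rate :: "nat \<Rightarrow> (nat \<Rightarrow> real) \<Rightarrow> real \<Rightarrow> real" where
  "gap_rate n w s = rate_of (path_of (gap_ext n s w)) (arr n w + s)"

lemma gap_rate_eq:
  assumes w: "regular w" and s: "0 < s" "s \<le> w n"
  shows "gap_rate n w s = rate_of (path_of w) (arr n w + s)"
  unfolding gap_rate_def
proof (rule rate_of_agree)
  show "0 < arr n w + s" using arr_nonneg[OF w, of n] s by simp
qed (use path_of_ext_agree[OF w s] in auto)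

lemma gap_rate_nn_integral:
  assumes w: "regular w" and x: "x \<le> w n" and [measurable]: "g \<in> borel_measurable borel"
  shows "(\<integral>\<^sup>+s. g (gap_rate n w s) * indicator {0<..x} s \<partial>lborel) =
    (\<integral>\<^sup>+u. g (rate_of (path_of w) u) * indicator {arr n w<..arr n w + x} u \<partial>lborel)"
proof -
  have [measurable]: "rate_of (path_of w) \<in> borel_measurable borel" by (rule rate_of_meas1) simp
  have "(\<integral>\<^sup>+u. g (rate_of (path_of w) u) * indicator {arr n w<..arr n w + x} u \<partial>lborel) =
    (\<integral>\<^sup>+s. g (rate_of (path_of w) (arr n w + s)) * indicator {0<..x} s \<partial>lborel)"
    by (subst nn_integral_real_affine[where c=1 and t="arr n w"]) (auto intro!: nn_integral_cong simp: indicator_def)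
  also have "\<dots> = (\<integral>\<^sup>+s. g (gap_rate n w s) * indicator {0<..x} s \<partial>lborel)"
    by (rule nn_integral_cong) (use x in \<open>auto simp: indicator_def gap_rate_eq[OF w]\<close>)
  finally show ?thesis by simp
qed

sublocale hazard gap_rate
proof
  fix n
  show "(\<lambda>(w, s). gap_rate n w s) \<in> borel_measurable (seqS \<Otimes>\<^sub>M borel)"
    unfolding gap_rate_def by measurable
  show "0 < gap_rate n w s" for w s unfolding gap_rate_def by (rule rate_of_pos) simp
  show "adapted n (gap_rate n)" unfolding adapted_def
  proof (intro allI impI)
    fix w w' :: "nat \<Rightarrow> real" assume eq: "\<forall>i<n. w i = w' i"
    have "gap_ext n s w = gap_ext n s w'" for s by (rule gap_ext_cong) (use eq in auto)
    moreover have "arr n w = arr n w'" unfolding arr_def using eq by (intro sum.cong) auto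
    ultimately show "gap_rate n w = gap_rate n w'" by (intro ext) (simp add: gap_rate_def)
  qed
next
  have "AE w in expseq. unbounded_rate (rate_of (path_of w))" using AE_unbounded_rate_of by (simp add: AE_Pexp_iff)
  with AE_regular show "AE w in expseq. \<forall>n. (\<integral>\<^sup>+s. ennreal (gap_rate n w s) * indicator {0<..w n} s \<partial>lborel) < \<infinity>"
  proof eventually_elim
    case (elim w)
    interpret y: unbounded_rate "rate_of (path_of w)" by (rule elim(2))
    show ?case
    proof
      fix n
      have "(\<integral>\<^sup>+s. ennreal (gap_rate n w s) * indicator {0<..w n} s \<partial>lborel) =
        (\<integral>\<^sup>+u. ennreal (rate_of (path_of w) u) * indicator {arr n w<..arr n w + w n} u \<partial>lborel)"
        by (rule gap_rate_nn_integral[OF elim(1)]) auto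
      also have "\<dots> \<le> (\<integral>\<^sup>+u. ennreal (rate_of (path_of w) u) * indicator {0<..arr n w + w n} u \<partial>lborel)"
        by (intro nn_integral_mono) (use arr_nonneg[OF elim(1), of n] in \<open>auto simp: indicator_def\<close>)
      also have "\<dots> < \<infinity>" by (rule y.fin)
      finally show "(\<integral>\<^sup>+s. ennreal (gap_rate n w s) * indicator {0<..w n} s \<partial>lborel) < \<infinity>" .
    qed
  qed
qed

section \<open>The time change acting on gaps\<close>

definition good :: "(nat \<Rightarrow> real) \<Rightarrow> bool" where
  "good w \<longleftrightarrow> regular w \<and> (\<forall>n. rate (gap_rate n w)) \<and> unbounded_rate (rate_of (path_of w))"

lemma AE_good: "AE w in expseq. good w"
proof -
  have "AE w in expseq. unbounded_rate (rate_of (path_of w))" using AE_unbounded_rate_of by (simp add: AE_Pexp_iff)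
  with AE_regular AE_rate show ?thesis by eventually_elim (simp add: good_def)
qed

lemma cumint_arr_add:
  assumes g: "good w" and x: "0 \<le> x" "x \<le> w n"
  shows "cumint (rate_of (path_of w)) (arr n w + x) = cumint (rate_of (path_of w)) (arr n w) + cumint (gap_rate n w) x"
proof -
  have w: "regular w" using g by (simp add: good_def)
  interpret y: unbounded_rate "rate_of (path_of w)" using g by (simp add: good_def)
  interpret h: rate "gap_rate n w" using g by (simp add: good_def)
  have "ennreal (cumint (rate_of (path_of w)) (arr n w + x)) = ennreal (cumint (rate_of (path_of w)) (arr n w)) +
    (\<integral>\<^sup>+u. ennreal (rate_of (path_of w) u) * indicator {arr n w<..arr n w + x} u \<partial>lborel)"
    by (rule y.ennreal_cumint_diff) (use arr_nonneg[OF w] x in auto)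
  also have "(\<integral>\<^sup>+u. ennreal (rate_of (path_of w) u) * indicator {arr n w<..arr n w + x} u \<partial>lborel) =
    (\<integral>\<^sup>+s. ennreal (gap_rate n w s) * indicator {0<..x} s \<partial>lborel)"
    by (rule gap_rate_nn_integral[OF w x(2), symmetric]) auto
  also have "\<dots> = ennreal (cumint (gap_rate n w) x)" by (rule h.ennreal_cumint[symmetric])
  also have "ennreal (cumint (rate_of (path_of w)) (arr n w)) + ennreal (cumint (gap_rate n w) x) =
    ennreal (cumint (rate_of (path_of w)) (arr n w) + cumint (gap_rate n w) x)"
    by (rule ennreal_plus[symmetric]) (auto simp: y.cumint_nonneg h.cumint_nonneg)
  finally show ?thesis by (subst (asm) ennreal_inj) (auto simp: y.cumint_nonneg h.cumint_nonneg)
qed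

lemma cumint_arr: "good w \<Longrightarrow> cumint (rate_of (path_of w)) (arr n w) = arr n (new_gaps w)"
proof (induction n)
  case 0
  show ?case by (simp add: cumint_nonpos_arg)
next
  case (Suc n)
  have "regular w" using Suc.prems by (simp add: good_def)
  then have "0 \<le> w n" by (simp add: regular_pos less_imp_le)
  then have "cumint (rate_of (path_of w)) (arr n w + w n) = cumint (rate_of (path_of w)) (arr n w) + cumint (gap_rate n w) (w n)"
    by (intro cumint_arr_add Suc.prems) simp_all
  then show ?case using Suc by (simp add: arr_Suc new_gaps_def)
qed

text \<open>Positivity comes from strict monotonicity of each integrated rate, divergence from
  \<open>y\<close> tending to infinity along the path.\<close>

lemma regular_new_gaps: assumes g: "good w" shows "regular (new_gaps w)"
proof -
  have w: "regular w" using g by (simp add: good_def)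
  interpret y: unbounded_rate "rate_of (path_of w)" using g by (simp add: good_def)
  show ?thesis unfolding regular_def
  proof (intro conjI allI)
    fix i
    interpret h: rate "gap_rate i w" using g by (simp add: good_def)
    show "0 < new_gaps w i" using h.cumint_strict_mono[of 0 "w i"] regular_pos[OF w, of i] by (simp add: new_gaps_def)
  next
    fix m :: nat
    obtain x where x: "real m < cumint (rate_of (path_of w)) x" using y.unbounded by blast
    obtain k where "x < arr (Suc k) w" using regular_exceeds[OF w] by blast
    then have "cumint (rate_of (path_of w)) x \<le> arr (Suc k) (new_gaps w)"
      using y.cumint_mono[of x "arr (Suc k) w"] by (simp add: cumint_arr[OF g])
    then show "\<exists>n. real m \<le> arr n (new_gaps w)" using x by (intro exI[of _ "Suc k"]) simp
  qed
qed

text \<open>Jump \<open>k\<close> has occurred by \<open>y*(t)\<close> iff its image under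
  \<open>y\<close> is at most \<open>t\<close>, and this image is jump \<open>k\<close> of the new
  sequence. The result is a path, so the test in \<open>Ymap\<close> succeeds.\<close>

lemma Ymap_path_of: assumes g: "good w" shows "Ymap ydot (path_of w) = path_of (new_gaps w)"
proof -
  have w: "regular w" using g by (simp add: good_def)
  interpret y: unbounded_rate "rate_of (path_of w)" using g by (simp add: good_def)
  note r = regular_new_gaps[OF g]
  have "(\<lambda>t. if t \<le> 0 then 0 else path_of w (ystar ydot (path_of w) t)) = path_of (new_gaps w)"
  proof (rule ext)
    fix t :: real
    show "(if t \<le> 0 then 0 else path_of w (ystar ydot (path_of w) t)) = path_of (new_gaps w) t"
    proof (cases "t \<le> 0")
      case True
      then show ?thesis using paths_nonpos[of "path_of (new_gaps w)" t] by simp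
    next
      case False
      have "k \<le> path_of w (cuminv (rate_of (path_of w)) t) \<longleftrightarrow> k \<le> path_of (new_gaps w) t" if k: "0 < k" for k
      proof -
        have "k \<le> path_of w (cuminv (rate_of (path_of w)) t) \<longleftrightarrow> arr k w \<le> cuminv (rate_of (path_of w)) t" by (rule le_path_of_iff[OF w k])
        also have "\<dots> \<longleftrightarrow> cumint (rate_of (path_of w)) (arr k w) \<le> t"
          using False arr_nonneg[OF w, of k] by (intro y.le_cuminv_iff) auto
        also have "\<dots> \<longleftrightarrow> k \<le> path_of (new_gaps w) t" unfolding cumint_arr[OF g] by (rule le_path_of_iff[OF r k, symmetric])
        finally show ?thesis .
      qed
      then have "path_of w (cuminv (rate_of (path_of w)) t) = path_of (new_gaps w) t"
        by (metis le_antisym le_refl not_gr_zero zero_le)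
      then show ?thesis using False by (simp add: ystar_rate_of)
    qed
  qed
  then show ?thesis unfolding Ymap_def Let_def by simp
qed

text \<open>The sets \<open>A s\<close> shrink as \<open>s\<close> grows, and a point of
  \<open>A t\<close> close to its infimum stays in \<open>A s\<close> for \<open>s\<close> slightly
  above \<open>t\<close>. The infimum thus moves only to the right and only a little, where the path
  is constant. Arbitrary \<open>b\<close> are allowed because measurability of \<open>Ymap\<close>
  concerns all paths.\<close>

lemma cuminv_right_const:
  fixes b :: "real \<Rightarrow> real"
  assumes N: "N \<in> paths" and t: "0 \<le> t"
  shows "\<exists>e>0. \<forall>s. t \<le> s \<and> s < t + e \<longrightarrow> N (cuminv b s) = N (cuminv b t)"
proof -
  define A where "A s = {x. s < cumint b x}" for s
  have c: "cuminv b s = Inf (A s)" for s by (simp add: cuminv_def A_def)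
  have anti: "A s \<subseteq> A t" if "t \<le> s" for s using that by (auto simp: A_def)
  show ?thesis
  proof (cases "A t = {}")
    case True
    then have "A s = {}" if "t \<le> s" for s using anti[OF that] by simp
    then show ?thesis using True by (intro exI[of _ 1]) (simp add: c)
  next
    case False
    have bd: "bdd_below (A s)" if "0 \<le> s" for s
    proof (rule bdd_belowI[of _ 0])
      fix x assume "x \<in> A s"
      then have "s < cumint b x" by (simp add: A_def)
      then show "0 \<le> x" using that cumint_nonpos_arg[of x b] by (cases "x \<le> 0") auto
    qed
    obtain e where e: "0 < e" and ev: "\<And>s. Inf (A t) \<le> s \<Longrightarrow> s < Inf (A t) + e \<Longrightarrow> N s = N (Inf (A t))"
      by (rule pathsE_right[OF N, of "Inf (A t)"]) blast
    have "Inf (A t) < Inf (A t) + e" using e by simp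
    from cInf_lessD[OF False this] obtain x where x: "x \<in> A t" "x < Inf (A t) + e" by blast
    show ?thesis
    proof (intro exI[of _ "cumint b x - t"] conjI allI impI)
      show "0 < cumint b x - t" using x by (simp add: A_def)
      fix s assume s: "t \<le> s \<and> s < t + (cumint b x - t)"
      then have xs: "x \<in> A s" by (simp add: A_def)
      have "Inf (A s) \<le> x" using s t by (intro cInf_lower xs bd) simp
      moreover have "Inf (A t) \<le> Inf (A s)" using xs s t by (intro cInf_superset_mono bd anti) auto
      ultimately show "N (cuminv b s) = N (cuminv b t)" unfolding c using x by (intro ev) simp_all
    qed
  qed
qed

text \<open>The membership test in \<open>Ymap\<close> is replaced by its countable form, whose
  right-continuity premise holds for every path.\<close>

lemma Ymap_meas [measurable]: "Ymap ydot \<in> measurable Ninf Ninf"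
proof -
  define Y where "Y N = (\<lambda>t. if t \<le> 0 then 0 else N (cuminv (rate_of N) t))" for N :: cpath
  have Y_def': "Ymap ydot N = (if Y N \<in> paths then Y N else (\<lambda>_. 0))" for N
    by (simp only: Ymap_def Let_def Y_def ystar_rate_of)
  have zero: "(\<lambda>_. 0) \<in> paths" by (auto simp: paths_def mono_def intro!: exI[of _ 1])
  have Ym: "{N \<in> paths. Y N t = k} \<in> sets Ninf" for t k
  proof (cases "t \<le> 0")
    case True
    then have "{N \<in> paths. Y N t = k} = (if k = 0 then paths else {})" by (auto simp: Y_def)
    then show ?thesis using sets.top[of Ninf] by simp
  next
    case False
    have "(\<lambda>N. cuminv (rate_of N) t) \<in> borel_measurable Ninf" by measurable
    then have "{N \<in> paths. N (cuminv (rate_of N) t) = k} \<in> sets Ninf" by (rule measurable_eval_at)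
    then show ?thesis using False by (simp add: Y_def)
  qed
  have [measurable]: "(\<lambda>N. Y N t) \<in> measurable Ninf (count_space UNIV)" for t
  proof (rule measurableI)
    fix B :: "nat set"
    have "(\<lambda>N. Y N t) -` B \<inter> space Ninf = (\<Union>k\<in>B. {N \<in> paths. Y N t = k})" by auto
    then show "(\<lambda>N. Y N t) -` B \<inter> space Ninf \<in> sets Ninf" using Ym by (simp add: sets.countable_UN')
  qed simp
  have iff: "Y N \<in> paths \<longleftrightarrow> (\<forall>q r::rat. q \<le> r \<longrightarrow> Y N (of_rat q) \<le> Y N (of_rat r)) \<and>
    (\<exists>m::nat. \<forall>q::rat. of_rat q < 1 / real (Suc m) \<longrightarrow> Y N (of_rat q) = 0) \<and>
    (\<forall>q::rat. \<forall>k\<le>Y N (of_rat q). \<exists>r::rat. Y N (of_rat r) = k)" if N: "N \<in> paths" for N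
  proof (rule paths_countable_iff)
    show "Y N t = 0" if "t \<le> 0" for t using that by (simp add: Y_def)
    fix t :: real assume t: "0 < t"
    have YN: "Y N s = N (cuminv (rate_of N) s)" if "t \<le> s" for s using that t by (simp add: Y_def)
    show "\<exists>e>0. \<forall>s. t \<le> s \<and> s < t + e \<longrightarrow> Y N s = Y N t"
      using cuminv_right_const[OF N less_imp_le[OF t], of "rate_of N"]
    proof (rule ex_forward)
      fix e assume e: "e > 0 \<and> (\<forall>s. t \<le> s \<and> s < t + e \<longrightarrow> N (cuminv (rate_of N) s) = N (cuminv (rate_of N) t))"
      have "Y N s = Y N t" if "t \<le> s \<and> s < t + e" for s
        unfolding YN[OF conjunct1[OF that]] YN[OF order_refl] using e that by blast
      then show "e > 0 \<and> (\<forall>s. t \<le> s \<and> s < t + e \<longrightarrow> Y N s = Y N t)" using e by blast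
    qed
  qed
  have P: "{N \<in> paths. Y N \<in> paths} \<in> sets Ninf"
  proof -
    have "{N \<in> paths. Y N \<in> paths} = {N \<in> space Ninf. (\<forall>q r::rat. q \<le> r \<longrightarrow> Y N (of_rat q) \<le> Y N (of_rat r)) \<and>
      (\<exists>m::nat. \<forall>q::rat. of_rat q < 1 / real (Suc m) \<longrightarrow> Y N (of_rat q) = 0) \<and>
      (\<forall>q::rat. \<forall>k. k \<le> Y N (of_rat q) \<longrightarrow> (\<exists>r::rat. Y N (of_rat r) = k))}"
      by (rule Collect_cong, rule conj_cong, simp, rule iff) simp
    also have "\<dots> \<in> sets Ninf" by measurable
    finally show ?thesis .
  qed
  show ?thesis
  proof (rule measurable_NinfI)
    fix N assume "N \<in> space Ninf"
    show "Ymap ydot N \<in> paths" using zero by (simp add: Y_def')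
  next
    fix s k
    have "{N \<in> space Ninf. Ymap ydot N s = k} = ({N \<in> paths. Y N \<in> paths} \<inter> {N \<in> paths. Y N s = k}) \<union>
      (if k = 0 then paths - {N \<in> paths. Y N \<in> paths} else {})" by (auto simp: Y_def')
    then show "{N \<in> space Ninf. Ymap ydot N s = k} \<in> sets Ninf"
      using P Ym[of s k] sets.compl_sets[OF P] by auto
  qed
qed

text \<open>\<open>(1/a) * ln (1/a) - 1/a + 1\<close> times \<open>a\<close> is
  \<open>a - 1 - ln a\<close>. The special value of \<open>mfun\<close> at -1 does not occur since
  \<open>1/a\<close> is positive; the factor \<open>a\<close> is the Jacobian of the time
  change.\<close>

lemma mfun_mult:
  assumes a: "0 < a" shows "ennreal (mfun (inverse a - 1)) * ennreal a = ennreal (log_gap a)"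
proof -
  have "mfun (inverse a - 1) * a = log_gap a"
    using a by (simp add: mfun_def log_gap_def ln_inverse algebra_simps)
  then show ?thesis using a by (simp add: ennreal_mult''[symmetric])
qed

text \<open>Almost everywhere \<open>ydstar\<close> at \<open>t\<close> is the reciprocal of the
  rate at \<open>cuminv t\<close>; substituting \<open>t = cumint x\<close> supplies the factor
  required by \<open>mfun_mult\<close>.\<close>

lemma nn_integral_mfun_ydstar:
  assumes N: "N \<in> paths" and "unbounded_rate (rate_of N)"
  shows "(\<integral>\<^sup>+ s. ennreal (mfun (ydstar ydot N s - 1)) * indicator {0<..} s \<partial>lborel) =
    (\<integral>\<^sup>+ s. ennreal (log_gap (rate_of N s)) * indicator {0<..} s \<partial>lborel)"
proof -
  interpret unbounded_rate "rate_of N" by fact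
  have [measurable]: "rate_of N \<in> borel_measurable borel" by (rule rate_of_meas1[OF N])
  have [measurable]: "mfun \<in> borel_measurable borel" unfolding mfun_def by measurable
  define inv where "inv t = (if 0 \<le> t then cuminv (rate_of N) t else 0)" for t
  have [measurable]: "inv \<in> borel_measurable borel" unfolding inv_def by (rule measurable_cuminv_pos)
  define g where "g t = ennreal (mfun (inverse (rate_of N (inv t)) - 1))" for t
  have "(\<integral>\<^sup>+ s. ennreal (mfun (ydstar ydot N s - 1)) * indicator {0<..} s \<partial>lborel) = (\<integral>\<^sup>+ s. g s * indicator {0<..} s \<partial>lborel)"
  proof (rule nn_integral_cong_AE, use AE_derivative_cuminv in eventually_elim)
    case (elim t)
    show ?case
    proof (cases "0 < t")
      case True
      then have d: "(cuminv (rate_of N) has_real_derivative inverse (rate_of N (cuminv (rate_of N) t))) (at t)" using elim by simp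
      then have "cuminv (rate_of N) differentiable (at t)"
        unfolding differentiable_def has_field_derivative_def by blast
      then have "ydstar ydot N t = inverse (rate_of N (cuminv (rate_of N) t))"
        using DERIV_imp_deriv[OF d] by (simp add: ydstar_def ystar_rate_of)
      then show ?thesis using True by (simp add: g_def inv_def)
    qed simp
  qed
  also have "\<dots> = (\<integral>\<^sup>+x. g (cumint (rate_of N) x) * (ennreal (rate_of N x) * indicator {0<..} x) \<partial>lborel)"
    by (rule nn_integral_rate_subst) (unfold g_def, measurable)
  also have "\<dots> = (\<integral>\<^sup>+ s. ennreal (log_gap (rate_of N s)) * indicator {0<..} s \<partial>lborel)"
  proof (rule nn_integral_cong)
    fix x
    show "g (cumint (rate_of N) x) * (ennreal (rate_of N x) * indicator {0<..} x) = ennreal (log_gap (rate_of N x)) * indicator {0<..} x"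
    proof (cases "0 < x")
      case True
      then have "inv (cumint (rate_of N) x) = x" by (simp add: inv_def cumint_nonneg cuminv_cumint)
      then show ?thesis using mfun_mult[OF rate_of_pos[OF N, of x]] True by (simp add: g_def)
    qed simp
  qed
  finally show ?thesis .
qed

lemma Emm_eq: "Emm ydot = (\<integral>\<^sup>+w. (\<Sum>n. \<integral>\<^sup>+s. ennreal (log_gap (gap_rate n w s)) * indicator {0<..w n} s \<partial>lborel) \<partial>expseq)"
proof -
  have "Emm ydot = (\<integral>\<^sup>+N. (\<integral>\<^sup>+ s. ennreal (log_gap (rate_of N s)) * indicator {0<..} s \<partial>lborel) \<partial>Pexp)"
    unfolding Emm_def Ppi_eq
  proof (rule nn_integral_cong_AE, use AE_unbounded_rate_of AE_space[of Pexp] in eventually_elim)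
    case (elim N)
    then show ?case by (intro nn_integral_mfun_ydstar) auto
  qed
  also have "\<dots> = (\<integral>\<^sup>+w. (\<integral>\<^sup>+ s. ennreal (log_gap (rate_of (path_of w) s)) * indicator {0<..} s \<partial>lborel) \<partial>expseq)"
    by (rule nn_integral_Pexp) measurable
  also have "\<dots> = (\<integral>\<^sup>+w. (\<Sum>n. \<integral>\<^sup>+s. ennreal (log_gap (gap_rate n w s)) * indicator {0<..w n} s \<partial>lborel) \<partial>expseq)"
  proof (rule nn_integral_cong_AE, use AE_regular in eventually_elim)
    case (elim w)
    have [measurable]: "rate_of (path_of w) \<in> borel_measurable borel" by (rule rate_of_meas1) simp
    have "(\<integral>\<^sup>+ s. ennreal (log_gap (rate_of (path_of w) s)) * indicator {0<..} s \<partial>lborel) =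
      (\<Sum>n. \<integral>\<^sup>+s. ennreal (log_gap (rate_of (path_of w) (arr n w + s))) * indicator {0<..w n} s \<partial>lborel)"
      by (rule nn_integral_gaps[OF elim]) measurable
    also have "\<dots> = (\<Sum>n. \<integral>\<^sup>+s. ennreal (log_gap (gap_rate n w s)) * indicator {0<..w n} s \<partial>lborel)"
      by (intro suminf_cong nn_integral_cong) (auto simp: indicator_def gap_rate_eq[OF elim])
    finally show ?case .
  qed
  finally show ?thesis .
qed

end

section \<open>Likelihood, law and entropy of the time-changed path\<close>

locale finite_entropy_intensity = intensity +
  assumes Emm_fin: "Emm ydot < \<infinity>"
begin

sublocale hazard_entropy gap_rate
  by unfold_locales (use Emm_fin in \<open>simp add: Emm_eq\<close>)

lemma Emm_gap_entropy: "Emm ydot = (\<Sum>n. gap_entropy n)"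
  unfolding Emm_eq by (rule suminf_gap_entropy)

text \<open>The \<open>n\<close> gaps completed by time \<open>t\<close> make up
  \<open>lik n\<close>; the remaining term belongs to the unfinished gap, which contributes drift
  but no jump.\<close>

lemma log_Lambda_eq:
  assumes g: "good w" and t: "0 < t"
  defines "n \<equiv> path_of w t"
  shows "(\<Sum>x\<in>jumps (path_of w) \<inter> {0<..t}. ln (ydot (path_of w) x)) + (LINT s:{0<..t}|lborel. 1 - ydot (path_of w) s) =
    ln (lik n w) + ((t - arr n w) - cumint (gap_rate n w) (t - arr n w))"
proof -
  have w: "regular w" using g by (simp add: good_def)
  interpret y: unbounded_rate "rate_of (path_of w)" using g by (simp add: good_def)
  have n: "arr n w \<le> t" "t < arr n w + w n"
    using arr_path_of_le[OF w, of t] path_of_less_arr[OF w, of t] t by (auto simp: n_def arr_Suc)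
  have J: "jumps (path_of w) \<inter> {0<..t} = (\<lambda>i. arr (Suc i) w) ` {..<n}"
  proof -
    have "arr (Suc i) w \<le> t \<longleftrightarrow> i < n" for i using le_path_of_iff[OF w, of "Suc i" t] by (auto simp: n_def)
    then show ?thesis unfolding jumps_path_of[OF w] using arr_pos[OF w] by auto
  qed
  have inj: "inj_on (\<lambda>i. arr (Suc i) w) {..<n}"
  proof (rule inj_onI)
    fix i j assume "arr (Suc i) w = arr (Suc j) w"
    then show "i = j" using arr_strict_mono[OF w, of "Suc i" "Suc j"] arr_strict_mono[OF w, of "Suc j" "Suc i"] by (cases i j rule: linorder_cases) auto
  qed
  have ln_gap_rate: "ln (ydot (path_of w) (arr (Suc i) w)) = ln (gap_rate i w (w i))" for i
    using gap_rate_eq[OF w, of "w i" i] regular_pos[OF w, of i] arr_pos[OF w, of "Suc i"] by (simp add: arr_Suc rate_of_def)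
  have S: "(\<Sum>x\<in>jumps (path_of w) \<inter> {0<..t}. ln (ydot (path_of w) x)) = (\<Sum>i<n. ln (gap_rate i w (w i)))"
    unfolding J by (subst sum.reindex[OF inj]) (simp add: ln_gap_rate)
  have one: "set_integrable lborel {0<..t} (\<lambda>s. 1 :: real)"
    using t by (simp add: set_integrable_def integrable_indicator_iff)
  have "(LINT s:{0<..t}|lborel. 1 - ydot (path_of w) s) = (LINT s:{0<..t}|lborel. 1 - rate_of (path_of w) s)"
    unfolding set_lebesgue_integral_def
    by (rule Bochner_Integration.integral_cong) (auto simp: indicator_def rate_of_def)
  also have "\<dots> = (LINT s:{0<..t}|lborel. 1) - (LINT s:{0<..t}|lborel. rate_of (path_of w) s)"
    by (rule set_integral_diff(2)[OF one y.set_integrable_rate])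
  also have "\<dots> = t - cumint (rate_of (path_of w)) t"
    unfolding y.cumint_eq_LINT using t by (simp add: set_lebesgue_integral_def)
  also have "cumint (rate_of (path_of w)) t = arr n (new_gaps w) + cumint (gap_rate n w) (t - arr n w)"
    using cumint_arr_add[OF g, of "t - arr n w" n] n by (simp add: cumint_arr[OF g])
  finally have I: "(LINT s:{0<..t}|lborel. 1 - ydot (path_of w) s) = t - (arr n (new_gaps w) + cumint (gap_rate n w) (t - arr n w))" .
  have "ln (lik n w) = (\<Sum>i<n. ln (gap_rate i w (w i))) + (arr n w - arr n (new_gaps w))"
    by (subst ln_lik) (auto simp: regular_pos[OF w] sum.distrib sum_subtractf arr_def)
  then show ?thesis unfolding S I by simp
qed

text \<open>Along the jump counts the exponent follows \<open>ln (lik n w)\<close>, and the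
  unfinished gap changes it by at most the integral of \<open>|1 - a|\<close> over the whole gap,
  which tends to 0.\<close>

lemma Lambda_path_of: "AE w in expseq. Lambda ydot (path_of w) = exp (logLam w)"
  using AE_good ln_lik_tendsto gap_integral_tendsto_0
proof eventually_elim
  case (elim w)
  note g = elim(1)
  have w: "regular w" using g by (simp add: good_def)
  have flim: "filterlim (\<lambda>t. path_of w t) sequentially at_top"
    unfolding filterlim_at_top
  proof
    fix k
    have "\<forall>\<^sub>F t in at_top. arr (Suc k) w \<le> t" by (rule eventually_ge_at_top)
    then show "\<forall>\<^sub>F t in at_top. k \<le> path_of w t"
      by eventually_elim (use le_path_of_iff[OF w, of "Suc k"] in \<open>auto dest: Suc_leD\<close>)
  qed
  define dev where "dev t = (t - arr (path_of w t) w) - cumint (gap_rate (path_of w t) w) (t - arr (path_of w t) w)" for t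
  define V where "V n = (\<integral>\<^sup>+s. ennreal \<bar>1 - gap_rate n w s\<bar> * indicator {0<..w n} s \<partial>lborel)" for n
  have dev: "ennreal \<bar>dev t\<bar> \<le> V (path_of w t)" if t: "0 < t" for t
  proof -
    define n where "n = path_of w t"
    define x where "x = t - arr n w"
    have x: "0 \<le> x" "x \<le> w n"
      using arr_path_of_le[OF w, of t] path_of_less_arr[OF w, of t] t by (auto simp: n_def x_def arr_Suc)
    interpret h: rate "gap_rate n w" using g by (simp add: good_def)
    have one: "set_integrable lborel {0<..x} (\<lambda>s. 1 :: real)"
      using x by (simp add: set_integrable_def integrable_indicator_iff)
    have "dev t = (LINT s:{0<..x}|lborel. 1) - (LINT s:{0<..x}|lborel. gap_rate n w s)"
      unfolding dev_def n_def[symmetric] x_def[symmetric] h.cumint_eq_LINT using x by (simp add: set_lebesgue_integral_def)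
    also have "\<dots> = (LINT s:{0<..x}|lborel. 1 - gap_rate n w s)"
      by (rule set_integral_diff(2)[OF one h.set_integrable_rate, symmetric])
    finally have "ennreal \<bar>dev t\<bar> \<le> (\<integral>\<^sup>+s. ennreal \<bar>1 - gap_rate n w s\<bar> * indicator {0<..x} s \<partial>lborel)"
      using abs_LINT_Ioc_le[of x "\<lambda>s. 1 - gap_rate n w s"] by simp
    also have "\<dots> \<le> V n" unfolding V_def
      by (intro nn_integral_mono) (use x in \<open>auto simp: indicator_def\<close>)
    finally show ?thesis by (simp add: n_def)
  qed
  have V0: "((\<lambda>t. V (path_of w t)) \<longlongrightarrow> 0) at_top"
    using filterlim_compose[OF elim(3) flim] by (simp add: V_def)
  have "((\<lambda>t. ennreal \<bar>dev t\<bar>) \<longlongrightarrow> 0) at_top"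
  proof (rule tendsto_sandwich[OF _ _ tendsto_const V0])
    show "\<forall>\<^sub>F t in at_top. ennreal \<bar>dev t\<bar> \<le> V (path_of w t)"
      using eventually_gt_at_top[of 0] by eventually_elim (rule dev)
  qed simp
  then have "((\<lambda>t. ennreal \<bar>dev t\<bar>) \<longlongrightarrow> ennreal 0) at_top" by simp
  then have "((\<lambda>t. \<bar>dev t\<bar>) \<longlongrightarrow> 0) at_top" by (subst (asm) tendsto_ennreal_iff) auto
  then have dev0: "(dev \<longlongrightarrow> 0) at_top" by (rule tendsto_rabs_zero_cancel)
  have "((\<lambda>t. exp (ln (lik (path_of w t) w) + dev t)) \<longlongrightarrow> exp (logLam w + 0)) at_top"
    by (intro tendsto_exp tendsto_add dev0 filterlim_compose[OF elim(2) flim])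
  then have "((\<lambda>t. exp ((\<Sum>x\<in>jumps (path_of w) \<inter> {0<..t}. ln (ydot (path_of w) x)) + (LINT s:{0<..t}|lborel. 1 - ydot (path_of w) s)))
    \<longlongrightarrow> exp (logLam w + 0)) at_top"
  proof (rule Lim_transform_eventually)
    show "\<forall>\<^sub>F t in at_top. exp (ln (lik (path_of w t) w) + dev t) =
      exp ((\<Sum>x\<in>jumps (path_of w) \<inter> {0<..t}. ln (ydot (path_of w) x)) + (LINT s:{0<..t}|lborel. 1 - ydot (path_of w) s))"
      using eventually_gt_at_top[of 0] by eventually_elim (simp add: log_Lambda_eq[OF g] dev_def)
  qed
  then show ?case unfolding Lambda_def by (intro tendsto_Lim) auto
qed

end

locale unit_intensity = finite_entropy_intensity +
  assumes unit: "(\<integral>\<^sup>+ N. ennreal (Lambda ydot N) \<partial>Ppi) = 1"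
begin

sublocale hazard_unit gap_rate "\<lambda>w. exp (logLam w)"
proof
  show "(\<lambda>w. exp (logLam w)) \<in> borel_measurable seqS" by measurable
  show "AE w in expseq. (\<lambda>n. lik n w) \<longlonglongrightarrow> exp (logLam w)" by (rule lik_tendsto)
  \<comment> \<open>Writing \<open>Lambda\<close> as a function of \<open>gaps_of N\<close> supplies
    the measurability needed to transport the integral.\<close>
  have "AE w in expseq. Lambda ydot (path_of w) = exp (logLam (gaps_of (path_of w)))"
    using Lambda_path_of AE_regular by eventually_elim (simp add: gaps_of_path_of)
  then have "AE N in Pexp. Lambda ydot N = exp (logLam (gaps_of N))" by (rule AE_Pexp_transfer)
  then have "(\<integral>\<^sup>+ N. ennreal (Lambda ydot N) \<partial>Ppi) = (\<integral>\<^sup>+ N. ennreal (exp (logLam (gaps_of N))) \<partial>Pexp)"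
    unfolding Ppi_eq by (intro nn_integral_cong_AE) (auto elim!: eventually_mono)
  also have "\<dots> = (\<integral>\<^sup>+ w. ennreal (exp (logLam (gaps_of (path_of w)))) \<partial>expseq)"
    by (rule nn_integral_Pexp) measurable
  also have "\<dots> = (\<integral>\<^sup>+ w. ennreal (exp (logLam w)) \<partial>expseq)"
    by (rule nn_integral_cong_AE, use AE_regular in eventually_elim) (simp add: gaps_of_path_of)
  finally show "(\<integral>\<^sup>+ w. ennreal (exp (logLam w)) \<partial>expseq) = 1" using unit by simp
qed

lemma old_gaps_new_gaps_AE: "AE w in expseq. old_gaps (new_gaps w) = w"
  using AE_unbounded_rate AE_expseq_pos by eventually_elim (auto intro: old_gaps_new_gaps)

definition Zmap :: "cpath \<Rightarrow> cpath" where
  "Zmap N = path_of (old_gaps (gaps_of N))"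

lemma Zmap_meas: "Zmap \<in> measurable Ninf Ninf"
  unfolding Zmap_def by measurable

lemma Zmap_Ymap: "AE N in Ppi. Zmap (Ymap ydot N) = N"
  unfolding Ppi_eq AE_Pexp_iff
  using AE_good old_gaps_new_gaps_AE
proof eventually_elim
  case (elim w)
  then show ?case by (simp add: Zmap_def Ymap_path_of regular_new_gaps gaps_of_path_of)
qed

definition Ldens :: "cpath \<Rightarrow> real" where
  "Ldens N = exp (- logLam (old_gaps (gaps_of N)))"

lemma Ldens_meas [measurable]: "Ldens \<in> borel_measurable Ninf"
  unfolding Ldens_def by measurable

text \<open>On gaps, \<open>nn_integral_new_gaps\<close> inserts the weight
  \<open>exp (logLam w)\<close> and the new gaps at once. Since the old gaps are recovered from
  these, the density cancels the weight and the law of \<open>Ymap\<close> remains.\<close>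

lemma distr_Ymap: "distr Pexp Ninf (Ymap ydot) = density Pexp (\<lambda>N. ennreal (Ldens N))"
proof (rule measure_eqI)
  show "sets (distr Pexp Ninf (Ymap ydot)) = sets (density Pexp (\<lambda>N. ennreal (Ldens N)))" by simp
  fix A assume "A \<in> sets (distr Pexp Ninf (Ymap ydot))"
  then have [measurable]: "A \<in> sets Ninf" by simp
  have "emeasure (density Pexp (\<lambda>N. ennreal (Ldens N))) A = (\<integral>\<^sup>+N. ennreal (Ldens N) * indicator A N \<partial>Pexp)"
    by (rule emeasure_density) auto
  also have "\<dots> = (\<integral>\<^sup>+w. ennreal (Ldens (path_of w)) * indicator A (path_of w) \<partial>expseq)"
    by (rule nn_integral_Pexp) measurable
  also have "\<dots> = (\<integral>\<^sup>+w. ennreal (exp (- logLam (old_gaps w))) * indicator A (path_of w) \<partial>expseq)"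
    by (rule nn_integral_cong_AE, use AE_regular in eventually_elim) (simp add: Ldens_def gaps_of_path_of)
  also have "\<dots> = (\<integral>\<^sup>+w. ennreal (exp (logLam w)) * (ennreal (exp (- logLam (old_gaps (new_gaps w)))) * indicator A (path_of (new_gaps w))) \<partial>expseq)"
    by (rule nn_integral_new_gaps[symmetric]) measurable
  also have "\<dots> = (\<integral>\<^sup>+w. indicator A (Ymap ydot (path_of w)) \<partial>expseq)"
  proof (rule nn_integral_cong_AE, use AE_good old_gaps_new_gaps_AE in eventually_elim)
    case (elim w)
    have "ennreal (exp (logLam w)) * ennreal (exp (- logLam w)) = 1"
      by (simp add: ennreal_mult[symmetric] exp_add[symmetric])
    then show ?case using elim by (simp add: Ymap_path_of mult.assoc[symmetric])
  qed
  also have "\<dots> = (\<integral>\<^sup>+N. indicator A (Ymap ydot N) \<partial>Pexp)"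
    by (rule nn_integral_Pexp[symmetric]) measurable
  also have "\<dots> = (\<integral>\<^sup>+N. indicator A N \<partial>distr Pexp Ninf (Ymap ydot))"
    by (rule nn_integral_distr[symmetric]) auto
  also have "\<dots> = emeasure (distr Pexp Ninf (Ymap ydot)) A" by simp
  finally show "emeasure (distr Pexp Ninf (Ymap ydot)) A = emeasure (density Pexp (\<lambda>N. ennreal (Ldens N))) A" by simp
qed

lemma absolutely_continuous_Ymap: "absolutely_continuous Pexp (distr Pexp Ninf (Ymap ydot))"
  unfolding distr_Ymap by (rule absolutely_continuousI_density) measurable

text \<open>Under the law of \<open>Ymap\<close> the logarithm of the density is distributed as
  \<open>- logLam\<close> under \<open>expseq\<close>. Its positive and negative parts have finite
  means, so the difference in \<open>relent\<close> is well defined and equals the entropy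
  series.\<close>

lemma relent_Ymap: "relent (distr Ppi Ninf (Ymap ydot)) Ppi = enn2ereal (Emm ydot)"
proof -
  let ?\<nu> = "distr Pexp Ninf (Ymap ydot)"
  interpret P: prob_space Pexp by (rule prob_space_Pexp)
  have "AE N in Pexp. ennreal (Ldens N) = RN_deriv Pexp ?\<nu> N"
    by (rule P.RN_deriv_unique) (auto simp: distr_Ymap)
  \<comment> \<open>The derivative is determined almost everywhere for \<open>Pexp\<close>; absolute
    continuity carries this over to the law of \<open>Ymap\<close>, under which the entropy is
    taken.\<close>
  then have "AE N in ?\<nu>. ennreal (Ldens N) = RN_deriv Pexp ?\<nu> N"
    by (rule absolutely_continuous_AE[OF _ absolutely_continuous_Ymap, rotated]) simp
  then have ln: "AE N in ?\<nu>. ln (enn2real (RN_deriv Pexp ?\<nu> N)) = - logLam (old_gaps (gaps_of N))"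
  proof eventually_elim
    case (elim N)
    have "enn2real (RN_deriv Pexp ?\<nu> N) = Ldens N" unfolding elim[symmetric] by (simp add: Ldens_def)
    then show ?case by (simp add: Ldens_def)
  qed
  have int: "(\<integral>\<^sup>+N. ennreal (f (ln (enn2real (RN_deriv Pexp ?\<nu> N)))) \<partial>?\<nu>) = (\<integral>\<^sup>+w. ennreal (f (- logLam w)) \<partial>expseq)"
    if [measurable]: "f \<in> borel_measurable borel" for f :: "real \<Rightarrow> real"
  proof -
    have "(\<integral>\<^sup>+N. ennreal (f (ln (enn2real (RN_deriv Pexp ?\<nu> N)))) \<partial>?\<nu>) = (\<integral>\<^sup>+N. ennreal (f (- logLam (old_gaps (gaps_of N)))) \<partial>?\<nu>)"
      by (rule nn_integral_cong_AE, use ln in eventually_elim) simp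
    also have "\<dots> = (\<integral>\<^sup>+N. ennreal (f (- logLam (old_gaps (gaps_of (Ymap ydot N))))) \<partial>Pexp)"
      by (rule nn_integral_distr) auto
    also have "\<dots> = (\<integral>\<^sup>+w. ennreal (f (- logLam (old_gaps (gaps_of (Ymap ydot (path_of w)))))) \<partial>expseq)"
      by (rule nn_integral_Pexp) measurable
    also have "\<dots> = (\<integral>\<^sup>+w. ennreal (f (- logLam w)) \<partial>expseq)"
    proof (rule nn_integral_cong_AE, use AE_good old_gaps_new_gaps_AE in eventually_elim)
      case (elim w)
      then show ?case by (simp add: Ymap_path_of regular_new_gaps gaps_of_path_of)
    qed
    finally show ?thesis .
  qed
  define A where "A = (\<integral>\<^sup>+w. ennreal (- logLam w) \<partial>expseq)"
  define B where "B = (\<integral>\<^sup>+w. ennreal (logLam w) \<partial>expseq)"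
  have fin: "A \<noteq> \<infinity>" "B \<noteq> \<infinity>"
    using logLam_integrable by (auto simp: real_integrable_def A_def B_def)
  have "enn2real B - enn2real A = - enn2real (Emm ydot)"
    using logLam_mean real_lebesgue_integral_def[OF logLam_integrable] by (simp add: A_def B_def Emm_gap_entropy)
  then have AB: "enn2real A - enn2real B = enn2real (Emm ydot)" by simp
  have "relent ?\<nu> Pexp = enn2ereal A - enn2ereal B"
    unfolding relent_def using absolutely_continuous_Ymap int[of "\<lambda>x. x"] int[of "\<lambda>x. - x"] by (simp add: A_def B_def)
  also have "\<dots> = ereal (enn2real A) - ereal (enn2real B)"
    using fin by (cases A; cases B) (auto simp: enn2ereal_ennreal)
  also have "\<dots> = ereal (enn2real (Emm ydot))" by (simp add: AB)
  also have "\<dots> = enn2ereal (Emm ydot)"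
    using Emm_fin by (cases "Emm ydot") (auto simp: enn2ereal_ennreal)
  finally show ?thesis by (simp add: Ppi_eq)
qed

lemma left_invertible_Ymap: "left_invertible ydot"
  unfolding left_invertible_def using absolutely_continuous_Ymap Zmap_meas Zmap_Ymap by (auto simp: Ppi_eq)

end

theorem mainTheorem12:
  fixes ydot :: "cpath \<Rightarrow> real \<Rightarrow> real"
  assumes "Ppp2 ydot (pi_y ydot)"
    and "(\<integral>\<^sup>+ N. ennreal (Lambda ydot N) \<partial>Ppi) = 1"
    and "Emm ydot < \<infinity>"
    and "absolutely_continuous Ppi (distr Ppi Ninf (Ymap ydot))"
  shows "relent (distr Ppi Ninf (Ymap ydot)) Ppi \<le> enn2ereal (Emm ydot) \<and>
    (left_invertible ydot \<longleftrightarrow> relent (distr Ppi Ninf (Ymap ydot)) Ppi = enn2ereal (Emm ydot))"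
proof -
  interpret unit_intensity ydot
    by unfold_locales (use assms in \<open>auto simp: Ppp2_def\<close>)
  \<comment> \<open>The inequality holds as an equality, and in the equivalence both sides are
    true.\<close>
  show ?thesis using relent_Ymap left_invertible_Ymap by simp
qed

end
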